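(* For every $\eta>0$ there exists a Banach space $X$ with the Daugavet property such that, for every free ultrafilter $\mathcal U$ over $\mathbb N$, the closed unit ball of the ultrapower $(X)_{\mathcal U}$ has a slice of diameter smaller than or equal to $\eta$.
   Context: Banach spaces are over the scalar field $\mathbb R$ or $\mathbb C$ and are assumed non-zero. For a Banach space $X$, $B_X$ and $S_X$ denote the closed unit ball and the unit sphere, and $X^*$ the topological dual. A slice of $B_X$ is a set of the form $\{x\in B_X: \operatorname{Re} f(x)>\sup_{y\in B_X} \operatorname{Re} f(y)-\beta\}$ with $f\in X^*$ and $\beta>0$. $X$ has the Daugavet property if for every slice $S$ of $B_X$, every $x\in S_X$ and every $\varepsilon>0$ there exists $y\in S$ satisfying $\Vert x-y\Vert>2-\varepsilon$. For a free ultrafilter $\mathcal U$ over $\mathbb N$, the ultrapower $(X)_{\mathcal U}$ is the quotient of the Banach space of bounded sequences in $X$ (sup norm) by the closed subspace of those sequences $(x_n)$ with $\lim_{\mathcal U}\Vert x_n\Vert=0$; its norm satisfies $\Vert(x_n)_{\mathcal U}\Vert=\lim_{\mathcal U}\Vert x_n\Vert$. *)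

theory Defs
  imports "HOL-Analysis.Analysis"
begin

text \<open>
  The theorem asserts that a Banach space exists, and an ultrapower is a quotient of a space of
  sequences, so Banach spaces are carriers with explicit operations instead of instances of the type
  class \<open>banach\<close>. Both scalar fields are covered at once: \<open>K\<close> is a set of complex numbers, either
  \<open>\<real>\<close> or \<open>UNIV\<close>, and only the values of \<open>scale\<close> at scalars in \<open>K\<close> and at points of the carrier
  matter.
\<close>

record 'a nspace =
  carrier :: "'a set"
  zero :: 'a
  add :: "'a \<Rightarrow> 'a \<Rightarrow> 'a"
  scale :: "complex \<Rightarrow> 'a \<Rightarrow> 'a"
  nrm :: "'a \<Rightarrow> real"

definition diff :: "'a nspace \<Rightarrow> 'a \<Rightarrow> 'a \<Rightarrow> 'a" where
  "diff X x y = add X x (scale X (- 1) y)"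

locale normed_space =
  fixes K :: "complex set" and X :: "'a nspace"
  assumes scalars: "K = \<real> \<or> K = UNIV"
    and zero_closed: "zero X \<in> carrier X"
    and add_closed: "\<lbrakk>x \<in> carrier X; y \<in> carrier X\<rbrakk> \<Longrightarrow> add X x y \<in> carrier X"
    and scale_closed: "\<lbrakk>a \<in> K; x \<in> carrier X\<rbrakk> \<Longrightarrow> scale X a x \<in> carrier X"
    and add_assoc: "\<lbrakk>x \<in> carrier X; y \<in> carrier X; z \<in> carrier X\<rbrakk>
      \<Longrightarrow> add X (add X x y) z = add X x (add X y z)"
    and add_commute: "\<lbrakk>x \<in> carrier X; y \<in> carrier X\<rbrakk> \<Longrightarrow> add X x y = add X y x"
    and add_zero: "x \<in> carrier X \<Longrightarrow> add X x (zero X) = x"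
    and diff_self: "x \<in> carrier X \<Longrightarrow> diff X x x = zero X"
    and scale_add: "\<lbrakk>a \<in> K; x \<in> carrier X; y \<in> carrier X\<rbrakk>
      \<Longrightarrow> scale X a (add X x y) = add X (scale X a x) (scale X a y)"
    and add_scale: "\<lbrakk>a \<in> K; b \<in> K; x \<in> carrier X\<rbrakk>
      \<Longrightarrow> scale X (a + b) x = add X (scale X a x) (scale X b x)"
    and scale_scale: "\<lbrakk>a \<in> K; b \<in> K; x \<in> carrier X\<rbrakk>
      \<Longrightarrow> scale X a (scale X b x) = scale X (a * b) x"
    and scale_one: "x \<in> carrier X \<Longrightarrow> scale X 1 x = x"
    and nrm_nonneg: "x \<in> carrier X \<Longrightarrow> 0 \<le> nrm X x"
    and nrm_eq_0: "x \<in> carrier X \<Longrightarrow> nrm X x = 0 \<longleftrightarrow> x = zero X"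
    and nrm_add: "\<lbrakk>x \<in> carrier X; y \<in> carrier X\<rbrakk> \<Longrightarrow> nrm X (add X x y) \<le> nrm X x + nrm X y"
    and nrm_scale: "\<lbrakk>a \<in> K; x \<in> carrier X\<rbrakk> \<Longrightarrow> nrm X (scale X a x) = norm a * nrm X x"

locale banach_space = normed_space +
  assumes nonzero: "\<exists>x \<in> carrier X. x \<noteq> zero X"
    and complete: "\<lbrakk>\<And>n. x n \<in> carrier X;
        \<And>e. e > 0 \<Longrightarrow> \<exists>N. \<forall>m\<ge>N. \<forall>n\<ge>N. nrm X (diff X (x m) (x n)) < e\<rbrakk>
      \<Longrightarrow> \<exists>l \<in> carrier X. (\<lambda>n. nrm X (diff X (x n) l)) \<longlonglongrightarrow> 0"

definition unit_ball :: "'a nspace \<Rightarrow> 'a set" where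
  "unit_ball X = {x \<in> carrier X. nrm X x \<le> 1}"

definition unit_sphere :: "'a nspace \<Rightarrow> 'a set" where
  "unit_sphere X = {x \<in> carrier X. nrm X x = 1}"

text \<open>Functionals are total functions on the underlying type; their values off the carrier are
  irrelevant.\<close>

definition dual :: "complex set \<Rightarrow> 'a nspace \<Rightarrow> ('a \<Rightarrow> complex) set" where
  "dual K X = {f.
     (\<forall>x \<in> carrier X. f x \<in> K) \<and>
     (\<forall>x \<in> carrier X. \<forall>y \<in> carrier X. f (add X x y) = f x + f y) \<and>
     (\<forall>a \<in> K. \<forall>x \<in> carrier X. f (scale X a x) = a * f x) \<and>
     (\<exists>C. \<forall>x \<in> carrier X. norm (f x) \<le> C * nrm X x)}"

definition slices :: "complex set \<Rightarrow> 'a nspace \<Rightarrow> 'a set set" where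
  "slices K X = {{x \<in> unit_ball X. Re (f x) > (SUP y \<in> unit_ball X. Re (f y)) - \<beta>} | f \<beta>.
     f \<in> dual K X \<and> \<beta> > 0}"

definition daugavet_property :: "complex set \<Rightarrow> 'a nspace \<Rightarrow> bool" where
  "daugavet_property K X \<longleftrightarrow>
     (\<forall>S \<in> slices K X. \<forall>x \<in> unit_sphere X. \<forall>\<epsilon>>0. \<exists>y \<in> S. nrm X (diff X x y) > 2 - \<epsilon>)"

text \<open>Same convention as \<open>diameter\<close>, which needs a metric on the whole type.\<close>

definition diam :: "'a nspace \<Rightarrow> 'a set \<Rightarrow> real" where
  "diam X S = (if S = {} then 0 else SUP (x, y) \<in> S \<times> S. nrm X (diff X x y))"

definition coset :: "'a nspace \<Rightarrow> 'a set \<Rightarrow> 'a \<Rightarrow> 'a set" where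
  "coset X Y x = {y \<in> carrier X. diff X y x \<in> Y}"

text \<open>For a closed subspace \<open>Y\<close>. The cosets in the unions below all coincide, since the operations
  do not depend on the representatives.\<close>

definition quotient_space :: "'a nspace \<Rightarrow> 'a set \<Rightarrow> 'a set nspace" where
  "quotient_space X Y = \<lparr>
     carrier = coset X Y ` carrier X,
     zero = coset X Y (zero X),
     add = (\<lambda>A B. \<Union>x \<in> A. \<Union>y \<in> B. coset X Y (add X x y)),
     scale = (\<lambda>a A. \<Union>x \<in> A. coset X Y (scale X a x)),
     nrm = (\<lambda>A. INF x \<in> A. nrm X x)\<rparr>"

definition bounded_seqs :: "'a nspace \<Rightarrow> (nat \<Rightarrow> 'a) nspace" where
  "bounded_seqs X = \<lparr>
     carrier = {x. (\<forall>n. x n \<in> carrier X) \<and> bdd_above (range (\<lambda>n. nrm X (x n)))},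
     zero = (\<lambda>n. zero X),
     add = (\<lambda>x y n. add X (x n) (y n)),
     scale = (\<lambda>a x n. scale X a (x n)),
     nrm = (\<lambda>x. SUP n. nrm X (x n))\<rparr>"

definition free_ultrafilter :: "'i filter \<Rightarrow> bool" where
  "free_ultrafilter \<U> \<longleftrightarrow>
     \<U> \<noteq> bot \<and>
     (\<forall>P. (\<forall>\<^sub>F i in \<U>. P i) \<or> (\<forall>\<^sub>F i in \<U>. \<not> P i)) \<and>
     (\<forall>j. \<forall>\<^sub>F i in \<U>. i \<noteq> j)"

definition null_seqs :: "nat filter \<Rightarrow> 'a nspace \<Rightarrow> (nat \<Rightarrow> 'a) set" where
  "null_seqs \<U> X = {x \<in> carrier (bounded_seqs X). ((\<lambda>n. nrm X (x n)) \<longlongrightarrow> 0) \<U>}"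

definition ultrapower :: "nat filter \<Rightarrow> 'a nspace \<Rightarrow> (nat \<Rightarrow> 'a) set nspace" where
  "ultrapower \<U> X = quotient_space (bounded_seqs X) (null_seqs \<U> X)"

text \<open>HOL cannot quantify existentially over types, so the points of the space to be found are taken
  from a fixed type of cardinality \<open>2\<close> to the power \<open>2\<close> to the power continuum. Every Banach space
  of at most this cardinality is isometrically isomorphic to one whose carrier is a set of such
  points.\<close>

type_synonym point = "((nat \<Rightarrow> real) \<Rightarrow> complex) set"

context normed_space
begin

lemma minus_one_mem: "- 1 \<in> K"
  using scalars by auto

lemma zero_mem: "0 \<in> K"
  using scalars by auto

lemma diff_closed: "\<lbrakk>x \<in> carrier X; y \<in> carrier X\<rbrakk> \<Longrightarrow> diff X x y \<in> carrier X"
  unfolding diff_def using add_closed scale_closed minus_one_mem by blast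

lemma add_diff_cancel: "\<lbrakk>x \<in> carrier X; y \<in> carrier X\<rbrakk> \<Longrightarrow> add X (diff X x y) y = x"
  using add_assoc[of x "scale X (- 1) y" y] add_commute[of "scale X (- 1) y" y] diff_self[of y]
    add_zero[of x] scale_closed[OF minus_one_mem, of y]
  by (simp add: diff_def)

lemma nrm_diff_commute:
  assumes "x \<in> carrier X" "y \<in> carrier X"
  shows "nrm X (diff X x y) = nrm X (diff X y x)"
proof -
  have m: "scale X (- 1) x \<in> carrier X" "scale X (- 1) y \<in> carrier X"
    using assms scale_closed minus_one_mem by auto
  have "scale X (- 1) (diff X x y) = add X (scale X (- 1) x) y"
    unfolding diff_def using assms m
    by (simp add: scale_add minus_one_mem scale_scale scale_one)
  also have "\<dots> = diff X y x"
    unfolding diff_def using assms m add_commute by simp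
  finally show ?thesis
    using nrm_scale[OF minus_one_mem diff_closed[OF assms]] by simp
qed

lemma nrm_diff_ge:
  assumes "x \<in> carrier X" "y \<in> carrier X"
  shows "\<bar>nrm X x - nrm X y\<bar> \<le> nrm X (diff X x y)"
proof -
  have "nrm X u \<le> nrm X (diff X u v) + nrm X v" if "u \<in> carrier X" "v \<in> carrier X" for u v
    using nrm_add[OF diff_closed[OF that] that(2)] add_diff_cancel[OF that] by simp
  from this[OF assms] this[OF assms(2,1)] show ?thesis
    using nrm_diff_commute[OF assms] by simp
qed

end

lemma ultrafilter_limit_exists:
  fixes f :: "'i \<Rightarrow> real"
  assumes U: "free_ultrafilter \<U>" and bdd: "\<And>i. f i \<in> {a..b}"
  shows "\<exists>l. (f \<longlongrightarrow> l) \<U>"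
proof -
  have "filtermap f \<U> \<noteq> bot"
    using U by (auto simp: free_ultrafilter_def filtermap_bot_iff)
  moreover have "eventually (\<lambda>x. x \<in> {a..b}) (filtermap f \<U>)"
    using bdd by (simp add: eventually_filtermap)
  ultimately obtain l where l: "inf (nhds l) (filtermap f \<U>) \<noteq> bot"
    using compact_Icc[of a b] unfolding compact_filter by (metis eventually_mono)
  have "eventually (\<lambda>i. f i \<in> S) \<U>" if S: "open S" "l \<in> S" for S
  proof (rule ccontr)
    assume "\<not> eventually (\<lambda>i. f i \<in> S) \<U>"
    then have "eventually (\<lambda>i. f i \<notin> S) \<U>"
      using U unfolding free_ultrafilter_def by blast
    then have "eventually (\<lambda>x. x \<notin> S) (filtermap f \<U>)"
      by (simp add: eventually_filtermap)
    moreover have "eventually (\<lambda>x. x \<in> S) (nhds l)"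
      using S by (simp add: eventually_nhds_in_open)
    ultimately have "eventually (\<lambda>x. False) (inf (nhds l) (filtermap f \<U>))"
      unfolding eventually_inf by blast
    then show False using l by (simp add: trivial_limit_def)
  qed
  then show ?thesis by (auto simp: tendsto_def)
qed

lemma bounded_seqsI:
  assumes "\<And>n. x n \<in> carrier X" "\<And>n. nrm X (x n) \<le> M"
  shows "x \<in> carrier (bounded_seqs X)"
  using assms by (auto simp: bounded_seqs_def bdd_above_def)

lemma (in normed_space) nrm_ultrapower:
  assumes U: "free_ultrafilter \<U>" and x: "x \<in> carrier (bounded_seqs X)"
  shows "((\<lambda>n. nrm X (x n)) \<longlongrightarrow>
    nrm (ultrapower \<U> X) (coset (bounded_seqs X) (null_seqs \<U> X) x)) \<U>"
proof -
  let ?C = "coset (bounded_seqs X) (null_seqs \<U> X) x"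
  have xc: "x n \<in> carrier X" for n using x by (simp add: bounded_seqs_def)
  obtain B where B: "\<And>n. nrm X (x n) \<le> B"
    using x by (auto simp: bounded_seqs_def bdd_above_def)
  have nb: "\<U> \<noteq> bot" using U by (simp add: free_ultrafilter_def)
  obtain L where L: "((\<lambda>n. nrm X (x n)) \<longlongrightarrow> L) \<U>"
    using ultrafilter_limit_exists[OF U, of "\<lambda>n. nrm X (x n)" 0 B] B nrm_nonneg[OF xc] by auto
  have L0: "0 \<le> L"
    by (rule tendsto_lowerbound[OF L]) (use nb nrm_nonneg xc in auto)
  have dn: "diff (bounded_seqs X) y x n = diff X (y n) (x n)" for y n
    by (simp add: diff_def bounded_seqs_def)
  have lower: "L \<le> nrm (bounded_seqs X) y" if "y \<in> ?C" for y
  proof -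
    have y: "y \<in> carrier (bounded_seqs X)" and yx: "((\<lambda>n. nrm X (diff X (y n) (x n))) \<longlongrightarrow> 0) \<U>"
      using that by (auto simp: coset_def null_seqs_def dn)
    have yc: "y n \<in> carrier X" for n using y by (simp add: bounded_seqs_def)
    have "((\<lambda>n. nrm X (x n) - nrm X (diff X (y n) (x n))) \<longlongrightarrow> L - 0) \<U>"
      by (intro tendsto_diff L yx)
    moreover have "nrm X (x n) - nrm X (diff X (y n) (x n)) \<le> nrm (bounded_seqs X) y" for n
    proof -
      have "nrm X (y n) \<le> nrm (bounded_seqs X) y"
        using y by (auto simp: bounded_seqs_def intro!: cSUP_upper)
      then show ?thesis using nrm_diff_ge[OF yc xc, of n n] by linarith
    qed
    ultimately have "L - 0 \<le> nrm (bounded_seqs X) y"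
      by (intro tendsto_upperbound[OF _ _ nb]) auto
    then show ?thesis by simp
  qed
  have upper: "\<exists>y \<in> ?C. nrm (bounded_seqs X) y \<le> L + e" if "e > 0" for e
  proof
    let ?y = "\<lambda>n. if nrm X (x n) \<le> L + e then x n else zero X"
    have z: "nrm X (zero X) = 0" using nrm_eq_0 zero_closed by blast
    have le: "nrm X (?y n) \<le> L + e" for n using z L0 that by auto
    then show "nrm (bounded_seqs X) ?y \<le> L + e"
      by (auto simp: bounded_seqs_def intro!: cSUP_least)
    have yc: "?y n \<in> carrier X" for n using xc zero_closed by auto
    have "eventually (\<lambda>n. nrm X (x n) < L + e) \<U>"
      using L that by (intro order_tendstoD) auto
    then have "eventually (\<lambda>n. nrm X (diff X (?y n) (x n)) = 0) \<U>"
      by eventually_elim (use xc diff_self z in auto)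
    then have lim: "((\<lambda>n. nrm X (diff X (?y n) (x n))) \<longlongrightarrow> 0) \<U>"
      by (rule tendsto_eventually)
    have bd: "nrm X (diff X (?y n) (x n)) \<le> L + e + B" for n
    proof -
      have "nrm X (diff X (?y n) (x n)) \<le> nrm X (?y n) + nrm X (scale X (- 1) (x n))"
        unfolding diff_def by (intro nrm_add yc scale_closed minus_one_mem xc)
      also have "\<dots> \<le> L + e + B"
        using le[of n] B[of n] nrm_scale[OF minus_one_mem xc, of n] by simp
      finally show ?thesis .
    qed
    have "diff (bounded_seqs X) ?y x \<in> carrier (bounded_seqs X)"
    proof (rule bounded_seqsI)
      show "diff (bounded_seqs X) ?y x n \<in> carrier X" for n
        unfolding dn by (rule diff_closed[OF yc xc])
      show "nrm X (diff (bounded_seqs X) ?y x n) \<le> L + e + B" for n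
        unfolding dn by (rule bd)
    qed
    then have "diff (bounded_seqs X) ?y x \<in> null_seqs \<U> X"
      unfolding null_seqs_def using lim by (simp only: dn mem_Collect_eq)
    moreover have "?y \<in> carrier (bounded_seqs X)"
      using yc le by (rule bounded_seqsI)
    ultimately show "?y \<in> ?C" by (simp add: coset_def)
  qed
  have "(INF y \<in> ?C. nrm (bounded_seqs X) y) = L"
  proof (rule antisym)
    have bb: "bdd_below (nrm (bounded_seqs X) ` ?C)" using lower by (auto simp: bdd_below_def)
    show "(INF y \<in> ?C. nrm (bounded_seqs X) y) \<le> L"
    proof (rule field_le_epsilon)
      fix e :: real assume "e > 0"
      from upper[OF this] show "(INF y \<in> ?C. nrm (bounded_seqs X) y) \<le> L + e"
        using bb by (meson cINF_lower order_trans)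
    qed
    show "L \<le> (INF y \<in> ?C. nrm (bounded_seqs X) y)"
      using upper[of 1] lower by (intro cINF_greatest) auto
  qed
  then show ?thesis using L by (simp add: ultrapower_def quotient_space_def)
qed

end

theory Submission
  imports Defs "HOL-Library.Function_Algebras"
begin

text \<open>The space is the closure of an increasing union \<open>E\<^sub>0 \<subseteq> E\<^sub>1 \<subseteq> \<dots>\<close> that
starts with the scalar field. A vector of \<open>E\<^sub>n\<^sub>+\<^sub>1\<close> is a multiple
of a fresh unit vector \<open>x\<^sub>n\<close> plus a finite formal sum \<open>z = z\<^sub>0 + \<Sum>\<^sub>k z\<^sub>k \<otimes> g\<^sub>k\<close> with all \<open>z\<^sub>k\<close> in \<open>E\<^sub>n\<close>.
Writing \<open>w = z\<^sub>0 + \<Sum>\<^sub>k z\<^sub>k\<close>, its norm is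
\<open>|c| + \<Sum>\<^sub>j w\<^sub>j sup {\<parallel>w - \<Sum>\<^sub>k\<^sub>\<in>\<^sub>A z\<^sub>k\<parallel> + \<Sum>\<^sub>k\<^sub>\<in>\<^sub>A \<parallel>z\<^sub>k\<parallel> | card A \<le> 4\<^sup>j}\<close> with \<open>w\<^sub>j = d / (1 + d)\<^sup>j\<^sup>+\<^sup>1\<close>,
where \<open>c\<close> is the coefficient of \<open>x\<^sub>n\<close> and \<open>d\<close> decreases geometrically with \<open>n\<close>. The norm sees up to \<open>4\<^sup>j\<close>
of the layers \<open>z\<^sub>k\<close> separately at scale \<open>j\<close> and merges all others; a vector \<open>y\<close> of \<open>E\<^sub>n\<close> is identified
with \<open>y \<otimes> 1\<close>, that is, with \<open>w = y\<close> and no layers.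

The Daugavet property. For \<open>x, y\<close> in \<open>E\<^sub>n\<close> the choice \<open>A = {k}\<close> gives
\<open>\<parallel>x - y \<otimes> g\<^sub>k\<parallel> \<ge> \<parallel>x\<parallel> + \<parallel>y\<parallel>\<close>, while \<open>\<parallel>y \<otimes> g\<^sub>k\<parallel> \<le> \<parallel>y\<parallel>\<close>. The average of \<open>y \<otimes> g\<^sub>k\<close> over \<open>M\<close> values of \<open>k\<close>
tends to \<open>y\<close> as \<open>M \<longrightarrow> \<infinity>\<close>, because at scale \<open>j\<close> only a proportion \<open>4\<^sup>j / M\<close> of it is seen
(\<open>bump_average\<close>). Hence each slice that contains \<open>y\<close> contains some \<open>y \<otimes> g\<^sub>k\<close>.

Small slices of the ultrapower. No bound on \<open>M\<close> is valid at all levels. To exploit this, let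
\<open>\<rho>(z) = \<Sum>\<^sub>j w\<^sub>j (w - \<Sum>\<^sub>k\<^sub>\<in>\<^sub>A\<^sub>j z\<^sub>k) \<in> E\<^sub>n\<close>, where \<open>A\<^sub>j\<close> consists of \<open>4\<^sup>j\<close> heaviest layers of \<open>z\<close>: the part of \<open>z\<close>
that is spread too thinly to be seen. Two facts carry the proof. First,
\<open>\<parallel>z\<parallel> \<ge> \<parallel>\<rho>(z)\<parallel> + \<parallel>z - \<rho>(z)\<parallel> / 3\<close> (\<open>regular_part_split\<close>). Second, \<open>\<rho>\<close> is homogeneous and additive up to a
relative error of order \<open>d\<close> (\<open>regular_part_quasi_additive\<close>): the heavy layers of a few vectors at
scale \<open>j\<close> all fit into one set that is allowed at scale \<open>j + 1\<close>, and the geometric weights make a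
shift of scale by one cost only a factor \<open>1 + d\<close>. Applying \<open>\<rho>\<close> at all levels above \<open>m\<close> and then
taking the coefficient of \<open>x\<^sub>m\<close> yields \<open>c\<^sub>m\<close> on the union with
\<open>\<parallel>v\<parallel> \<ge> |c\<^sub>m(v)| + \<parallel>v - c\<^sub>m(v) x\<^sub>m\<parallel> / 3\<close>, homogeneous and additive up to an error that tends to \<open>0\<close> with
\<open>m\<close> (\<open>regular_coeff_split\<close>, \<open>regular_coeff_quasi_additive\<close>).

No \<open>c\<^sub>m\<close> is additive, as it would define small slices of the unit ball itself. But the limit \<open>\<Phi> = lim\<^sub>\<U> c\<^sub>m\<close> is a linear functional on the ultrapower with
\<open>\<parallel>A\<parallel> \<ge> |\<Phi>(A)| + \<parallel>A - \<Phi>(A) x\<parallel> / 3\<close> for the class \<open>x\<close> of \<open>(x\<^sub>m)\<close>. If \<open>\<parallel>A\<parallel> \<le> 1\<close> and \<open>Re \<Phi>(A) > 1 - b\<close>, then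
\<open>|\<Phi>(A)|\<close> and \<open>\<Phi>(A)\<close> are close to \<open>1\<close>, so \<open>A\<close> is close to \<open>x\<close>: slices of \<open>\<Phi>\<close> are as small as desired
(\<open>small_slice\<close>).\<close>

section \<open>Limits along a free ultrafilter\<close>

lemma free_ultrafilter_le_sequentially:
  assumes "free_ultrafilter \<U>"
  shows "\<U> \<le> sequentially"
proof (rule filter_leI)
  fix P :: "nat \<Rightarrow> bool" assume "eventually P sequentially"
  then obtain M where M: "\<And>n. n \<ge> M \<Longrightarrow> P n" by (auto simp: eventually_sequentially)
  have "eventually (\<lambda>i. \<forall>j\<in>{..<M}. i \<noteq> j) \<U>"
    using assms by (subst eventually_ball_finite_distrib) (auto simp: free_ultrafilter_def)
  then show "eventually P \<U>"
    by eventually_elim (auto intro!: M simp: not_less[symmetric])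
qed

lemma free_ultrafilter_ne_bot: "free_ultrafilter \<U> \<Longrightarrow> \<U> \<noteq> bot"
  by (simp add: free_ultrafilter_def)

lemma ultrafilter_limit_exists_complex:
  fixes f :: "'i \<Rightarrow> complex"
  assumes U: "free_ultrafilter \<U>" and B: "\<And>i. norm (f i) \<le> B"
  shows "\<exists>l. (f \<longlongrightarrow> l) \<U>"
proof -
  have "Re (f i) \<in> {-B..B}" "Im (f i) \<in> {-B..B}" for i
    using B[of i] abs_Re_le_cmod[of "f i"] abs_Im_le_cmod[of "f i"] by auto
  then obtain a b where "((\<lambda>i. Re (f i)) \<longlongrightarrow> a) \<U>" "((\<lambda>i. Im (f i)) \<longlongrightarrow> b) \<U>"
    using ultrafilter_limit_exists[OF U, of "\<lambda>i. Re (f i)" "-B" B]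
      ultrafilter_limit_exists[OF U, of "\<lambda>i. Im (f i)" "-B" B] by blast
  then have "(f \<longlongrightarrow> Complex a b) \<U>" by (simp add: tendsto_complex_iff)
  then show ?thesis ..
qed

section \<open>Operations of an ultrapower on representatives\<close>

context normed_space
begin

lemma one_mem: "1 \<in> K" using scalars by auto

lemma neg_closed: "x \<in> carrier X \<Longrightarrow> scale X (- 1) x \<in> carrier X"
  using scale_closed minus_one_mem by blast

lemma neg_add: "x \<in> carrier X \<Longrightarrow> add X (scale X (- 1) x) x = zero X"
  using diff_self[of x] add_commute[of "scale X (- 1) x" x] neg_closed[of x] by (simp add: diff_def)

lemma zero_add: "x \<in> carrier X \<Longrightarrow> add X (zero X) x = x"
  using add_zero[of x] add_commute[of "zero X" x] zero_closed by simp

lemma nrm_zero: "nrm X (zero X) = 0" using nrm_eq_0 zero_closed by blast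

lemma scale_zero: assumes "x \<in> carrier X" shows "scale X 0 x = zero X"
  using nrm_scale[OF zero_mem assms] nrm_eq_0[OF scale_closed[OF zero_mem assms]] by simp

lemma add_left_commute:
  assumes "x \<in> carrier X" "y \<in> carrier X" "z \<in> carrier X"
  shows "add X x (add X y z) = add X y (add X x z)"
  using assms add_assoc[of x y z] add_assoc[of y x z] add_commute[of x y] by simp

lemma nrm_diff_triangle:
  assumes "x \<in> carrier X" "y \<in> carrier X" "z \<in> carrier X"
  shows "nrm X (diff X x z) \<le> nrm X (diff X x y) + nrm X (diff X y z)"
proof -
  note n = neg_closed[OF assms(2)] neg_closed[OF assms(3)]
  have "add X (scale X (- 1) y) (add X y (scale X (- 1) z)) = scale X (- 1) z"
    using assms n by (simp add: add_assoc[symmetric] neg_add zero_add)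
  then have "add X (diff X x y) (diff X y z) = diff X x z"
    using assms n by (simp add: diff_def add_assoc add_closed)
  then show ?thesis using nrm_add[of "diff X x y" "diff X y z"] assms by (simp add: diff_closed)
qed

lemma nrm_diff_add:
  assumes "x \<in> carrier X" "y \<in> carrier X" "x' \<in> carrier X" "y' \<in> carrier X"
  shows "nrm X (diff X (add X x y) (add X x' y')) \<le> nrm X (diff X x x') + nrm X (diff X y y')"
proof -
  note n = neg_closed[OF assms(3)] neg_closed[OF assms(4)]
  have "diff X (add X x y) (add X x' y') = add X (diff X x x') (diff X y y')"
    using assms n
    by (simp add: diff_def scale_add minus_one_mem add_assoc add_closed add_left_commute[OF assms(2) n])
  then show ?thesis using nrm_add[of "diff X x x'" "diff X y y'"] assms by (simp add: diff_closed)
qed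

lemma nrm_diff_scale:
  assumes "a \<in> K" "x \<in> carrier X" "x' \<in> carrier X"
  shows "nrm X (diff X (scale X a x) (scale X a x')) = norm a * nrm X (diff X x x')"
proof -
  have "diff X (scale X a x) (scale X a x') = scale X a (diff X x x')"
    using assms neg_closed by (simp add: diff_def scale_add scale_scale minus_one_mem)
  then show ?thesis using nrm_scale[OF assms(1) diff_closed[OF assms(2,3)]] by simp
qed

lemma nrm_diff_scale_left:
  assumes "a \<in> K" "b \<in> K" "x \<in> carrier X"
  shows "nrm X (diff X (scale X a x) (scale X b x)) = norm (a - b) * nrm X x"
proof -
  have nb: "- b \<in> K" and ab: "a - b \<in> K" using scalars assms by auto
  have "diff X (scale X a x) (scale X b x) = scale X (a - b) x"
    using assms nb add_scale[of a "- b" x] by (simp add: diff_def scale_scale minus_one_mem)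
  then show ?thesis using nrm_scale[OF ab assms(3)] by simp
qed

lemma nrm_diff_self: "x \<in> carrier X \<Longrightarrow> nrm X (diff X x x) = 0"
  by (simp add: diff_self nrm_zero)

abbreviation "BS \<equiv> carrier (bounded_seqs X)"

lemma BS_D: assumes "x \<in> BS" shows "x n \<in> carrier X" "\<exists>B\<ge>0. \<forall>n. nrm X (x n) \<le> B"
proof -
  show c: "x n \<in> carrier X" for n using assms by (simp add: bounded_seqs_def)
  obtain B where B: "\<And>n. nrm X (x n) \<le> B" using assms by (auto simp: bounded_seqs_def bdd_above_def)
  moreover have "0 \<le> B" using B[of 0] nrm_nonneg[OF c[of 0]] by linarith
  ultimately show "\<exists>B\<ge>0. \<forall>n. nrm X (x n) \<le> B" by blast
qed

lemma BS_add: assumes "x \<in> BS" "y \<in> BS" shows "(\<lambda>n. add X (x n) (y n)) \<in> BS"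
proof -
  obtain B C where B: "\<And>n. nrm X (x n) \<le> B" "\<And>n. nrm X (y n) \<le> C"
    using BS_D(2)[OF assms(1)] BS_D(2)[OF assms(2)] by blast
  show ?thesis
  proof (rule bounded_seqsI)
    show "add X (x n) (y n) \<in> carrier X" for n by (intro add_closed BS_D(1) assms)
    show "nrm X (add X (x n) (y n)) \<le> B + C" for n
      by (rule order_trans[OF nrm_add add_mono[OF B]]) (intro BS_D(1) assms)+
  qed
qed

lemma BS_scale: assumes "a \<in> K" "x \<in> BS" shows "(\<lambda>n. scale X a (x n)) \<in> BS"
proof -
  obtain B where B: "\<And>n. nrm X (x n) \<le> B" using BS_D(2)[OF assms(2)] by blast
  show ?thesis
  proof (rule bounded_seqsI)
    show "scale X a (x n) \<in> carrier X" for n by (intro scale_closed BS_D(1) assms)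
    show "nrm X (scale X a (x n)) \<le> norm a * B" for n
      using nrm_scale[OF assms(1) BS_D(1)[OF assms(2)]] B[of n] by (simp add: mult_left_mono)
  qed
qed

lemma BS_diff: "x \<in> BS \<Longrightarrow> y \<in> BS \<Longrightarrow> (\<lambda>n. diff X (x n) (y n)) \<in> BS"
  unfolding diff_def by (intro BS_add BS_scale minus_one_mem)

abbreviation cls :: "nat filter \<Rightarrow> (nat \<Rightarrow> 'a) \<Rightarrow> (nat \<Rightarrow> 'a) set" where
  "cls \<U> x \<equiv> coset (bounded_seqs X) (null_seqs \<U> X) x"

lemma mem_cls_iff:
  assumes "x \<in> BS"
  shows "y \<in> cls \<U> x \<longleftrightarrow> y \<in> BS \<and> ((\<lambda>n. nrm X (diff X (y n) (x n))) \<longlongrightarrow> 0) \<U>"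
proof -
  have "diff (bounded_seqs X) y x = (\<lambda>n. diff X (y n) (x n))"
    by (simp add: diff_def bounded_seqs_def)
  then show ?thesis using BS_diff[OF _ assms] by (auto simp: coset_def null_seqs_def)
qed

lemma self_mem_cls: "x \<in> BS \<Longrightarrow> x \<in> cls \<U> x"
  by (simp add: mem_cls_iff nrm_diff_self BS_D(1))

text \<open>A class does not depend on the representative, so the unions in the definition of a quotient space
are unions of equal sets. The three lemmas on \<open>add\<close>, \<open>scale\<close> and \<open>diff\<close> below rest on this.\<close>

lemma cls_eqI:
  assumes x: "x \<in> BS" and y: "y \<in> BS" and lim: "((\<lambda>n. nrm X (diff X (x n) (y n))) \<longlongrightarrow> 0) \<U>"
  shows "cls \<U> x = cls \<U> y"
proof -
  have sub: "cls \<U> x \<subseteq> cls \<U> y"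
    if x: "x \<in> BS" and y: "y \<in> BS" and lim: "((\<lambda>n. nrm X (diff X (x n) (y n))) \<longlongrightarrow> 0) \<U>" for x y
  proof
    fix z assume "z \<in> cls \<U> x"
    then have z: "z \<in> BS" and l: "((\<lambda>n. nrm X (diff X (z n) (x n))) \<longlongrightarrow> 0) \<U>"
      using mem_cls_iff[OF x] by auto
    have "((\<lambda>n. nrm X (diff X (z n) (y n))) \<longlongrightarrow> 0) \<U>"
    proof (rule tendsto_sandwich[OF _ _ tendsto_const])
      show "((\<lambda>n. nrm X (diff X (z n) (x n)) + nrm X (diff X (x n) (y n))) \<longlongrightarrow> 0) \<U>"
        using tendsto_add[OF l lim] by simp
    qed (auto intro!: always_eventually nrm_nonneg diff_closed nrm_diff_triangle BS_D(1)[OF x] BS_D(1)[OF y] BS_D(1)[OF z])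
    then show "z \<in> cls \<U> y" using mem_cls_iff[OF y] z by simp
  qed
  have "((\<lambda>n. nrm X (diff X (y n) (x n))) \<longlongrightarrow> 0) \<U>"
    using lim nrm_diff_commute[OF BS_D(1)[OF x] BS_D(1)[OF y]] by simp
  then show ?thesis using sub[OF x y lim] sub[OF y x] by auto
qed

lemma carrier_ultrapower: "carrier (ultrapower \<U> X) = cls \<U> ` BS"
  by (simp add: ultrapower_def quotient_space_def)

lemma add_ultrapower:
  assumes x: "x \<in> BS" and y: "y \<in> BS"
  shows "add (ultrapower \<U> X) (cls \<U> x) (cls \<U> y) = cls \<U> (\<lambda>n. add X (x n) (y n))"
proof -
  have "cls \<U> (\<lambda>n. add X (x' n) (y' n)) = cls \<U> (\<lambda>n. add X (x n) (y n))"
    if "x' \<in> cls \<U> x" "y' \<in> cls \<U> y" for x' y'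
  proof -
    have x': "x' \<in> BS" "((\<lambda>n. nrm X (diff X (x' n) (x n))) \<longlongrightarrow> 0) \<U>"
      and y': "y' \<in> BS" "((\<lambda>n. nrm X (diff X (y' n) (y n))) \<longlongrightarrow> 0) \<U>"
      using that mem_cls_iff x y by auto
    note c = BS_D(1)[OF x] BS_D(1)[OF y] BS_D(1)[OF x'(1)] BS_D(1)[OF y'(1)]
    show ?thesis
    proof (rule cls_eqI[OF BS_add[OF x'(1) y'(1)] BS_add[OF x y]], rule tendsto_sandwich[OF _ _ tendsto_const])
      show "((\<lambda>n. nrm X (diff X (x' n) (x n)) + nrm X (diff X (y' n) (y n))) \<longlongrightarrow> 0) \<U>"
        using tendsto_add[OF x'(2) y'(2)] by simp
    qed (intro always_eventually allI nrm_nonneg diff_closed add_closed nrm_diff_add c)+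
  qed
  then have "(\<Union>x'\<in>cls \<U> x. \<Union>y'\<in>cls \<U> y. cls \<U> (\<lambda>n. add X (x' n) (y' n)))
      = (\<Union>x'\<in>cls \<U> x. \<Union>y'\<in>cls \<U> y. cls \<U> (\<lambda>n. add X (x n) (y n)))"
    by (intro SUP_cong refl)
  also have "\<dots> = cls \<U> (\<lambda>n. add X (x n) (y n))"
    using self_mem_cls[OF x, of \<U>] self_mem_cls[OF y, of \<U>] by blast
  finally show ?thesis by (simp add: ultrapower_def quotient_space_def) (simp add: bounded_seqs_def)
qed

lemma scale_ultrapower:
  assumes a: "a \<in> K" and x: "x \<in> BS"
  shows "scale (ultrapower \<U> X) a (cls \<U> x) = cls \<U> (\<lambda>n. scale X a (x n))"
proof -
  have "cls \<U> (\<lambda>n. scale X a (x' n)) = cls \<U> (\<lambda>n. scale X a (x n))" if "x' \<in> cls \<U> x" for x'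
  proof -
    have x': "x' \<in> BS" "((\<lambda>n. nrm X (diff X (x' n) (x n))) \<longlongrightarrow> 0) \<U>"
      using that mem_cls_iff x by auto
    show ?thesis
    proof (rule cls_eqI[OF BS_scale[OF a x'(1)] BS_scale[OF a x]])
      show "((\<lambda>n. nrm X (diff X (scale X a (x' n)) (scale X a (x n)))) \<longlongrightarrow> 0) \<U>"
        using tendsto_mult_right_zero[OF x'(2), of "norm a"]
        by (simp add: nrm_diff_scale a BS_D(1) x x'(1))
    qed
  qed
  then have "(\<Union>x'\<in>cls \<U> x. cls \<U> (\<lambda>n. scale X a (x' n)))
      = (\<Union>x'\<in>cls \<U> x. cls \<U> (\<lambda>n. scale X a (x n)))"
    by (intro SUP_cong refl)
  also have "\<dots> = cls \<U> (\<lambda>n. scale X a (x n))"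
    using self_mem_cls[OF x, of \<U>] by blast
  finally show ?thesis by (simp add: ultrapower_def quotient_space_def) (simp add: bounded_seqs_def)
qed

lemma diff_ultrapower:
  assumes "x \<in> BS" "y \<in> BS"
  shows "diff (ultrapower \<U> X) (cls \<U> x) (cls \<U> y) = cls \<U> (\<lambda>n. diff X (x n) (y n))"
  using assms by (simp add: diff_def add_ultrapower scale_ultrapower BS_scale minus_one_mem)

end

section \<open>Small slices from asymptotically additive coefficients\<close>

text \<open>The hypotheses are stated on a dense set \<open>E\<close> only, and additivity of \<open>F m\<close> is required in the
perturbed form \<open>F m c \<approx> F m a + F m b\<close> whenever \<open>c \<approx> a + b\<close>. The perturbation is what allows the
coefficients to be carried over to the whole space by approximation, where sums of approximants
approximate sums only up to an error.\<close>

locale asymptotic_coefficients = normed_space +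
  fixes E :: "'a set" and F :: "nat \<Rightarrow> 'a \<Rightarrow> complex" and x :: "nat \<Rightarrow> 'a" and e :: "nat \<Rightarrow> real"
  assumes E_subset: "a \<in> E \<Longrightarrow> a \<in> carrier X"
    and E_scale: "\<lbrakk>k \<in> K; a \<in> E\<rbrakk> \<Longrightarrow> scale X k a \<in> E"
    and E_dense: "\<lbrakk>y \<in> carrier X; \<epsilon> > 0\<rbrakk> \<Longrightarrow> \<exists>a\<in>E. nrm X (diff X y a) < \<epsilon>"
    and F_mem: "a \<in> E \<Longrightarrow> F m a \<in> K"
    and F_scale: "\<lbrakk>k \<in> K; a \<in> E\<rbrakk> \<Longrightarrow> F m (scale X k a) = k * F m a"
    and F_add: "\<lbrakk>a \<in> E; b \<in> E; c \<in> E\<rbrakk> \<Longrightarrow>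
      norm (F m c - F m a - F m b) \<le> 3 * nrm X (diff X c (add X a b)) + e m * (nrm X a + nrm X b)"
    and F_split: "a \<in> E \<Longrightarrow> norm (F m a) + nrm X (diff X a (scale X (F m a) (x m))) / 3 \<le> nrm X a"
    and x_mem: "x m \<in> E" and nrm_x: "nrm X (x m) = 1" and F_x: "F m (x m) = 1"
    and e_nonneg: "0 \<le> e m" and e_lim: "e \<longlonglongrightarrow> 0"
begin

text \<open>Points of \<open>E\<close> are their own approximants, so that the coefficient of \<open>x m\<close> stays exactly \<open>1\<close>.\<close>

definition approximant :: "nat \<Rightarrow> 'a \<Rightarrow> 'a" where
  "approximant m y = (if y \<in> E then y else SOME a. a \<in> E \<and> nrm X (diff X y a) < inverse (real (Suc m)))"

lemma approximant:
  assumes "y \<in> carrier X"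
  shows "approximant m y \<in> E" "nrm X (diff X y (approximant m y)) \<le> inverse (real (Suc m))"
proof -
  have "approximant m y \<in> E \<and> nrm X (diff X y (approximant m y)) \<le> inverse (real (Suc m))"
  proof (cases "y \<in> E")
    case True
    then show ?thesis using nrm_diff_self[OF assms] by (simp add: approximant_def)
  next
    case False
    have "\<exists>a. a \<in> E \<and> nrm X (diff X y a) < inverse (real (Suc m))"
      using E_dense[OF assms, of "inverse (real (Suc m))"] by auto
    from someI_ex[OF this] show ?thesis using False by (simp add: approximant_def)
  qed
  then show "approximant m y \<in> E" "nrm X (diff X y (approximant m y)) \<le> inverse (real (Suc m))" by auto
qed

lemma approximant_carrier: "y \<in> carrier X \<Longrightarrow> approximant m y \<in> carrier X"
  using approximant(1) E_subset by blast

lemma nrm_approximant: "y \<in> carrier X \<Longrightarrow> nrm X (approximant m y) \<le> nrm X y + inverse (real (Suc m))"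
  using approximant(2)[of y m] nrm_diff_ge[of y "approximant m y"] approximant_carrier[of y m] by linarith

definition coeff :: "nat \<Rightarrow> 'a \<Rightarrow> complex" where "coeff m y = F m (approximant m y)"

lemma coeff_mem: "y \<in> carrier X \<Longrightarrow> coeff m y \<in> K" by (simp add: coeff_def F_mem approximant(1))

lemma norm_coeff: assumes "y \<in> carrier X" shows "norm (coeff m y) \<le> nrm X y + inverse (real (Suc m))"
proof -
  have "nrm X (diff X (approximant m y) (scale X (F m (approximant m y)) (x m))) \<ge> 0"
    by (intro nrm_nonneg diff_closed scale_closed approximant_carrier F_mem approximant(1) assms E_subset x_mem)
  then show ?thesis
    using F_split[OF approximant(1)[OF assms], of m m] nrm_approximant[OF assms, of m] by (simp add: coeff_def)
qed

lemma coeff_x: "coeff m (x m) = 1" by (simp add: coeff_def approximant_def x_mem F_x)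

text \<open>By \<open>F_split\<close>, a point whose coefficient almost exhausts its norm is close to a multiple of \<open>x m\<close>.
This is the estimate that makes slices small.\<close>

lemma nrm_diff_x:
  assumes y: "y \<in> carrier X"
  shows "nrm X (diff X y (x m)) \<le> 4 * inverse (real (Suc m)) + 3 * (nrm X y - norm (coeff m y)) + norm (coeff m y - 1)"
proof -
  let ?p = "approximant m y" and ?g = "scale X (coeff m y) (x m)"
  have c: "?p \<in> carrier X" "?g \<in> carrier X" "x m \<in> carrier X"
    using approximant_carrier[OF y] E_subset x_mem scale_closed coeff_mem[OF y] by auto
  have "nrm X (diff X y (x m)) \<le> nrm X (diff X y ?p) + nrm X (diff X ?p (x m))"
    by (intro nrm_diff_triangle y c)
  moreover have "nrm X (diff X ?p (x m)) \<le> nrm X (diff X ?p ?g) + nrm X (diff X ?g (x m))"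
    by (intro nrm_diff_triangle y c)
  moreover have "nrm X (diff X ?g (x m)) = norm (coeff m y - 1)"
    using nrm_diff_scale_left[OF coeff_mem[OF y] one_mem c(3)] by (simp add: scale_one[OF c(3)] nrm_x)
  moreover have "norm (coeff m y) + nrm X (diff X ?p ?g) / 3 \<le> nrm X ?p"
    using F_split[OF approximant(1)[OF y], of m m] by (simp add: coeff_def)
  ultimately have "nrm X (diff X y (x m)) \<le> nrm X (diff X y ?p) + 3 * nrm X ?p - 3 * norm (coeff m y) + norm (coeff m y - 1)"
    by linarith
  also have "\<dots> \<le> inverse (real (Suc m)) + 3 * (nrm X y + inverse (real (Suc m))) - 3 * norm (coeff m y) + norm (coeff m y - 1)"
    by (intro add_mono mult_left_mono diff_right_mono approximant(2) nrm_approximant y) auto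
  also have "\<dots> = 4 * inverse (real (Suc m)) + 3 * (nrm X y - norm (coeff m y)) + norm (coeff m y - 1)"
    by (simp only: ring_distribs)
  finally show ?thesis .
qed

text \<open>The error terms come from the perturbation of \<open>w\<close>, from the three approximants, and from the defect
\<open>e m\<close> of additivity. The last two vanish as \<open>m\<close> grows while the points stay bounded.\<close>

lemma coeff_linear:
  assumes y: "y \<in> carrier X" and z: "z \<in> carrier X" and w: "w \<in> carrier X"
    and a: "a \<in> K" and b: "b \<in> K"
  shows "norm (coeff m w - a * coeff m y - b * coeff m z) \<le>
    3 * nrm X (diff X w (add X (scale X a y) (scale X b z)))
    + 3 * (1 + norm a + norm b) * inverse (real (Suc m))
    + e m * (norm a * (nrm X y + 1) + norm b * (nrm X z + 1))"
proof -
  let ?i = "inverse (real (Suc m))"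
  let ?y = "approximant m y" and ?z = "approximant m z" and ?w = "approximant m w"
  let ?l = "add X (scale X a y) (scale X b z)" and ?l' = "add X (scale X a ?y) (scale X b ?z)"
  have c: "?y \<in> carrier X" "?z \<in> carrier X" "?w \<in> carrier X" using approximant_carrier y z w by auto
  have sc: "scale X a y \<in> carrier X" "scale X b z \<in> carrier X"
    "scale X a ?y \<in> carrier X" "scale X b ?z \<in> carrier X"
    using scale_closed a b y z c by auto
  have l: "?l \<in> carrier X" "?l' \<in> carrier X" using add_closed sc by auto
  have "nrm X (diff X ?w ?l') \<le> nrm X (diff X ?w w) + nrm X (diff X w ?l')"
    by (intro nrm_diff_triangle c w l)
  also have "nrm X (diff X w ?l') \<le> nrm X (diff X w ?l) + nrm X (diff X ?l ?l')"
    by (intro nrm_diff_triangle w l)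
  also have "nrm X (diff X ?l ?l') \<le> nrm X (diff X (scale X a y) (scale X a ?y)) + nrm X (diff X (scale X b z) (scale X b ?z))"
    by (intro nrm_diff_add sc)
  also have "\<dots> \<le> norm a * ?i + norm b * ?i"
    using a b y z c by (simp add: nrm_diff_scale) (intro add_mono mult_left_mono; use approximant(2) in simp)
  also have "nrm X (diff X ?w w) \<le> ?i" using nrm_diff_commute[OF c(3) w] approximant(2)[OF w, of m] by simp
  finally have 1: "nrm X (diff X ?w ?l') \<le> ?i + (nrm X (diff X w ?l) + (norm a * ?i + norm b * ?i))"
    by simp
  have i1: "?i \<le> 1" by (simp add: field_simps)
  have "coeff m w - a * coeff m y - b * coeff m z = F m ?w - F m (scale X a ?y) - F m (scale X b ?z)"
    by (simp add: coeff_def F_scale a b approximant(1) y z)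
  then have "norm (coeff m w - a * coeff m y - b * coeff m z) \<le>
      3 * nrm X (diff X ?w ?l') + e m * (norm a * nrm X ?y + norm b * nrm X ?z)"
    using F_add[OF E_scale[OF a approximant(1)[OF y]] E_scale[OF b approximant(1)[OF z]] approximant(1)[OF w], of m m m m]
    by (simp add: nrm_scale a b c)
  also have "e m * (norm a * nrm X ?y + norm b * nrm X ?z) \<le> e m * (norm a * (nrm X y + 1) + norm b * (nrm X z + 1))"
    using nrm_approximant[OF y, of m] nrm_approximant[OF z, of m] i1
    by (intro mult_left_mono add_mono e_nonneg) auto
  finally show ?thesis using 1 by (simp add: algebra_simps)
qed

context
  fixes \<U> :: "nat filter"
  assumes U: "free_ultrafilter \<U>"
begin

lemma U_ne_bot: "\<U> \<noteq> bot" by (rule free_ultrafilter_ne_bot[OF U])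

lemma tendsto_U: "f \<longlonglongrightarrow> l \<Longrightarrow> (f \<longlongrightarrow> l) \<U>"
  using tendsto_mono[OF free_ultrafilter_le_sequentially[OF U]] .

lemma coeff_linear_lim:
  assumes y: "y \<in> BS" and z: "z \<in> BS" and w: "w \<in> BS" and a: "a \<in> K" and b: "b \<in> K"
    and lim: "((\<lambda>m. nrm X (diff X (w m) (add X (scale X a (y m)) (scale X b (z m))))) \<longlongrightarrow> 0) \<U>"
  shows "((\<lambda>m. coeff m (w m) - a * coeff m (y m) - b * coeff m (z m)) \<longlongrightarrow> 0) \<U>"
proof -
  obtain B C where B: "\<And>n. nrm X (y n) \<le> B" and C: "\<And>n. nrm X (z n) \<le> C"
    using BS_D(2)[OF y] BS_D(2)[OF z] by blast
  let ?r = "\<lambda>m. 3 * nrm X (diff X (w m) (add X (scale X a (y m)) (scale X b (z m))))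
     + 3 * (1 + norm a + norm b) * inverse (real (Suc m)) + e m * (norm a * (B + 1) + norm b * (C + 1))"
  have "(?r \<longlongrightarrow> 3 * 0 + 3 * (1 + norm a + norm b) * 0 + 0 * (norm a * (B + 1) + norm b * (C + 1))) \<U>"
    by (intro tendsto_add tendsto_mult tendsto_const lim
        tendsto_U[OF LIMSEQ_inverse_real_of_nat] tendsto_U[OF e_lim])
  then have "(?r \<longlongrightarrow> 0) \<U>" by (simp only: mult_zero_left mult_zero_right add_0)
  moreover have "norm (coeff m (w m) - a * coeff m (y m) - b * coeff m (z m)) \<le> ?r m" for m
  proof -
    have "e m * (norm a * (nrm X (y m) + 1) + norm b * (nrm X (z m) + 1)) \<le>
        e m * (norm a * (B + 1) + norm b * (C + 1))"
      by (intro mult_left_mono add_mono B C e_nonneg norm_ge_zero order_refl)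
    with coeff_linear[OF BS_D(1)[OF y] BS_D(1)[OF z] BS_D(1)[OF w] a b, of m m m m] show ?thesis
      by linarith
  qed
  ultimately show ?thesis
    using Lim_null_comparison[OF always_eventually, of "\<lambda>m. coeff m (w m) - a * coeff m (y m) - b * coeff m (z m)" ?r \<U>] by blast
qed

text \<open>The limit of the coefficients is the same for all representatives of a class:
\<open>coeff_linear_lim\<close> compares any two of them.\<close>

definition Phi :: "(nat \<Rightarrow> 'a) set \<Rightarrow> complex" where
  "Phi A = (THE l. \<forall>y\<in>A. ((\<lambda>m. coeff m (y m)) \<longlongrightarrow> l) \<U>)"

lemma Phi_lim:
  assumes y: "y \<in> BS"
  shows "((\<lambda>m. coeff m (y m)) \<longlongrightarrow> Phi (cls \<U> y)) \<U>"
proof -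
  obtain B where B: "\<And>n. nrm X (y n) \<le> B" using BS_D(2)[OF y] by blast
  have "norm (coeff m (y m)) \<le> B + 1" for m
  proof -
    have "inverse (real (Suc m)) \<le> 1" by (simp add: field_simps)
    then show ?thesis using norm_coeff[OF BS_D(1)[OF y], of m m] B[of m] by linarith
  qed
  then obtain l where l: "((\<lambda>m. coeff m (y m)) \<longlongrightarrow> l) \<U>"
    using ultrafilter_limit_exists_complex[OF U, of "\<lambda>m. coeff m (y m)" "B + 1"] by blast
  have all: "((\<lambda>m. coeff m (z m)) \<longlongrightarrow> l) \<U>" if "z \<in> cls \<U> y" for z
  proof -
    have z: "z \<in> BS" "((\<lambda>n. nrm X (diff X (z n) (y n))) \<longlongrightarrow> 0) \<U>"
      using that mem_cls_iff[OF y] by auto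
    have "add X (scale X 1 (y m)) (scale X 0 (y m)) = y m" for m
      using BS_D(1)[OF y, of m] by (simp add: scale_one scale_zero add_zero)
    then have "((\<lambda>m. coeff m (z m) - 1 * coeff m (y m) - 0 * coeff m (y m)) \<longlongrightarrow> 0) \<U>"
      using z by (intro coeff_linear_lim y one_mem zero_mem) auto
    from tendsto_add[OF this l] show ?thesis by simp
  qed
  have "Phi (cls \<U> y) = l"
    unfolding Phi_def
  proof (rule the_equality)
    show "\<forall>z\<in>cls \<U> y. ((\<lambda>m. coeff m (z m)) \<longlongrightarrow> l) \<U>" using all by blast
    show "l' = l" if "\<forall>z\<in>cls \<U> y. ((\<lambda>m. coeff m (z m)) \<longlongrightarrow> l') \<U>" for l'
      using that self_mem_cls[OF y] tendsto_unique[OF U_ne_bot _ l] by blast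
  qed
  then show ?thesis using l by simp
qed

lemma Phi_linear:
  assumes y: "y \<in> BS" and z: "z \<in> BS" and a: "a \<in> K" and b: "b \<in> K"
  shows "Phi (cls \<U> (\<lambda>m. add X (scale X a (y m)) (scale X b (z m)))) = a * Phi (cls \<U> y) + b * Phi (cls \<U> z)"
proof -
  let ?w = "\<lambda>m. add X (scale X a (y m)) (scale X b (z m))"
  have w: "?w \<in> BS" by (intro BS_add BS_scale y z a b)
  have "((\<lambda>m. coeff m (?w m) - a * coeff m (y m) - b * coeff m (z m)) \<longlongrightarrow> 0) \<U>"
    by (rule coeff_linear_lim[OF y z w a b]) (simp add: nrm_diff_self BS_D(1)[OF w])
  moreover have "((\<lambda>m. coeff m (?w m) - a * coeff m (y m) - b * coeff m (z m)) \<longlongrightarrow>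
      Phi (cls \<U> ?w) - a * Phi (cls \<U> y) - b * Phi (cls \<U> z)) \<U>"
    by (intro tendsto_intros Phi_lim y z w)
  ultimately have "Phi (cls \<U> ?w) - a * Phi (cls \<U> y) - b * Phi (cls \<U> z) = 0"
    using tendsto_unique[OF U_ne_bot] by blast
  then show ?thesis by (simp add: algebra_simps)
qed

lemma norm_Phi_le:
  assumes y: "y \<in> BS"
  shows "norm (Phi (cls \<U> y)) \<le> nrm (ultrapower \<U> X) (cls \<U> y)"
proof (rule tendsto_le[OF U_ne_bot])
  show "((\<lambda>m. nrm X (y m) + inverse (real (Suc m))) \<longlongrightarrow> nrm (ultrapower \<U> X) (cls \<U> y)) \<U>"
    using tendsto_add[OF nrm_ultrapower[OF U y] tendsto_U[OF LIMSEQ_inverse_real_of_nat]] by simp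
  show "((\<lambda>m. norm (coeff m (y m))) \<longlongrightarrow> norm (Phi (cls \<U> y))) \<U>"
    by (intro tendsto_norm Phi_lim y)
qed (intro always_eventually allI norm_coeff BS_D(1)[OF y])

lemma Phi_dual: "Phi \<in> dual K (ultrapower \<U> X)"
  unfolding dual_def carrier_ultrapower
proof (intro CollectI conjI ballI)
  fix A assume "A \<in> cls \<U> ` BS"
  then obtain y where y: "y \<in> BS" "A = cls \<U> y" by auto
  have "closed K" using scalars by (auto simp: closed_complex_Reals)
  then show "Phi A \<in> K"
    unfolding y(2)
    by (rule Lim_in_closed_set[OF _ _ U_ne_bot Phi_lim[OF y(1)]])
      (auto intro!: always_eventually coeff_mem BS_D(1) y)
next
  fix A B assume "A \<in> cls \<U> ` BS" "B \<in> cls \<U> ` BS"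
  then obtain y z where y: "y \<in> BS" "A = cls \<U> y" and z: "z \<in> BS" "B = cls \<U> z" by auto
  show "Phi (add (ultrapower \<U> X) A B) = Phi A + Phi B"
    using Phi_linear[OF y(1) z(1) one_mem one_mem]
    by (simp add: y z add_ultrapower scale_one BS_D(1))
next
  fix a A assume a: "a \<in> K" and "A \<in> cls \<U> ` BS"
  then obtain y where y: "y \<in> BS" "A = cls \<U> y" by auto
  show "Phi (scale (ultrapower \<U> X) a A) = a * Phi A"
    using Phi_linear[OF y(1) y(1) a zero_mem]
    by (simp add: y scale_ultrapower a scale_zero add_zero scale_closed BS_D(1))
next
  show "\<exists>C. \<forall>A\<in>cls \<U> ` BS. norm (Phi A) \<le> C * nrm (ultrapower \<U> X) A"
    by (rule exI[of _ 1]) (auto simp: norm_Phi_le)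
qed

lemma x_BS: "x \<in> BS"
  by (rule bounded_seqsI[of x X 1]) (auto simp: E_subset x_mem nrm_x)

lemma Phi_x: "Phi (cls \<U> x) = 1"
  using tendsto_unique[OF U_ne_bot Phi_lim[OF x_BS]] by (simp add: coeff_x)

lemma nrm_cls_x: "nrm (ultrapower \<U> X) (cls \<U> x) = 1"
  using tendsto_unique[OF U_ne_bot nrm_ultrapower[OF U x_BS]] by (simp add: nrm_x)

lemma nrm_diff_ultrapower_le:
  assumes y: "y \<in> BS" and z: "z \<in> BS"
    and ball: "nrm (ultrapower \<U> X) (cls \<U> y) \<le> 1" "nrm (ultrapower \<U> X) (cls \<U> z) \<le> 1"
  shows "nrm (ultrapower \<U> X) (diff (ultrapower \<U> X) (cls \<U> y) (cls \<U> z))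
    \<le> 3 * (1 - norm (Phi (cls \<U> y))) + norm (Phi (cls \<U> y) - 1)
     + (3 * (1 - norm (Phi (cls \<U> z))) + norm (Phi (cls \<U> z) - 1))"
proof -
  let ?r = "\<lambda>y m. 4 * inverse (real (Suc m)) + 3 * (nrm X (y m) - norm (coeff m (y m))) + norm (coeff m (y m) - 1)"
  let ?l = "\<lambda>y. 4 * 0 + 3 * (nrm (ultrapower \<U> X) (cls \<U> y) - norm (Phi (cls \<U> y))) + norm (Phi (cls \<U> y) - 1)"
  have r: "(?r y \<longlongrightarrow> ?l y) \<U>" if "y \<in> BS" for y
    by (intro tendsto_intros tendsto_U[OF LIMSEQ_inverse_real_of_nat] nrm_ultrapower[OF U] Phi_lim that)
  have "nrm (ultrapower \<U> X) (cls \<U> (\<lambda>n. diff X (y n) (z n))) \<le> ?l y + ?l z"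
  proof (rule tendsto_le[OF U_ne_bot tendsto_add[OF r[OF y] r[OF z]] nrm_ultrapower[OF U BS_diff[OF y z]]],
      rule always_eventually, rule allI)
    fix m
    have c: "y m \<in> carrier X" "z m \<in> carrier X" "x m \<in> carrier X" using BS_D(1) y z x_BS by auto
    have "nrm X (diff X (y m) (z m)) \<le> nrm X (diff X (y m) (x m)) + nrm X (diff X (x m) (z m))"
      by (intro nrm_diff_triangle c)
    then show "nrm X (diff X (y m) (z m)) \<le> ?r y m + ?r z m"
      using nrm_diff_x[OF c(1), of m] nrm_diff_x[OF c(2), of m] nrm_diff_commute[OF c(3,2)] by linarith
  qed
  then show ?thesis using ball by (simp add: diff_ultrapower[OF y z])
qed

text \<open>On the slice \<open>Re \<Phi> > 1 - b\<close> of the unit ball, \<open>1 - |\<Phi>| \<le> b\<close> and \<open>|\<Phi> - 1|\<^sup>2 \<le> 1 - 2 Re \<Phi> + 1 \<le> 2 b\<close>. Each of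
its points is thus within \<open>3 b + sqrt (2 b) \<le> 5 sqrt b\<close> of the class of \<open>x\<close>, and \<open>b\<close> is chosen to
make twice this bound at most \<open>\<eta>\<close>.\<close>

lemma small_slice:
  assumes \<eta>: "\<eta> > 0"
  shows "\<exists>S \<in> slices K (ultrapower \<U> X). diam (ultrapower \<U> X) S \<le> \<eta>"
proof -
  let ?Y = "ultrapower \<U> X"
  define b where "b = min 1 ((\<eta> / 10)\<^sup>2)"
  have b: "0 < b" "b \<le> 1" using \<eta> by (auto simp: b_def)
  have sb: "sqrt b \<le> \<eta> / 10" "b \<le> sqrt b"
  proof -
    show "sqrt b \<le> \<eta> / 10" using \<eta> by (intro real_le_lsqrt) (auto simp: b_def)
    show "b \<le> sqrt b" using b by (intro real_le_rsqrt) (auto simp: power2_eq_square mult_left_le)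
  qed
  define S where "S = {A \<in> unit_ball ?Y. Re (Phi A) > (SUP A\<in>unit_ball ?Y. Re (Phi A)) - b}"
  have "S \<in> slices K ?Y" unfolding slices_def S_def using Phi_dual b(1) by blast
  moreover have "diam ?Y S \<le> \<eta>"
  proof (cases "S = {}")
    case True
    then show ?thesis using \<eta> by (simp add: diam_def)
  next
    case False
    have le1: "norm (Phi A) \<le> 1" if "A \<in> unit_ball ?Y" for A
      using that norm_Phi_le by (auto simp: unit_ball_def carrier_ultrapower intro: order_trans)
    have xb: "cls \<U> x \<in> unit_ball ?Y"
      using x_BS nrm_cls_x by (auto simp: unit_ball_def carrier_ultrapower)
    have "bdd_above ((\<lambda>A. Re (Phi A)) ` unit_ball ?Y)"
      using le1 complex_Re_le_cmod order_trans by (intro bdd_aboveI2[of _ _ 1]) blast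
    then have sup: "1 \<le> (SUP A\<in>unit_ball ?Y. Re (Phi A))"
      using cSUP_upper[OF xb, of "\<lambda>A. Re (Phi A)"] by (simp add: Phi_x)
    have est: "3 * (1 - norm (Phi A)) + norm (Phi A - 1) \<le> \<eta> / 2" if A: "A \<in> S" for A
    proof -
      have A: "A \<in> unit_ball ?Y" "Re (Phi A) > 1 - b" using A sup by (auto simp: S_def)
      let ?p = "Phi A"
      have "(norm (?p - 1))\<^sup>2 = (norm ?p)\<^sup>2 - 2 * Re ?p + 1"
        unfolding cmod_power2 by (simp add: power2_eq_square algebra_simps)
      also have "\<dots> \<le> (2 * sqrt b)\<^sup>2"
        using A(2) power_le_one[OF norm_ge_zero le1[OF A(1)], of 2] b by (simp add: power_mult_distrib)
      finally have "norm (?p - 1) \<le> 2 * sqrt b"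
        using b by (intro power2_le_imp_le[of "norm (?p - 1)"]) auto
      moreover have "1 - norm ?p \<le> b" using A(2) complex_Re_le_cmod[of ?p] by linarith
      ultimately show ?thesis using sb unfolding right_diff_distrib by linarith
    qed
    have "(SUP (A, B) \<in> S \<times> S. nrm ?Y (diff ?Y A B)) \<le> \<eta>"
    proof (rule cSUP_least)
      fix p assume p: "p \<in> S \<times> S"
      obtain A B where AB: "p = (A, B)" "A \<in> S" "B \<in> S" using p by auto
      then have "A \<in> unit_ball ?Y" "B \<in> unit_ball ?Y" by (auto simp: S_def)
      then obtain y z where y: "y \<in> BS" "A = cls \<U> y" "nrm ?Y (cls \<U> y) \<le> 1"
        and z: "z \<in> BS" "B = cls \<U> z" "nrm ?Y (cls \<U> z) \<le> 1"
        by (auto simp: unit_ball_def carrier_ultrapower)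
      show "(case p of (A, B) \<Rightarrow> nrm ?Y (diff ?Y A B)) \<le> \<eta>"
        using nrm_diff_ultrapower_le[OF y(1) z(1) y(3) z(3)] est[OF AB(2)] est[OF AB(3)]
        by (simp add: AB(1) y(2) z(2))
    qed (use False in auto)
    then show ?thesis using False by (simp add: diam_def)
  qed
  ultimately show ?thesis by blast
qed

end

end

section \<open>Vectors and the norms of the levels\<close>

text \<open>Vectors are functions with pointwise operations. Sums of vectors are kept folded, and
\<open>pointwise\<close> opens them where a single coordinate matters.\<close>

declare plus_fun_apply [simp del] zero_fun_apply [simp del] minus_apply [simp del] uminus_apply [simp del]

lemma sum_fun_apply: "(\<Sum>k\<in>A. f k) s = (\<Sum>k\<in>A. f k s)"
  for f :: "'k \<Rightarrow> 's \<Rightarrow> 'b::comm_monoid_add"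
  by (induction A rule: infinite_finite_induct) (auto simp: plus_fun_apply zero_fun_apply)

lemma suminf_swap_ennreal:
  fixes f :: "nat \<Rightarrow> nat \<Rightarrow> ennreal"
  shows "(\<Sum>i. \<Sum>j. f i j) = (\<Sum>j. \<Sum>i. f i j)"
proof -
  have "(\<Sum>i. \<Sum>j. f i j) = (\<integral>\<^sup>+ i. (\<Sum>j. f i j) \<partial>count_space UNIV)"
    by (simp add: nn_integral_count_space_nat)
  also have "\<dots> = (\<Sum>j. \<integral>\<^sup>+ i. f i j \<partial>count_space UNIV)"
    by (rule nn_integral_suminf) simp
  finally show ?thesis by (simp add: nn_integral_count_space_nat)
qed

lemma ennreal_norm_sums_le:
  fixes f :: "nat \<Rightarrow> complex"
  assumes "f sums x"
  shows "ennreal (norm x) \<le> (\<Sum>i. ennreal (norm (f i)))"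
proof -
  have "(\<lambda>n. ennreal (norm (\<Sum>i<n. f i))) \<longlonglongrightarrow> ennreal (norm x)"
    using assms unfolding sums_def by (intro tendsto_ennrealI tendsto_norm)
  moreover have "ennreal (norm (\<Sum>i<n. f i)) \<le> (\<Sum>i. ennreal (norm (f i)))" for n
  proof -
    have "ennreal (norm (\<Sum>i<n. f i)) \<le> ennreal (\<Sum>i<n. norm (f i))"
      by (intro ennreal_leI norm_sum)
    also have "\<dots> = (\<Sum>i<n. ennreal (norm (f i)))" by simp
    also have "\<dots> \<le> (\<Sum>i. ennreal (norm (f i)))"
      by (rule sum_le_suminf) auto
    finally show ?thesis .
  qed
  ultimately show ?thesis by (rule LIMSEQ_le_const2[OF _ exI, OF _ allI, OF _ impI])
qed

text \<open>Coordinates of a vector \<open>v\<close> are indexed by sequences \<open>s\<close> with finitely many non-zero entries. The entry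
\<open>s n\<close> tells which component of a vector of \<open>E\<^sub>n\<^sub>+\<^sub>1\<close> is meant: \<open>0\<close> for the total \<open>w\<close>, \<open>1\<close> for the
coefficient of the fresh vector \<open>x\<^sub>n\<close>, and \<open>k \<ge> 2\<close> for the layer \<open>z\<^sub>k\<close>. Using \<open>w\<close> instead of \<open>z\<^sub>0\<close> turns
the embedding of \<open>E\<^sub>n\<close> into \<open>E\<^sub>n\<^sub>+\<^sub>1\<close> into an inclusion and makes every coordinate a bounded functional
(\<open>coordinate_le_level_norm\<close>), so that the completion can be formed among functions.\<close>

type_synonym index = "nat \<Rightarrow> nat"
type_synonym vec = "index \<Rightarrow> complex"

definition scl :: "complex \<Rightarrow> vec \<Rightarrow> vec" where
  "scl c v = (\<lambda>s. c * v s)"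

lemma scl_apply: "scl c v s = c * v s" by (simp add: scl_def)

lemmas pointwise = plus_fun_apply zero_fun_apply minus_apply uminus_apply sum_fun_apply scl_apply

text \<open>The fresh vector \<open>x\<^sub>m\<close> contributes one dimension to \<open>E\<^sub>m\<^sub>+\<^sub>1\<close>, so an entry \<open>1\<close> has only zeros before it.\<close>

definition indices :: "nat \<Rightarrow> index set" where
  "indices n = {s. (\<forall>i\<ge>n. s i = 0) \<and> (\<forall>m. s m = 1 \<longrightarrow> (\<forall>i<m. s i = 0))}"

definition birth :: "nat \<Rightarrow> index" where
  "birth n = (\<lambda>_. 0)(n := 1)"

definition layer :: "nat \<Rightarrow> nat \<Rightarrow> vec \<Rightarrow> vec" where
  "layer n k v = (\<lambda>s. if s \<in> indices n then v (s(n := k)) else 0)"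

text \<open>Geometric weights of sum \<open>1\<close>, with ratio \<open>1 / (1 + d)\<close>. The values of \<open>d\<close> decrease like \<open>2\<^sup>-\<^sup>n\<close>, so the
errors of all levels together stay bounded, and those of the levels above \<open>m\<close> tend to \<open>0\<close>; the factor
\<open>1/8\<close> serves the constants in \<open>coeff_from_quasi_additive\<close>.\<close>

definition weight :: "nat \<Rightarrow> nat \<Rightarrow> real" where
  "weight n j = (let d = (1/2)^n / 8 in d / (1 + d) ^ Suc j)"

definition capped :: "nat \<Rightarrow> nat set set" where
  "capped j = {A. finite A \<and> card A \<le> 4 ^ j \<and> A \<subseteq> {2..}}"

text \<open>Values in \<open>ennreal\<close> make the norm meaningful for all functions, which is what the proof of
completeness needs.\<close>

fun level_norm :: "nat \<Rightarrow> vec \<Rightarrow> ennreal" where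
  "level_norm 0 v = ennreal (norm (v (\<lambda>_. 0)))"
| "level_norm (Suc n) v = ennreal (norm (v (birth n))) +
     (\<Sum>j. ennreal (weight n j) *
       (SUP A\<in>capped j. level_norm n (layer n 0 v - (\<Sum>k\<in>A. layer n k v)) + (\<Sum>k\<in>A. level_norm n (layer n k v))))"

lemma empty_capped [simp]: "{} \<in> capped j" by (simp add: capped_def)
lemma capped_finite: "A \<in> capped j \<Longrightarrow> finite A" by (simp add: capped_def)
lemma capped_ne [simp]: "capped j \<noteq> {}" using empty_capped by blast

lemma weight_pos [simp]: "0 < weight n j" "0 \<le> weight n j"
proof -
  show "0 < weight n j"
    unfolding weight_def Let_def by (intro divide_pos_pos zero_less_power add_pos_pos) auto
  then show "0 \<le> weight n j" by (rule less_imp_le)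
qed

lemma weight_sums: "weight n sums 1"
proof -
  define d :: real where "d = (1/2)^n / 8"
  have d: "d > 0" by (simp add: d_def)
  have "(\<lambda>j. (1 / (1 + d)) ^ j) sums (1 / (1 - 1 / (1 + d)))"
    using d by (intro geometric_sums) (simp add: field_simps)
  from sums_mult[OF this, of "d / (1 + d)"]
  have "(\<lambda>j. d / (1 + d) * (1 / (1 + d)) ^ j) sums (d / (1 + d) * (1 / (1 - 1 / (1 + d))))" .
  moreover have "d / (1 + d) * (1 / (1 - 1 / (1 + d))) = 1"
    using d add_pos_pos[OF d mult_pos_pos[OF d d]] by (simp add: field_simps)
  ultimately have "(\<lambda>j. d / (1 + d) * (1 / (1 + d)) ^ j) sums 1" by (simp only:)
  moreover have "weight n j = d / (1 + d) * (1 / (1 + d)) ^ j" for j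
    unfolding weight_def Let_def d_def by (simp add: power_one_over)
  ultimately show ?thesis by (simp add: cong: sums_cong)
qed

text \<open>The ratio of consecutive weights is close to \<open>1\<close>: the source of near-additivity.\<close>

lemma weight_Suc: "weight n j = (1 + (1/2)^n / 8) * weight n (Suc j)"
proof -
  define d :: real where "d = (1/2)^n / 8"
  have d: "d > 0" by (simp add: d_def)
  have "d / (1 + d) ^ Suc j = (1 + d) * (d / ((1 + d) * (1 + d) ^ Suc j))"
    using d by simp
  then show ?thesis unfolding weight_def Let_def d_def[symmetric] by simp
qed

lemma weight_suminf_ennreal: "(\<Sum>j. ennreal (weight n j)) = 1"
  using weight_sums[of n] by (metis weight_pos(2) ennreal_1 sums_unique suminf_ennreal_eq)

lemma layer_sums:
  assumes "\<And>s. (\<lambda>i. u i s) sums v s"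
  shows "(\<lambda>i. layer n k (u i) s) sums layer n k v s"
  using assms by (auto simp: layer_def)

text \<open>Countable subadditivity under coordinatewise convergence. With finitely many summands it is the
triangle inequality; with infinitely many it bounds the limit of a series, and hence gives
completeness and the estimates for the regular part below.\<close>

lemma level_norm_sums_le:
  assumes "\<And>s. (\<lambda>i. u i s) sums v s"
  shows "level_norm n v \<le> (\<Sum>i. level_norm n (u i))"
  using assms
proof (induction n arbitrary: u v)
  case 0
  then show ?case by (simp add: ennreal_norm_sums_le)
next
  case (Suc n)
  let ?p = "\<lambda>v j A. level_norm n (layer n 0 v - (\<Sum>k\<in>A. layer n k v)) + (\<Sum>k\<in>A. level_norm n (layer n k v))"
  have p: "?p v j A \<le> (\<Sum>i. SUP A\<in>capped j. ?p (u i) j A)" if A: "A \<in> capped j" for j A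
  proof -
    have "(\<lambda>i. (layer n 0 (u i) - (\<Sum>k\<in>A. layer n k (u i))) s) sums
        (layer n 0 v - (\<Sum>k\<in>A. layer n k v)) s" for s
      unfolding fun_diff_def sum_fun_apply
      by (intro sums_diff sums_sum layer_sums Suc.prems)
    then have "level_norm n (layer n 0 v - (\<Sum>k\<in>A. layer n k v))
        \<le> (\<Sum>i. level_norm n (layer n 0 (u i) - (\<Sum>k\<in>A. layer n k (u i))))"
      by (rule Suc.IH)
    moreover have "(\<Sum>k\<in>A. level_norm n (layer n k v)) \<le> (\<Sum>k\<in>A. \<Sum>i. level_norm n (layer n k (u i)))"
      by (intro sum_mono Suc.IH layer_sums Suc.prems)
    ultimately have "?p v j A \<le> (\<Sum>i. level_norm n (layer n 0 (u i) - (\<Sum>k\<in>A. layer n k (u i)))) +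
       (\<Sum>i. \<Sum>k\<in>A. level_norm n (layer n k (u i)))"
      by (subst suminf_sum) (auto intro: add_mono)
    also have "\<dots> = (\<Sum>i. ?p (u i) j A)" by (rule suminf_add) auto
    also have "\<dots> \<le> (\<Sum>i. SUP A\<in>capped j. ?p (u i) j A)"
      by (intro suminf_le SUP_upper A) auto
    finally show ?thesis .
  qed
  have "(\<Sum>j. ennreal (weight n j) * (SUP A\<in>capped j. ?p v j A))
      \<le> (\<Sum>j. ennreal (weight n j) * (\<Sum>i. SUP A\<in>capped j. ?p (u i) j A))"
    by (intro suminf_le mult_left_mono SUP_least p) auto
  also have "\<dots> = (\<Sum>j. \<Sum>i. ennreal (weight n j) * (SUP A\<in>capped j. ?p (u i) j A))"
    by simp
  also have "\<dots> = (\<Sum>i. \<Sum>j. ennreal (weight n j) * (SUP A\<in>capped j. ?p (u i) j A))"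
    by (rule suminf_swap_ennreal)
  finally have "level_norm (Suc n) v \<le> (\<Sum>i. ennreal (norm (u i (birth n)))) + \<dots>"
    using ennreal_norm_sums_le[OF Suc.prems, of "birth n"] by (auto intro: add_mono)
  also have "\<dots> = (\<Sum>i. level_norm (Suc n) (u i))"
    unfolding level_norm.simps by (rule suminf_add) auto
  finally show ?case .
qed

lemma level_norm_zero [simp]: "level_norm n 0 = 0"
proof (induction n)
  case (Suc n)
  have "layer n k 0 = 0" for k by (auto simp: layer_def pointwise)
  moreover have "(0 :: vec) (birth n) = 0" by (simp add: pointwise)
  ultimately show ?case using Suc by simp
qed (simp add: pointwise)

lemma level_norm_add: "level_norm n (u + v) \<le> level_norm n u + level_norm n v"
proof -
  let ?f = "\<lambda>i::nat. if i = 0 then u else if i = 1 then v else 0"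
  have "level_norm n (u + v) \<le> (\<Sum>i. level_norm n (?f i))"
  proof (rule level_norm_sums_le)
    fix s
    have "(\<lambda>i. ?f i s) sums (\<Sum>i\<in>{0,1}. ?f i s)"
      by (rule sums_finite) (auto simp: pointwise)
    then show "(\<lambda>i. ?f i s) sums (u + v) s" by (simp add: pointwise)
  qed
  also have "\<dots> = (\<Sum>i\<in>{0,1}. level_norm n (?f i))" by (rule suminf_finite) auto
  finally show ?thesis by simp
qed

lemma layer_scl: "layer n k (scl c v) = scl c (layer n k v)" by (rule ext) (simp add: pointwise layer_def)
lemma layer_add: "layer n k (u + v) = layer n k u + layer n k v" by (rule ext) (simp add: pointwise layer_def)
lemma layer_diff: "layer n k (u - v) = layer n k u - layer n k v" by (rule ext) (simp add: pointwise layer_def)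
lemma layer_sum: "layer n k (\<Sum>i\<in>I. u i) = (\<Sum>i\<in>I. layer n k (u i))"
  by (rule ext) (simp add: pointwise layer_def)
lemma scl_diff: "scl c (u - v) = scl c u - scl c v" by (rule ext) (simp add: pointwise algebra_simps)
lemma scl_add: "scl c (u + v) = scl c u + scl c v" by (rule ext) (simp add: pointwise algebra_simps)
lemma scl_sum: "scl c (\<Sum>i\<in>I. u i) = (\<Sum>i\<in>I. scl c (u i))"
  by (rule ext) (simp add: pointwise sum_distrib_left)
lemma scl_scl: "scl a (scl b v) = scl (a * b) v" by (rule ext) (simp add: pointwise algebra_simps)
lemma scl_one [simp]: "scl 1 v = v" by (rule ext) (simp add: pointwise algebra_simps)
lemma scl_zero [simp]: "scl 0 v = 0" "scl c 0 = 0" by (rule ext, simp add: pointwise)+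
lemma scl_minus1: "scl (-1) v = - v" by (rule ext) (simp add: pointwise algebra_simps)
lemma scl_plus: "scl (a + b) v = scl a v + scl b v" by (rule ext) (simp add: pointwise algebra_simps)

lemma level_norm_scl: "level_norm n (scl c v) = ennreal (norm c) * level_norm n v"
proof (induction n arbitrary: v)
  case 0
  show ?case by (simp add: pointwise norm_mult ennreal_mult)
next
  case (Suc n)
  show ?case
    unfolding level_norm.simps layer_scl scl_sum[symmetric] scl_diff[symmetric] Suc.IH
      sum_distrib_left[symmetric] distrib_left[symmetric] SUP_mult_left_ennreal[symmetric]
    by (simp add: pointwise norm_mult ennreal_mult distrib_left mult.left_commute[of _ "ennreal (norm c)"])
qed

lemma level_norm_minus: "level_norm n (- v) = level_norm n v"
  using level_norm_scl[of n "-1" v] by (simp add: scl_minus1)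

lemma level_norm_diff: "level_norm n (u - v) \<le> level_norm n u + level_norm n v"
  using level_norm_add[of n u "- v"] by (simp add: level_norm_minus)

lemma level_norm_sum: "level_norm n (\<Sum>i\<in>I. u i) \<le> (\<Sum>i\<in>I. level_norm n (u i))"
proof (induction I rule: infinite_finite_induct)
  case (insert i I)
  then show ?case using order_trans[OF level_norm_add add_left_mono[OF insert.IH]] by simp
qed auto

lemma indices_zero: "s \<in> indices n \<Longrightarrow> i \<ge> n \<Longrightarrow> s i = 0" by (simp add: indices_def)

lemma indices_mono: "m \<le> n \<Longrightarrow> indices m \<subseteq> indices n" by (auto simp: indices_def)

lemma indices_update:
  assumes "s \<in> indices n" "k \<noteq> 1"
  shows "s(n := k) \<in> indices (Suc n)"
proof -
  have z: "\<And>i. i \<ge> n \<Longrightarrow> s i = 0" and g: "\<And>m i. s m = 1 \<Longrightarrow> i < m \<Longrightarrow> s i = 0"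
    using assms by (auto simp: indices_def)
  have "(s(n := k)) i = 0" if "(s(n := k)) m = 1" "i < m" for m i
  proof -
    have m: "m \<noteq> n" "s m = 1" using that assms(2) by (auto split: if_splits)
    then have "m < n" using z[of m] by (cases "m < n") auto
    then show ?thesis using g[OF m(2) that(2)] that(2) by auto
  qed
  then show ?thesis using z by (auto simp: indices_def)
qed

lemma birth_in_indices: "birth n \<in> indices (Suc n)" by (auto simp: indices_def birth_def)

lemma birth_notin_indices: "m \<le> n \<Longrightarrow> birth n \<notin> indices m" by (auto simp: indices_def birth_def)

lemma indices_Suc_eq_1:
  assumes "s \<in> indices (Suc n)" "s n = 1"
  shows "s = birth n"
proof
  fix i
  show "s i = birth n i"
    using assms by (cases i n rule: linorder_cases) (auto simp: indices_def birth_def)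
qed

lemma indices_Suc_erase:
  assumes "s \<in> indices (Suc n)" "s n \<noteq> 1"
  shows "s(n := 0) \<in> indices n"
  using assms unfolding indices_def by (auto simp: le_Suc_eq not_less_eq_eq split: if_splits)

lemma layer_cong:
  assumes "\<And>s. s \<in> indices (Suc n) \<Longrightarrow> u s = v s" "k \<noteq> 1"
  shows "layer n k u = layer n k v"
  using assms indices_update unfolding layer_def by fastforce

lemma level_norm_cong:
  assumes "\<And>s. s \<in> indices n \<Longrightarrow> u s = v s"
  shows "level_norm n u = level_norm n v"
proof (cases n)
  case 0
  then show ?thesis using assms by (simp add: indices_def)
next
  case (Suc m)
  have k: "layer m k u = layer m k v" if "k \<noteq> 1" for k
    using layer_cong assms that Suc by blast
  have "(SUP A\<in>capped j. level_norm m (layer m 0 u - (\<Sum>k\<in>A. layer m k u)) + (\<Sum>k\<in>A. level_norm m (layer m k u))) =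
    (SUP A\<in>capped j. level_norm m (layer m 0 v - (\<Sum>k\<in>A. layer m k v)) + (\<Sum>k\<in>A. level_norm m (layer m k v)))" for j
  proof (rule SUP_cong[OF refl])
    fix A assume "A \<in> capped j"
    then have "layer m i u = layer m i v" if "i \<in> A" for i
      using that k[of i] by (auto simp: capped_def)
    then show "level_norm m (layer m 0 u - (\<Sum>k\<in>A. layer m k u)) + (\<Sum>k\<in>A. level_norm m (layer m k u)) =
        level_norm m (layer m 0 v - (\<Sum>k\<in>A. layer m k v)) + (\<Sum>k\<in>A. level_norm m (layer m k v))"
      using k[of 0] by simp
  qed
  then show ?thesis using Suc assms[of "birth m"] birth_in_indices by simp
qed

lemma level_norm_layer_0: "level_norm n (layer n 0 v) = level_norm n v"
proof (rule level_norm_cong)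
  fix s assume s: "s \<in> indices n"
  then have "s(n := 0) = s" using indices_zero[OF s, of n] by auto
  then show "layer n 0 v s = v s" using s by (simp add: layer_def)
qed

lemma weight_const_ennreal: "(\<Sum>j. ennreal (weight n j) * c) = c"
  by (simp add: weight_suminf_ennreal)

lemma level_norm_le_Suc: "level_norm n v \<le> level_norm (Suc n) v"
proof -
  let ?p = "\<lambda>A. level_norm n (layer n 0 v - (\<Sum>k\<in>A. layer n k v)) + (\<Sum>k\<in>A. level_norm n (layer n k v))"
  have "level_norm n v \<le> (SUP A\<in>capped j. ?p A)" for j
    by (rule SUP_upper2[of "{}"]) (auto simp: level_norm_layer_0)
  then have "(\<Sum>j. ennreal (weight n j) * level_norm n v) \<le> (\<Sum>j. ennreal (weight n j) * (SUP A\<in>capped j. ?p A))"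
    by (intro suminf_le mult_left_mono) auto
  then show ?thesis
    unfolding weight_const_ennreal level_norm.simps by (rule order_trans) simp
qed

lemma level_norm_mono: "m \<le> n \<Longrightarrow> level_norm m v \<le> level_norm n v"
  by (rule lift_Suc_mono_le[of "\<lambda>n. level_norm n v"]) (rule level_norm_le_Suc)

definition supp :: "vec \<Rightarrow> index set" where
  "supp v = {s. v s \<noteq> 0}"

lemma layer_0_id:
  assumes "supp v \<subseteq> indices n"
  shows "layer n 0 v = v"
proof
  fix s
  show "layer n 0 v s = v s"
  proof (cases "s \<in> indices n")
    case True
    then have "s(n := 0) = s" using indices_zero[OF True, of n] by auto
    then show ?thesis using True by (simp add: layer_def)
  next
    case False
    then show ?thesis using assms by (auto simp: layer_def supp_def)
  qed
qed

lemma layer_eq_0: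
  assumes "supp v \<subseteq> indices n" "k \<noteq> 0"
  shows "layer n k v = 0"
proof
  fix s
  have "s(n := k) \<notin> indices n" using assms(2) indices_zero[of "s(n := k)" n n] by auto
  then show "layer n k v s = 0 s" using assms(1) by (auto simp: layer_def supp_def pointwise)
qed

lemma level_norm_Suc_eq:
  assumes "supp v \<subseteq> indices n"
  shows "level_norm (Suc n) v = level_norm n v"
proof -
  have z: "v (birth n) = 0" using assms birth_notin_indices[of n n] by (auto simp: supp_def)
  have "(SUP A\<in>capped j. level_norm n (layer n 0 v - (\<Sum>k\<in>A. layer n k v)) + (\<Sum>k\<in>A. level_norm n (layer n k v))) = level_norm n v" for j
  proof -
    have "level_norm n (layer n 0 v - (\<Sum>k\<in>A. layer n k v)) + (\<Sum>k\<in>A. level_norm n (layer n k v)) = level_norm n v"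
      if "A \<in> capped j" for A
    proof -
      have "layer n k v = 0" if "k \<in> A" for k
        using \<open>A \<in> capped j\<close> that by (intro layer_eq_0[OF assms]) (auto simp: capped_def)
      then show ?thesis using layer_0_id[OF assms] by simp
    qed
    then show ?thesis by simp
  qed
  then show ?thesis using z by (simp add: weight_suminf_ennreal)
qed

lemma supp_layer: "supp (layer n k v) \<subseteq> (\<lambda>t. t(n := 0)) ` supp v" "supp (layer n k v) \<subseteq> indices n"
proof
  fix s assume "s \<in> supp (layer n k v)"
  then have s: "s \<in> indices n" "s(n := k) \<in> supp v" by (auto simp: supp_def layer_def split: if_splits)
  then have "s = (s(n := k))(n := 0)" using indices_zero[of s n n] by auto
  then show "s \<in> (\<lambda>t. t(n := 0)) ` supp v" using s by blast
qed (auto simp: supp_def layer_def split: if_splits)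

lemma finite_supp_layer: "finite (supp v) \<Longrightarrow> finite (supp (layer n k v))"
  using finite_subset[OF supp_layer(1)] by blast

lemma finite_slices: 
  assumes "finite (supp v)"
  shows "finite {k. layer n k v \<noteq> 0}"
proof (rule finite_subset)
  show "{k. layer n k v \<noteq> 0} \<subseteq> (\<lambda>t. t n) ` supp v"
  proof
    fix k assume "k \<in> {k. layer n k v \<noteq> 0}"
    then obtain s where "layer n k v s \<noteq> 0" by (auto simp: fun_eq_iff pointwise)
    then have "s(n := k) \<in> supp v" by (auto simp: layer_def supp_def split: if_splits)
    then show "k \<in> (\<lambda>t. t n) ` supp v" by (intro image_eqI[of _ _ "s(n := k)"]) auto
  qed
qed (use assms in simp)

text \<open>If \<open>C\<close> is the sum of the norms of the finitely many non-zero layers, every term of the supremum is at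
most the norm of the total plus \<open>2 C\<close>.\<close>

lemma level_norm_finite:
  assumes "finite (supp v)"
  shows "level_norm n v < top"
  using assms
proof (induction n arbitrary: v)
  case (Suc n)
  let ?B = "{k. layer n k v \<noteq> 0}"
  define C where "C = (\<Sum>k\<in>?B. level_norm n (layer n k v))"
  have B: "finite ?B" by (rule finite_slices) fact
  have fin: "level_norm n (layer n k v) < top" for k using Suc by (simp add: finite_supp_layer)
  then have C: "C < top" using B by (simp add: C_def)
  have le: "(\<Sum>k\<in>A. level_norm n (layer n k v)) \<le> C" if "A \<in> capped j" for A j
  proof -
    have "(\<Sum>k\<in>A. level_norm n (layer n k v)) = (\<Sum>k\<in>A \<inter> ?B. level_norm n (layer n k v))"
      using capped_finite[OF that] by (intro sum.mono_neutral_right) auto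
    also have "\<dots> \<le> C" unfolding C_def using B by (intro sum_mono2) auto
    finally show ?thesis .
  qed
  have "(SUP A\<in>capped j. level_norm n (layer n 0 v - (\<Sum>k\<in>A. layer n k v)) + (\<Sum>k\<in>A. level_norm n (layer n k v)))
      \<le> level_norm n (layer n 0 v) + C + C" for j
  proof (rule SUP_least)
    fix A assume A: "A \<in> capped j"
    have "level_norm n (layer n 0 v - (\<Sum>k\<in>A. layer n k v)) \<le> level_norm n (layer n 0 v) + C"
      by (rule order_trans[OF level_norm_diff add_left_mono[OF order_trans[OF level_norm_sum le[OF A]]]])
    then show "level_norm n (layer n 0 v - (\<Sum>k\<in>A. layer n k v)) + (\<Sum>k\<in>A. level_norm n (layer n k v))
        \<le> level_norm n (layer n 0 v) + C + C"
      using le[OF A] by (rule add_mono)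
  qed
  then have "level_norm (Suc n) v \<le> ennreal (norm (v (birth n))) +
      (\<Sum>j. ennreal (weight n j) * (level_norm n (layer n 0 v) + C + C))"
    unfolding level_norm.simps by (intro add_left_mono suminf_le mult_left_mono) auto
  also have "\<dots> < top" unfolding weight_const_ennreal using fin[of 0] C by simp
  finally show ?case .
qed simp

text \<open>Each total or layer is seen at scale \<open>0\<close>, through the empty set or a singleton.\<close>

lemma coordinate_le_level_norm:
  assumes "s \<in> indices n"
  shows "\<exists>C\<ge>0. \<forall>v. ennreal (norm (v s)) \<le> ennreal C * level_norm n v"
  using assms
proof (induction n arbitrary: s)
  case 0
  then have "s = (\<lambda>_. 0)" by (auto simp: indices_def)
  then show ?case by (intro exI[of _ 1]) auto
next
  case (Suc n)
  show ?case
  proof (cases "s n = 1")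
    case True
    then have "s = birth n" using indices_Suc_eq_1[OF Suc.prems] by simp
    then show ?thesis by (intro exI[of _ 1]) auto
  next
    case False
    have e: "s(n := 0) \<in> indices n" using indices_Suc_erase[OF Suc.prems False] .
    then obtain C where C: "C \<ge> 0" "\<And>v. ennreal (norm (v (s(n := 0)))) \<le> ennreal C * level_norm n v"
      using Suc.IH by blast
    have "ennreal (norm (v s)) \<le> ennreal (C / weight n 0) * level_norm (Suc n) v" for v
    proof -
      let ?p = "\<lambda>A. level_norm n (layer n 0 v - (\<Sum>k\<in>A. layer n k v)) + (\<Sum>k\<in>A. level_norm n (layer n k v))"
      let ?A = "if s n = 0 then {} else {s n}"
      have A: "?A \<in> capped 0" using False by (auto simp: capped_def)
      have "level_norm n (layer n (s n) v) \<le> ?p ?A" by auto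
      also have "\<dots> \<le> (SUP A\<in>capped 0. ?p A)" by (rule SUP_upper[OF A])
      finally have "ennreal (weight n 0) * level_norm n (layer n (s n) v) \<le> ennreal (weight n 0) * (SUP A\<in>capped 0. ?p A)"
        by (rule mult_left_mono) simp
      also have "\<dots> \<le> (\<Sum>j. ennreal (weight n j) * (SUP A\<in>capped j. ?p A))"
        using sum_le_suminf[of "\<lambda>j. ennreal (weight n j) * (SUP A\<in>capped j. ?p A)" "{0}"] by simp
      also have "\<dots> \<le> level_norm (Suc n) v" by simp
      finally have w: "ennreal (weight n 0) * level_norm n (layer n (s n) v) \<le> level_norm (Suc n) v" .
      have "ennreal (norm (v s)) = ennreal (norm (layer n (s n) v (s(n := 0))))"
        using e by (simp add: layer_def)
      also have "\<dots> \<le> ennreal C * level_norm n (layer n (s n) v)" by (rule C(2))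
      also have "\<dots> = ennreal (C / weight n 0) * (ennreal (weight n 0) * level_norm n (layer n (s n) v))"
        using C(1) weight_pos[of n 0]
        by (simp add: mult.assoc[symmetric] ennreal_mult[symmetric] del: weight_pos)
      also have "\<dots> \<le> ennreal (C / weight n 0) * level_norm (Suc n) v"
        using w by (rule mult_left_mono) simp
      finally show ?thesis .
    qed
    then show ?thesis using C(1) by (intro exI[of _ "C / weight n 0"]) auto
  qed
qed

definition total_norm :: "vec \<Rightarrow> ennreal" where
  "total_norm v = (SUP n. level_norm n v)"

lemma level_norm_le_total_norm: "level_norm n v \<le> total_norm v" unfolding total_norm_def by (rule SUP_upper) simp

text \<open>The level norms increase with the level, and they agree on vectors that live on both levels.\<close>

lemma total_norm_eq_level_norm:
  assumes "supp v \<subseteq> indices n"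
  shows "total_norm v = level_norm n v"
proof (rule antisym[OF _ level_norm_le_total_norm])
  have eq: "level_norm (n + k) v = level_norm n v" for k
  proof (induction k)
    case (Suc k)
    have "supp v \<subseteq> indices (n + k)" using assms indices_mono[of n "n + k"] by auto
    then show ?case using level_norm_Suc_eq[of v "n + k"] Suc by simp
  qed simp
  show "total_norm v \<le> level_norm n v"
    unfolding total_norm_def
  proof (rule SUP_least)
    fix m
    have "level_norm m v \<le> level_norm (n + m) v" by (rule level_norm_mono) simp
    then show "level_norm m v \<le> level_norm n v" using eq by simp
  qed
qed

lemma total_norm_sums_le:
  assumes "\<And>s. (\<lambda>i. u i s) sums v s"
  shows "total_norm v \<le> (\<Sum>i. total_norm (u i))"
  unfolding total_norm_def[of v]
proof (rule SUP_least)
  fix n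
  have "level_norm n v \<le> (\<Sum>i. level_norm n (u i))" by (rule level_norm_sums_le[OF assms])
  also have "\<dots> \<le> (\<Sum>i. total_norm (u i))" by (intro suminf_le level_norm_le_total_norm) auto
  finally show "level_norm n v \<le> (\<Sum>i. total_norm (u i))" .
qed

lemma total_norm_zero [simp]: "total_norm 0 = 0" by (simp add: total_norm_def)

lemma total_norm_scl: "total_norm (scl c v) = ennreal (norm c) * total_norm v"
  unfolding total_norm_def by (simp add: level_norm_scl SUP_mult_left_ennreal)

lemma total_norm_add: "total_norm (u + v) \<le> total_norm u + total_norm v"
  unfolding total_norm_def[of "u + v"]
  by (intro SUP_least order_trans[OF level_norm_add] add_mono level_norm_le_total_norm)

definition finite_norm :: "vec \<Rightarrow> bool" where "finite_norm v \<longleftrightarrow> total_norm v < top"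

definition vnorm :: "vec \<Rightarrow> real" where "vnorm v = enn2real (total_norm v)"

lemma total_norm_vnorm: "finite_norm v \<Longrightarrow> total_norm v = ennreal (vnorm v)"
  unfolding finite_norm_def vnorm_def by simp

lemma vnorm_nonneg [simp]: "0 \<le> vnorm v" by (simp add: vnorm_def)

lemma vnorm_zero [simp]: "vnorm 0 = 0" by (simp add: vnorm_def)

lemma finite_norm_zero [simp]: "finite_norm 0" by (simp add: finite_norm_def)

lemma vnorm_le: "total_norm v \<le> ennreal r \<Longrightarrow> 0 \<le> r \<Longrightarrow> vnorm v \<le> r"
  unfolding vnorm_def by (rule enn2real_leI)

lemma finite_normI: "total_norm v \<le> ennreal r \<Longrightarrow> finite_norm v"
  unfolding finite_norm_def by (simp add: le_less_trans)

lemma assumes "finite_norm u" "finite_norm v" shows finite_norm_add: "finite_norm (u + v)" 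
  and vnorm_add: "vnorm (u + v) \<le> vnorm u + vnorm v"
proof -
  have "total_norm (u + v) \<le> ennreal (vnorm u + vnorm v)"
    using total_norm_add[of u v] by (simp add: total_norm_vnorm assms)
  then show "finite_norm (u + v)" "vnorm (u + v) \<le> vnorm u + vnorm v"
    by (rule finite_normI, rule vnorm_le) simp
qed

lemma finite_norm_scl: "finite_norm v \<Longrightarrow> finite_norm (scl c v)"
  by (simp add: finite_norm_def total_norm_scl ennreal_mult_less_top)

lemma vnorm_scl: "vnorm (scl c v) = norm c * vnorm v"
  by (simp add: vnorm_def total_norm_scl enn2real_mult)

lemma vnorm_minus [simp]: "vnorm (- v) = vnorm v"
  using vnorm_scl[of "-1" v] by (simp add: scl_minus1)

lemma finite_norm_minus [simp]: "finite_norm (- v) = finite_norm v"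
  using finite_norm_scl[of v "-1"] finite_norm_scl[of "- v" "-1"] by (auto simp: scl_minus1)

lemma assumes "finite_norm u" "finite_norm v" shows finite_norm_diff: "finite_norm (u - v)" 
  and vnorm_diff: "vnorm (u - v) \<le> vnorm u + vnorm v"
  using finite_norm_add[of u "- v"] vnorm_add[of u "- v"] assms by auto

lemma vnorm_diff_commute: "vnorm (u - v) = vnorm (v - u)"
  using vnorm_minus[of "u - v"] by simp

lemma assumes "\<And>i. i \<in> I \<Longrightarrow> finite_norm (u i)"
  shows finite_norm_sum: "finite_norm (\<Sum>i\<in>I. u i)" and vnorm_sum: "vnorm (\<Sum>i\<in>I. u i) \<le> (\<Sum>i\<in>I. vnorm (u i))"
proof -
  have "finite_norm (\<Sum>i\<in>I. u i) \<and> vnorm (\<Sum>i\<in>I. u i) \<le> (\<Sum>i\<in>I. vnorm (u i))"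
    using assms
  proof (induction I rule: infinite_finite_induct)
    case (insert i I)
    then show ?case using vnorm_add[of "u i" "\<Sum>i\<in>I. u i"] by (auto intro: finite_norm_add)
  qed auto
  then show "finite_norm (\<Sum>i\<in>I. u i)" "vnorm (\<Sum>i\<in>I. u i) \<le> (\<Sum>i\<in>I. vnorm (u i))" by auto
qed

lemma
  assumes "\<And>s. (\<lambda>i. u i s) sums v s" "\<And>i. finite_norm (u i)" "summable (\<lambda>i. vnorm (u i))"
  shows finite_norm_sums: "finite_norm v" and vnorm_sums_le: "vnorm v \<le> (\<Sum>i. vnorm (u i))"
proof -
  have "(\<Sum>i. total_norm (u i)) = ennreal (\<Sum>i. vnorm (u i))"
    using assms(2,3) by (simp add: total_norm_vnorm suminf_ennreal2)
  then have "total_norm v \<le> ennreal (\<Sum>i. vnorm (u i))"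
    using total_norm_sums_le[of u v, OF assms(1)] by simp
  then show "finite_norm v" "vnorm v \<le> (\<Sum>i. vnorm (u i))"
    using suminf_nonneg[OF assms(3)] by (auto intro: vnorm_le finite_normI)
qed

lemma coordinate_le_vnorm:
  assumes "s \<in> indices n"
  obtains C where "C \<ge> 0" "\<And>v. finite_norm v \<Longrightarrow> norm (v s) \<le> C * vnorm v"
proof -
  obtain C where C: "C \<ge> 0" "\<And>v. ennreal (norm (v s)) \<le> ennreal C * level_norm n v"
    using coordinate_le_level_norm[OF assms] by blast
  have "norm (v s) \<le> C * vnorm v" if "finite_norm v" for v
  proof -
    have "ennreal (norm (v s)) \<le> ennreal C * total_norm v"
      by (rule order_trans[OF C(2) mult_left_mono[OF level_norm_le_total_norm]]) simp
    then show ?thesis using C(1) by (simp add: total_norm_vnorm[OF that] ennreal_mult[symmetric])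
  qed
  then show ?thesis using that C(1) by blast
qed

lemma vnorm_triangle: "finite_norm u \<Longrightarrow> finite_norm v \<Longrightarrow> finite_norm w \<Longrightarrow> vnorm (u - w) \<le> vnorm (u - v) + vnorm (v - w)"
  using vnorm_add[of "u - v" "v - w"] by (simp add: finite_norm_diff)

section \<open>The levels as real normed spaces\<close>

locale scalar_field =
  fixes K :: "complex set"
  assumes K: "K = \<real> \<or> K = UNIV"
begin

lemma K_zero [simp]: "0 \<in> K" and K_one [simp]: "1 \<in> K" and K_of_real [simp]: "complex_of_real r \<in> K"
  and K_add: "a \<in> K \<Longrightarrow> b \<in> K \<Longrightarrow> a + b \<in> K"
  and K_diff: "a \<in> K \<Longrightarrow> b \<in> K \<Longrightarrow> a - b \<in> K"
  and K_mult: "a \<in> K \<Longrightarrow> b \<in> K \<Longrightarrow> a * b \<in> K"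
  and K_minus: "a \<in> K \<Longrightarrow> - a \<in> K"
  using K by auto

lemma closed_K: "closed K" using K by (auto simp: closed_complex_Reals)

lemma K_sum: "(\<And>i. i \<in> I \<Longrightarrow> f i \<in> K) \<Longrightarrow> sum f I \<in> K"
  by (induction I rule: infinite_finite_induct) (auto simp: K_add)

lemma K_sums: 
  assumes "f sums x" "\<And>i. f i \<in> K"
  shows "x \<in> K"
  by (rule Lim_in_closed_set[OF closed_K _ _ assms(1)[unfolded sums_def]])
    (auto intro!: always_eventually K_sum assms(2))

definition level :: "nat \<Rightarrow> vec set" where
  "level n = {v. (\<forall>s. v s \<in> K) \<and> finite (supp v) \<and> supp v \<subseteq> indices n}"

lemma levelD: "v \<in> level n \<Longrightarrow> v s \<in> K" "v \<in> level n \<Longrightarrow> finite (supp v)" "v \<in> level n \<Longrightarrow> supp v \<subseteq> indices n"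
  by (auto simp: level_def)

lemma level_mono: "m \<le> n \<Longrightarrow> v \<in> level m \<Longrightarrow> v \<in> level n"
  using indices_mono[of m n] by (auto simp: level_def)

lemma level_zero [simp]: "0 \<in> level n" by (auto simp: level_def supp_def pointwise)

lemma level_add: assumes "u \<in> level n" "v \<in> level n" shows "u + v \<in> level n"
proof -
  have "supp (u + v) \<subseteq> supp u \<union> supp v" by (auto simp: supp_def pointwise)
  then show ?thesis using assms finite_subset[of "supp (u + v)" "supp u \<union> supp v"]
    by (auto simp: level_def pointwise K_add)
qed

lemma level_scl: assumes "c \<in> K" "v \<in> level n" shows "scl c v \<in> level n"
proof -
  have "supp (scl c v) \<subseteq> supp v" by (auto simp: supp_def pointwise)
  then show ?thesis using assms finite_subset[of "supp (scl c v)" "supp v"]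
    by (auto simp: level_def pointwise K_mult)
qed

lemma level_minus: "v \<in> level n \<Longrightarrow> - v \<in> level n"
  using level_scl[of "-1" v n] K_minus[of 1] by (simp add: scl_minus1)

lemma level_diff: "u \<in> level n \<Longrightarrow> v \<in> level n \<Longrightarrow> u - v \<in> level n"
  using level_add[of u n "- v"] level_minus[of v n] by simp

lemma level_sum: "(\<And>i. i \<in> I \<Longrightarrow> u i \<in> level n) \<Longrightarrow> (\<Sum>i\<in>I. u i) \<in> level n"
  by (induction I rule: infinite_finite_induct) (auto simp: level_add)

lemma level_layer: assumes "v \<in> level m" shows "layer n k v \<in> level n"
  using assms finite_supp_layer supp_layer(2)[of n k v] by (auto simp: level_def) (auto simp: layer_def)

lemma level_finite_norm: assumes "v \<in> level n" shows "finite_norm v"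
  using total_norm_eq_level_norm[OF levelD(3)[OF assms]] level_norm_finite[OF levelD(2)[OF assms], of n]
  by (simp add: finite_norm_def)

lemma level_norm_level: assumes "v \<in> level n" shows "level_norm n v = ennreal (vnorm v)"
  using total_norm_eq_level_norm[OF levelD(3)[OF assms]] total_norm_vnorm[OF level_finite_norm[OF assms]] by simp

abbreviation split_val :: "nat \<Rightarrow> vec \<Rightarrow> nat set \<Rightarrow> real" where
  "split_val n v A \<equiv> vnorm (layer n 0 v - (\<Sum>k\<in>A. layer n k v)) + (\<Sum>k\<in>A. vnorm (layer n k v))"

lemma split_val_ennreal:
  assumes "v \<in> level (Suc n)"
  shows "level_norm n (layer n 0 v - (\<Sum>k\<in>A. layer n k v)) + (\<Sum>k\<in>A. level_norm n (layer n k v)) = ennreal (split_val n v A)"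
proof -
  have "layer n 0 v - (\<Sum>k\<in>A. layer n k v) \<in> level n"
    using assms by (intro level_diff level_sum level_layer)
  moreover have "level_norm n (layer n k v) = ennreal (vnorm (layer n k v))" for k
    by (rule level_norm_level[OF level_layer[OF assms]])
  ultimately show ?thesis by (simp add: level_norm_level sum_nonneg)
qed

text \<open>This lemma and \<open>vnorm_upper\<close> unfold the norm of one level over the reals. A lower bound needs only one
admissible set per scale.\<close>

lemma vnorm_lower:
  assumes v: "v \<in> level (Suc n)" and A: "\<And>j. A j \<in> capped j"
  shows "summable (\<lambda>j. weight n j * split_val n v (A j))"
    and "norm (v (birth n)) + (\<Sum>j. weight n j * split_val n v (A j)) \<le> vnorm v"
proof -
  let ?f = "\<lambda>j. weight n j * split_val n v (A j)"
  have f0: "0 \<le> ?f j" for j by (simp add: sum_nonneg)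
  have "(\<Sum>j. ennreal (?f j)) \<le> (\<Sum>j. ennreal (weight n j) *
      (SUP A\<in>capped j. level_norm n (layer n 0 v - (\<Sum>k\<in>A. layer n k v)) + (\<Sum>k\<in>A. level_norm n (layer n k v))))"
    unfolding split_val_ennreal[OF v]
    by (intro suminf_le) (auto simp: ennreal_mult sum_nonneg intro!: mult_left_mono SUP_upper A)
  then have le: "ennreal (norm (v (birth n))) + (\<Sum>j. ennreal (?f j)) \<le> ennreal (vnorm v)"
    unfolding level_norm_level[OF v, symmetric] level_norm.simps by (rule add_left_mono)
  then have "(\<Sum>j. ennreal (?f j)) \<noteq> top"
    by (auto simp: top_unique)
  then show s: "summable ?f" using f0 by (rule summable_suminf_not_top[rotated])
  have "(\<Sum>j. ennreal (?f j)) = ennreal (\<Sum>j. ?f j)"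
    using s f0 by (intro suminf_ennreal2) auto
  then have "ennreal (norm (v (birth n)) + (\<Sum>j. ?f j)) \<le> ennreal (vnorm v)"
    using le s f0 by (simp add: suminf_nonneg)
  then show "norm (v (birth n)) + (\<Sum>j. ?f j) \<le> vnorm v" by simp
qed

lemma vnorm_upper:
  assumes v: "v \<in> level (Suc n)"
    and P: "\<And>j A. A \<in> capped j \<Longrightarrow> split_val n v A \<le> P j" and s: "summable (\<lambda>j. weight n j * P j)"
  shows "vnorm v \<le> norm (v (birth n)) + (\<Sum>j. weight n j * P j)"
proof -
  have P0: "0 \<le> P j" for j
    by (rule order_trans[OF _ P[OF empty_capped]]) simp
  have "ennreal (vnorm v) \<le> ennreal (norm (v (birth n))) + (\<Sum>j. ennreal (weight n j) * ennreal (P j))"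
    unfolding level_norm_level[OF v, symmetric] level_norm.simps split_val_ennreal[OF v]
    by (intro add_left_mono suminf_le mult_left_mono SUP_least ennreal_leI P) auto
  also have "(\<Sum>j. ennreal (weight n j) * ennreal (P j)) = (\<Sum>j. ennreal (weight n j * P j))"
    by (simp add: ennreal_mult P0)
  also have "\<dots> = ennreal (\<Sum>j. weight n j * P j)"
    using s P0 by (intro suminf_ennreal2) auto
  finally have "ennreal (vnorm v) \<le> ennreal (norm (v (birth n)) + (\<Sum>j. weight n j * P j))"
    using s P0 by (simp add: suminf_nonneg)
  then show ?thesis using s P0 by (subst (asm) ennreal_le_iff) (auto intro!: suminf_nonneg add_nonneg_nonneg)
qed

section \<open>The regular part\<close>

text \<open>A maximizing set exists because \<open>a\<close> has finite support. The maximality predicate is invariant under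
scaling of \<open>a\<close>, so the same set is picked for all multiples of a vector; exact homogeneity of the
regular part follows from this.\<close>

definition heaviest :: "(nat \<Rightarrow> real) \<Rightarrow> nat \<Rightarrow> nat set" where
  "heaviest a j = (SOME A. A \<in> capped j \<and> (\<forall>B\<in>capped j. sum a B \<le> sum a A))"

lemma heaviest:
  assumes "finite {k. a k \<noteq> 0}"
  shows "heaviest a j \<in> capped j" and "B \<in> capped j \<Longrightarrow> sum a B \<le> sum a (heaviest a j)"
proof -
  have "sum a ` capped j \<subseteq> sum a ` Pow {k. a k \<noteq> 0}"
  proof
    fix x assume "x \<in> sum a ` capped j"
    then obtain B where B: "B \<in> capped j" "x = sum a B" by auto
    have "sum a B = sum a (B \<inter> {k. a k \<noteq> 0})"
      using capped_finite[OF B(1)] by (intro sum.mono_neutral_right) auto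
    then show "x \<in> sum a ` Pow {k. a k \<noteq> 0}" using B(2) by auto
  qed
  then have fin: "finite (sum a ` capped j)" using assms finite_subset by blast
  then have "Max (sum a ` capped j) \<in> sum a ` capped j" by (intro Max_in) auto
  then obtain A where A: "A \<in> capped j" "sum a A = Max (sum a ` capped j)" by auto
  have "\<exists>A. A \<in> capped j \<and> (\<forall>B\<in>capped j. sum a B \<le> sum a A)"
    using A fin by (intro exI[of _ A]) auto
  from someI_ex[OF this]
  show "heaviest a j \<in> capped j" and "B \<in> capped j \<Longrightarrow> sum a B \<le> sum a (heaviest a j)"
    unfolding heaviest_def by auto
qed

lemma heaviest_mult:
  assumes "c > 0"
  shows "heaviest (\<lambda>k. c * a k) j = heaviest a j"
  unfolding heaviest_def using assms by (simp add: sum_distrib_left[symmetric])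

definition leading :: "nat \<Rightarrow> vec \<Rightarrow> nat \<Rightarrow> nat set" where
  "leading n v = heaviest (\<lambda>k. vnorm (layer n k v))"

definition mass :: "nat \<Rightarrow> vec \<Rightarrow> nat \<Rightarrow> real" where
  "mass n v j = (\<Sum>k\<in>leading n v j. vnorm (layer n k v))"

lemma vnorm_layer_finite:
  assumes "v \<in> level m"
  shows "finite {k. vnorm (layer n k v) \<noteq> 0}"
  by (rule finite_subset[OF _ finite_slices[OF levelD(2)[OF assms], of n]]) (auto intro: ccontr)

lemma leading_capped: "v \<in> level m \<Longrightarrow> leading n v j \<in> capped j"
  unfolding leading_def by (intro heaviest vnorm_layer_finite)

lemma sum_le_mass: "v \<in> level m \<Longrightarrow> B \<in> capped j \<Longrightarrow> (\<Sum>k\<in>B. vnorm (layer n k v)) \<le> mass n v j"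
  unfolding mass_def leading_def by (intro heaviest vnorm_layer_finite)

lemma mass_nonneg: "0 \<le> mass n v j" by (simp add: mass_def sum_nonneg)

lemma summable_mass: assumes "v \<in> level (Suc n)" shows "summable (\<lambda>j. weight n j * mass n v j)"
proof (rule summable_comparison_test'[OF vnorm_lower(1)[OF assms leading_capped[OF assms]]])
  show "norm (weight n j * mass n v j) \<le> weight n j * split_val n v (leading n v j)" for j
    by (simp add: mass_nonneg abs_mult) (simp add: mass_def)
qed

definition total_mass :: "nat \<Rightarrow> vec \<Rightarrow> real" where "total_mass n v = (\<Sum>j. weight n j * mass n v j)"

lemma total_mass_le_vnorm: assumes v: "v \<in> level (Suc n)" shows "total_mass n v \<le> vnorm v"
proof -
  have "total_mass n v \<le> (\<Sum>j. weight n j * split_val n v (leading n v j))"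
    unfolding total_mass_def
    by (intro suminf_le summable_mass v vnorm_lower(1)[OF v leading_capped[OF v, of n]] mult_left_mono) (auto simp: mass_def)
  then show ?thesis using vnorm_lower(2)[OF v leading_capped[OF v, of n]] norm_ge_zero[of "v (birth n)"] by linarith
qed

text \<open>Summation by parts, with \<open>w\<^sub>j = (1 + d) w\<^sub>j\<^sub>+\<^sub>1\<close>. No boundary term arises because the scales are unbounded.\<close>

lemma mass_increments:
  assumes v: "v \<in> level (Suc n)"
  shows "summable (\<lambda>j. weight n j * (mass n v (Suc j) - mass n v j))"
    and "(\<Sum>j. weight n j * (mass n v (Suc j) - mass n v j)) \<le> (1/2)^n / 8 * vnorm v"
proof -
  let ?d = "(1/2)^n / 8 :: real"
  let ?f = "\<lambda>j. weight n j * mass n v j"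
  have f: "summable ?f" by (rule summable_mass[OF v])
  then have f': "summable (\<lambda>j. ?f (Suc j))" by (subst summable_Suc_iff)
  have eq: "weight n j * (mass n v (Suc j) - mass n v j) = (1 + ?d) * ?f (Suc j) - ?f j" for j
  proof -
    have "weight n j * mass n v (Suc j) = (1 + ?d) * ?f (Suc j)" unfolding weight_Suc[of n j] by (simp only: mult.assoc)
    then show ?thesis unfolding right_diff_distrib by (rule arg_cong)
  qed
  show "summable (\<lambda>j. weight n j * (mass n v (Suc j) - mass n v j))"
    unfolding eq using f f' by (intro summable_diff summable_mult)
  have "(\<Sum>j. weight n j * (mass n v (Suc j) - mass n v j)) = (1 + ?d) * (\<Sum>j. ?f (Suc j)) - (\<Sum>j. ?f j)"
    unfolding eq using f f' by (simp add: suminf_diff[symmetric] suminf_mult summable_mult)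
  also have "\<dots> \<le> (1 + ?d) * total_mass n v - total_mass n v"
    using suminf_split_head[OF f] mass_nonneg[of n v 0] 
    by (auto simp: total_mass_def intro!: mult_left_mono)
  also have "\<dots> = ?d * total_mass n v" by (simp add: algebra_simps)
  also have "\<dots> \<le> ?d * vnorm v" by (intro mult_left_mono total_mass_le_vnorm v) simp
  finally show "(\<Sum>j. weight n j * (mass n v (Suc j) - mass n v j)) \<le> ?d * vnorm v" .
qed

text \<open>The map \<open>\<rho>\<close> of the introduction. The series converges in each coordinate because only finitely many layers
of a vector of a level are non-zero.\<close>

definition regular_part :: "nat \<Rightarrow> vec \<Rightarrow> vec" where
  "regular_part n v = (\<lambda>s. \<Sum>j. scl (of_real (weight n j)) (layer n 0 v - (\<Sum>k\<in>leading n v j. layer n k v)) s)"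

lemma regular_part_sums:
  assumes v: "v \<in> level m"
  shows "(\<lambda>j. scl (of_real (weight n j)) (layer n 0 v - (\<Sum>k\<in>leading n v j. layer n k v)) s) sums regular_part n v s"
  unfolding regular_part_def
proof (rule summable_sums, rule summable_comparison_test')
  let ?B = "{k. layer n k v \<noteq> 0}"
  define C where "C = norm (layer n 0 v s) + (\<Sum>k\<in>?B. norm (layer n k v s))"
  have B: "finite ?B" by (rule finite_slices[OF levelD(2)[OF v]])
  show "summable (\<lambda>j. weight n j * C)" using weight_sums sums_summable summable_mult2 by blast
  fix j
  have "norm (\<Sum>k\<in>leading n v j. layer n k v s) \<le> (\<Sum>k\<in>leading n v j. norm (layer n k v s))"
    by (rule norm_sum)
  also have "\<dots> = (\<Sum>k\<in>leading n v j \<inter> ?B. norm (layer n k v s))"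
    using capped_finite[OF leading_capped[OF v]]
    by (intro sum.mono_neutral_right) (auto simp: pointwise)
  also have "\<dots> \<le> (\<Sum>k\<in>?B. norm (layer n k v s))" using B by (intro sum_mono2) auto
  finally have "norm (layer n 0 v s - (\<Sum>k\<in>leading n v j. layer n k v s)) \<le> C"
    unfolding C_def by (intro order_trans[OF norm_triangle_ineq4] add_left_mono)
  then show "norm (scl (of_real (weight n j)) (layer n 0 v - (\<Sum>k\<in>leading n v j. layer n k v)) s) \<le> weight n j * C"
    by (simp add: pointwise norm_mult mult_left_mono)
qed

lemma regular_part_level: assumes v: "v \<in> level (Suc n)" shows "regular_part n v \<in> level n"
proof -
  have K': "regular_part n v s \<in> K" for s
    by (rule K_sums[OF regular_part_sums[OF v]])
      (auto simp: pointwise intro!: K_mult K_diff K_sum levelD(1)[OF level_layer[OF v]])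
  have sub: "supp (regular_part n v) \<subseteq> (\<lambda>t. t(n := 0)) ` supp v \<inter> indices n"
  proof
    fix s assume "s \<in> supp (regular_part n v)"
    then have r: "regular_part n v s \<noteq> 0" by (simp add: supp_def)
    have "\<exists>k. layer n k v s \<noteq> 0"
    proof (rule ccontr)
      assume "\<nexists>k. layer n k v s \<noteq> 0"
      then show False using r by (simp add: regular_part_def pointwise)
    qed
    then obtain k where "s \<in> supp (layer n k v)" by (auto simp: supp_def)
    then show "s \<in> (\<lambda>t. t(n := 0)) ` supp v \<inter> indices n" using supp_layer[of n k v] by auto
  qed
  then have "finite (supp (regular_part n v))" using levelD(2)[OF v] by (auto intro: finite_subset)
  then show ?thesis using K' sub by (auto simp: level_def)
qed

lemma regular_part_id: assumes v: "v \<in> level n" shows "regular_part n v = v"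
proof
  fix s
  have "layer n 0 v - (\<Sum>k\<in>leading n v j. layer n k v) = v" for j
  proof -
    have "layer n k v = 0" if "k \<in> leading n v j" for k
      using leading_capped[OF v, of n j] that levelD(3)[OF v] by (intro layer_eq_0) (auto simp: capped_def)
    then show ?thesis using layer_0_id[OF levelD(3)[OF v]] by simp
  qed
  then have "(\<lambda>j. complex_of_real (weight n j) * v s) sums regular_part n v s"
    using regular_part_sums[OF v, of n s] by (simp add: pointwise)
  moreover have "(\<lambda>j. complex_of_real (weight n j) * v s) sums (complex_of_real 1 * v s)"
    by (intro sums_mult2 sums_of_real weight_sums)
  ultimately show "regular_part n v s = v s" using sums_unique2 by fastforce
qed

lemma regular_part_scl: assumes v: "v \<in> level (Suc n)" shows "regular_part n (scl c v) = scl c (regular_part n v)"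
proof (cases "c = 0")
  case True
  then show ?thesis using regular_part_id[of 0 n] by simp
next
  case False
  have "leading n (scl c v) = leading n v"
    unfolding leading_def layer_scl vnorm_scl using False by (intro ext heaviest_mult) simp
  then have "(\<lambda>j. c * scl (of_real (weight n j)) (layer n 0 v - (\<Sum>k\<in>leading n v j. layer n k v)) s)
      = (\<lambda>j. scl (of_real (weight n j)) (layer n 0 (scl c v) - (\<Sum>k\<in>leading n (scl c v) j. layer n k (scl c v))) s)" for s
    by (simp add: layer_scl pointwise algebra_simps sum_distrib_left)
  then have "(\<lambda>j. scl (of_real (weight n j)) (layer n 0 (scl c v) - (\<Sum>k\<in>leading n (scl c v) j. layer n k (scl c v))) s)
     sums (c * regular_part n v s)" for s
    using sums_mult[OF regular_part_sums[OF v, of n s], of c] by simp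
  then show ?thesis by (auto simp: regular_part_def[of n "scl c v"] pointwise sums_iff)
qed

text \<open>The norm is convex, also for infinite convex combinations.\<close>

lemma vnorm_weight_sums:
  assumes u: "\<And>j. u j \<in> level n" and p: "\<And>j. vnorm (u j) \<le> p j" and s: "summable (\<lambda>j. weight n' j * p j)"
    and w: "\<And>s. (\<lambda>j. scl (of_real (weight n' j)) (u j) s) sums v s"
  shows "vnorm v \<le> (\<Sum>j. weight n' j * p j)"
proof -
  have le: "vnorm (scl (of_real (weight n' j)) (u j)) \<le> weight n' j * p j" for j
    by (simp add: vnorm_scl p mult_left_mono)
  have s': "summable (\<lambda>j. vnorm (scl (of_real (weight n' j)) (u j)))"
    by (rule summable_comparison_test'[OF s]) (use le in simp)
  have "vnorm v \<le> (\<Sum>j. vnorm (scl (of_real (weight n' j)) (u j)))"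
    by (rule vnorm_sums_le[OF w _ s']) (intro finite_norm_scl level_finite_norm[OF u])
  also have "\<dots> \<le> (\<Sum>j. weight n' j * p j)" by (intro suminf_le le s s')
  finally show ?thesis .
qed

text \<open>With \<open>A\<close> the leading layers at each scale, the norm is at least \<open>\<parallel>\<rho>(v)\<parallel> + Q\<close>, where \<open>Q\<close> is the total
mass. On the other hand \<open>v - \<rho>(v)\<close> has the layers of \<open>v\<close>, and its total is the weighted sum of what
has been removed, of norm at most \<open>Q\<close>. A term at scale \<open>j\<close> is therefore at most \<open>Q\<close> plus twice the
mass at scale \<open>j\<close>, which sums up to \<open>3 Q\<close>.\<close>

lemma regular_part_split:
  assumes v: "v \<in> level (Suc n)"
  shows "vnorm (regular_part n v) + vnorm (v - regular_part n v) / 3 \<le> vnorm v"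
proof -
  let ?u = "\<lambda>j. layer n 0 v - (\<Sum>k\<in>leading n v j. layer n k v)"
  have L: "?u j \<in> level n" "(\<Sum>k\<in>leading n v j. layer n k v) \<in> level n" for j
    by (intro level_diff level_sum level_layer[OF v], intro level_sum level_layer[OF v])
  have sq: "summable (\<lambda>j. weight n j * mass n v j)" by (rule summable_mass[OF v])
  have sp: "summable (\<lambda>j. weight n j * split_val n v (leading n v j))"
    by (rule vnorm_lower(1)[OF v leading_capped[OF v, of n]])
  have su: "summable (\<lambda>j. weight n j * vnorm (?u j))"
    by (rule summable_comparison_test'[OF sp]) (auto simp: abs_mult intro!: mult_left_mono sum_nonneg)
  have "vnorm (regular_part n v) \<le> (\<Sum>j. weight n j * vnorm (?u j))"
    by (rule vnorm_weight_sums[OF L(1) order_refl su regular_part_sums[OF v]])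
  moreover have "(\<Sum>j. weight n j * split_val n v (leading n v j)) = (\<Sum>j. weight n j * vnorm (?u j)) + total_mass n v"
    unfolding total_mass_def mass_def[symmetric] distrib_left using su sq by (simp add: suminf_add)
  ultimately have 1: "norm (v (birth n)) + vnorm (regular_part n v) + total_mass n v \<le> vnorm v"
    using vnorm_lower(2)[OF v leading_capped[OF v, of n]] by linarith
  have 2: "vnorm (layer n 0 v - regular_part n v) \<le> total_mass n v"
    unfolding total_mass_def
  proof (rule vnorm_weight_sums[OF L(2) _ sq])
    show "vnorm (\<Sum>k\<in>leading n v j. layer n k v) \<le> mass n v j" for j
      unfolding mass_def by (intro vnorm_sum level_finite_norm[OF level_layer[OF v]])
    fix s
    have "(\<lambda>j. complex_of_real (weight n j) * layer n 0 v s) sums (complex_of_real 1 * layer n 0 v s)"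
      by (intro sums_mult2 sums_of_real weight_sums)
    from sums_diff[OF this regular_part_sums[OF v, of n s]]
    show "(\<lambda>j. scl (of_real (weight n j)) (\<Sum>k\<in>leading n v j. layer n k v) s) sums (layer n 0 v - regular_part n v) s"
      by (simp add: pointwise algebra_simps)
  qed
  let ?w = "v - regular_part n v"
  have r: "regular_part n v \<in> level n" by (rule regular_part_level[OF v])
  have w: "?w \<in> level (Suc n)" using v level_mono[OF _ r, of "Suc n"] by (intro level_diff) auto
  have s0: "layer n 0 ?w = layer n 0 v - regular_part n v" using layer_0_id[OF levelD(3)[OF r]] by (simp add: layer_diff)
  have sk: "layer n k ?w = layer n k v" if "k \<noteq> 0" for k
    using layer_eq_0[OF levelD(3)[OF r] that] by (simp add: layer_diff)
  have nn: "?w (birth n) = v (birth n)"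
    using levelD(3)[OF r] birth_notin_indices[of n n] by (auto simp: supp_def pointwise)
  have "vnorm ?w \<le> norm (?w (birth n)) + (\<Sum>j. weight n j * (total_mass n v + 2 * mass n v j))"
  proof (rule vnorm_upper[OF w])
    fix j A assume A: "A \<in> capped j"
    then have k0: "k \<in> A \<Longrightarrow> k \<noteq> 0" for k by (auto simp: capped_def)
    have "(\<Sum>k\<in>A. vnorm (layer n k v)) \<le> mass n v j" by (rule sum_le_mass[OF v A])
    moreover have "vnorm (layer n 0 v - regular_part n v - (\<Sum>k\<in>A. layer n k v)) \<le>
        vnorm (layer n 0 v - regular_part n v) + (\<Sum>k\<in>A. vnorm (layer n k v))"
      using v r by (intro order_trans[OF vnorm_diff] add_left_mono vnorm_sum level_finite_norm[of _ n] level_diff level_sum level_layer)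
    ultimately show "split_val n ?w A \<le> total_mass n v + 2 * mass n v j"
      using 2 sk k0 by (simp add: s0)
  next
    show "summable (\<lambda>j. weight n j * (total_mass n v + 2 * mass n v j))"
      unfolding distrib_left mult.left_commute[of _ 2]
      using sums_summable[OF weight_sums] sq by (intro summable_add summable_mult summable_mult2)
  qed
  also have "(\<Sum>j. weight n j * (total_mass n v + 2 * mass n v j)) = 3 * total_mass n v"
  proof -
    have "(\<lambda>j. weight n j * total_mass n v + 2 * (weight n j * mass n v j)) sums (1 * total_mass n v + 2 * total_mass n v)"
      using summable_sums[OF sq] by (intro sums_add sums_mult2 sums_mult weight_sums) (simp add: total_mass_def)
    then show ?thesis by (simp add: sums_iff algebra_simps)
  qed
  finally show ?thesis using 1 norm_ge_zero[of "v (birth n)"] unfolding nn by linarith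
qed

lemma vnorm_regular_part_le: "v \<in> level (Suc n) \<Longrightarrow> vnorm (regular_part n v) \<le> vnorm v"
  using regular_part_split[of v n] vnorm_nonneg[of "v - regular_part n v"] by linarith

text \<open>By maximality, the larger set carries at most the mass of the next scale, so what it carries in
addition to the leading layers is at most the increment.\<close>

lemma leading_excess:
  assumes x: "x \<in> level (Suc n)" and B: "B \<in> capped (Suc j)" "leading n x j \<subseteq> B"
  shows "vnorm ((\<Sum>k\<in>B. layer n k x) - (\<Sum>k\<in>leading n x j. layer n k x)) \<le> mass n x (Suc j) - mass n x j"
proof -
  have fB: "finite B" by (rule capped_finite[OF B(1)])
  have eq: "(\<Sum>k\<in>B. layer n k x) - (\<Sum>k\<in>leading n x j. layer n k x) = (\<Sum>k\<in>B - leading n x j. layer n k x)"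
    using sum_diff[OF fB B(2), of "\<lambda>k. layer n k x"] by simp
  have "vnorm ((\<Sum>k\<in>B. layer n k x) - (\<Sum>k\<in>leading n x j. layer n k x)) \<le> (\<Sum>k\<in>B - leading n x j. vnorm (layer n k x))"
    unfolding eq by (intro vnorm_sum level_finite_norm[OF level_layer[OF x]])
  also have "\<dots> = (\<Sum>k\<in>B. vnorm (layer n k x)) - mass n x j"
    unfolding mass_def by (rule sum_diff[OF fB B(2)])
  also have "\<dots> \<le> mass n x (Suc j) - mass n x j"
    using sum_le_mass[OF x B(1), of n] by simp
  finally show ?thesis .
qed

text \<open>Let \<open>d = c - a - b\<close>. At scale \<open>j\<close> the four vectors \<open>a, b, c, d\<close> have at most \<open>4 \<cdot> 4\<^sup>j\<close> leading layers
altogether, which is why the scales are powers of \<open>4\<close>. Removing the layers of this common set is a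
linear operation, and by \<open>leading_excess\<close> it differs from the removal of the leading layers by
increments, whose weighted sums are small.\<close>

lemma regular_part_quasi_additive:
  assumes a: "a \<in> level (Suc n)" and b: "b \<in> level (Suc n)" and c: "c \<in> level (Suc n)"
  shows "vnorm (regular_part n c - regular_part n a - regular_part n b)
    \<le> (1 + (1/2)^n / 4) * vnorm (c - a - b) + (1/2)^n / 4 * (vnorm a + vnorm b)"
proof -
  define d where "d = c - a - b"
  have d: "d \<in> level (Suc n)" unfolding d_def by (intro level_diff a b c)
  have cd: "c = a + b + d" by (simp add: d_def)
  define B where "B j = leading n a j \<union> leading n b j \<union> leading n c j \<union> leading n d j" for j
  have B: "B j \<in> capped (Suc j)" for j
  proof -
    have s: "leading n a j \<in> capped j" "leading n b j \<in> capped j" "leading n c j \<in> capped j" "leading n d j \<in> capped j"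
      using a b c d by (auto intro: leading_capped)
    have "card (B j) \<le> card (leading n a j) + card (leading n b j) + card (leading n c j) + card (leading n d j)"
      unfolding B_def by (meson add_mono card_Un_le order_trans order_refl)
    then show ?thesis using s unfolding capped_def by (auto simp: B_def)
  qed
  define e where "e j x = (\<Sum>k\<in>B j. layer n k x) - (\<Sum>k\<in>leading n x j. layer n k x)" for j x
  let ?i = "\<lambda>x j. mass n x (Suc j) - mass n x j"
  have ne: "vnorm (e j x) \<le> ?i x j" if "x \<in> {a, b, c, d}" for j x
    unfolding e_def using that a b c d by (intro leading_excess B) (auto simp: B_def)
  have eL: "e j x \<in> level n" if "x \<in> {a, b, c, d}" for j x
    unfolding e_def using that a b c d by (intro level_diff level_sum level_layer[of _ "Suc n"]) auto
  have si: "summable (\<lambda>j. weight n j * ?i x j)" if "x \<in> {a, b, c, d}" for x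
    using that a b c d by (intro mass_increments) auto
  have ii: "(\<Sum>j. weight n j * ?i x j) \<le> (1/2)^n / 8 * vnorm x" if "x \<in> {a, b, c, d}" for x
    using that a b c d by (intro mass_increments) auto
  have "vnorm (regular_part n c - regular_part n a - regular_part n b - regular_part n d)
      \<le> (\<Sum>j. weight n j * (?i c j + ?i a j + ?i b j + ?i d j))"
  proof (rule vnorm_weight_sums)
    show "e j c - e j a - e j b - e j d \<in> level n" for j by (intro level_diff eL) auto
    show "vnorm (e j c - e j a - e j b - e j d) \<le> ?i c j + ?i a j + ?i b j + ?i d j" for j
    proof -
      have bd: "finite_norm (e j c)" "finite_norm (e j a)" "finite_norm (e j b)" "finite_norm (e j d)"
        by (auto intro: level_finite_norm eL)
      have "vnorm (e j c - e j a - e j b - e j d) \<le> vnorm (e j c) + vnorm (e j a) + vnorm (e j b) + vnorm (e j d)"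
        using vnorm_diff[OF finite_norm_diff[OF finite_norm_diff[OF bd(1,2)] bd(3)] bd(4)]
          vnorm_diff[OF finite_norm_diff[OF bd(1,2)] bd(3)] vnorm_diff[OF bd(1,2)] by linarith
      then show ?thesis using ne[of a j] ne[of b j] ne[of c j] ne[of d j] by simp
    qed
    show "summable (\<lambda>j. weight n j * (?i c j + ?i a j + ?i b j + ?i d j))"
      unfolding distrib_left by (intro summable_add si) auto
    fix s
    let ?r = "\<lambda>x j. scl (of_real (weight n j)) (layer n 0 x - (\<Sum>k\<in>leading n x j. layer n k x)) s"
    have "(\<lambda>j. ?r c j - ?r a j - ?r b j - ?r d j) sums
        (regular_part n c s - regular_part n a s - regular_part n b s - regular_part n d s)"
      by (intro sums_diff regular_part_sums[of _ "Suc n"] a b c d)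
    moreover have "?r c j - ?r a j - ?r b j - ?r d j
        = scl (of_real (weight n j)) (e j c - e j a - e j b - e j d) s" for j
    proof -
      have "(\<Sum>k\<in>B j. layer n k c s) = (\<Sum>k\<in>B j. layer n k a s) + (\<Sum>k\<in>B j. layer n k b s) + (\<Sum>k\<in>B j. layer n k d s)"
        unfolding cd layer_add by (simp add: pointwise sum.distrib)
      moreover have "layer n 0 c s = layer n 0 a s + layer n 0 b s + layer n 0 d s"
        unfolding cd layer_add by (simp add: pointwise)
      ultimately show ?thesis by (simp add: e_def pointwise algebra_simps)
    qed
    ultimately show "(\<lambda>j. scl (of_real (weight n j)) (e j c - e j a - e j b - e j d) s) sums
      (regular_part n c - regular_part n a - regular_part n b - regular_part n d) s" by (simp add: pointwise)
  qed
  also have "\<dots> = (\<Sum>j. weight n j * ?i c j) + (\<Sum>j. weight n j * ?i a j) + (\<Sum>j. weight n j * ?i b j) + (\<Sum>j. weight n j * ?i d j)"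
    unfolding distrib_left using si by (simp add: suminf_add[symmetric] summable_add)
  also have "\<dots> \<le> (1/2)^n / 8 * (vnorm c + vnorm a + vnorm b + vnorm d)"
    using ii[of a] ii[of b] ii[of c] ii[of d] by (simp add: algebra_simps)
  also have "\<dots> \<le> (1/2)^n / 8 * (2 * (vnorm a + vnorm b + vnorm d))"
  proof (rule mult_left_mono)
    have "vnorm c \<le> vnorm a + vnorm b + vnorm d"
      unfolding cd using vnorm_add[of "a + b" d] vnorm_add[of a b] level_finite_norm a b d
      by (auto simp: finite_norm_add)
    then show "vnorm c + vnorm a + vnorm b + vnorm d \<le> 2 * (vnorm a + vnorm b + vnorm d)" by simp
  qed simp
  also have "\<dots> = (1/2)^n / 4 * (vnorm a + vnorm b + vnorm d)" by (simp add: field_simps)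
  finally have 1: "vnorm (regular_part n c - regular_part n a - regular_part n b - regular_part n d) \<le> (1/2)^n / 4 * (vnorm a + vnorm b + vnorm d)" .
  have "vnorm (regular_part n c - regular_part n a - regular_part n b) \<le> vnorm (regular_part n c - regular_part n a - regular_part n b - regular_part n d) + vnorm (regular_part n d)"
    using vnorm_add[of "regular_part n c - regular_part n a - regular_part n b - regular_part n d" "regular_part n d"] a b c d
    by (simp add: level_finite_norm[of _ n] level_diff regular_part_level)
  also have "vnorm (regular_part n d) \<le> vnorm d" by (rule vnorm_regular_part_le[OF d])
  finally have 2: "vnorm (regular_part n c - regular_part n a - regular_part n b)
      \<le> vnorm (regular_part n c - regular_part n a - regular_part n b - regular_part n d) + vnorm d" by simp
  have "X \<le> (1 + t / 4) * D + t / 4 * S" if "Y \<le> t / 4 * (S + D)" "X \<le> Y + D" for X Y D S t :: real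
    using that by (simp add: algebra_simps)
  from this[OF 1 2] show ?thesis unfolding d_def by simp
qed

section \<open>Coefficients of the fresh vectors\<close>

text \<open>On vectors of level \<open>n\<close>, this passes to the regular part until level \<open>m + 1\<close> is reached, where \<open>x\<^sub>m\<close> spans an
\<open>\<ell>\<^sub>1\<close>-summand.\<close>

primrec coeff_from :: "nat \<Rightarrow> nat \<Rightarrow> vec \<Rightarrow> complex" where
  "coeff_from m 0 v = v (birth m)"
| "coeff_from m (Suc n) v = (if n \<le> m then v (birth m) else coeff_from m n (regular_part n v))"

lemma coeff_from_base: "n \<le> Suc m \<Longrightarrow> coeff_from m n v = v (birth m)"
  by (cases n) auto

lemma coeff_from_stable: "v \<in> level n \<Longrightarrow> coeff_from m (Suc n) v = coeff_from m n v"
  by (auto simp: coeff_from_base regular_part_id)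

lemma coeff_from_in_K: "v \<in> level n \<Longrightarrow> coeff_from m n v \<in> K"
  by (induction n arbitrary: v) (auto simp: regular_part_level levelD(1))

lemma coeff_from_scl: "v \<in> level n \<Longrightarrow> coeff_from m n (scl c v) = c * coeff_from m n v"
  by (induction n arbitrary: v) (auto simp: regular_part_level regular_part_scl pointwise)

definition unit_vec :: "nat \<Rightarrow> vec" where
  "unit_vec m = (\<lambda>s. if s = birth m then 1 else 0)"

lemma unit_vec_level: "unit_vec m \<in> level (Suc m)"
proof -
  have "supp (unit_vec m) = {birth m}" by (auto simp: supp_def unit_vec_def)
  then show ?thesis using birth_in_indices by (auto simp: level_def unit_vec_def)
qed

text \<open>Neither the total nor the layers of a vector of level \<open>m + 1\<close> involve the coordinate of \<open>x\<^sub>m\<close>, which therefore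
enters the norm only through its absolute value.\<close>

lemma vnorm_Suc_split:
  assumes v: "v \<in> level (Suc m)"
  shows "vnorm v = norm (v (birth m)) + vnorm (v - scl (v (birth m)) (unit_vec m))"
proof -
  let ?w = "v - scl (v (birth m)) (unit_vec m)"
  have w: "?w \<in> level (Suc m)" by (intro level_diff v level_scl unit_vec_level levelD(1)[OF v])
  have "layer m k (unit_vec m) = 0" if "k \<noteq> 1" for k
  proof
    fix s
    have "s(m := k) \<noteq> birth m" using that by (auto simp: birth_def fun_eq_iff)
    then show "layer m k (unit_vec m) s = 0 s" by (simp add: layer_def unit_vec_def pointwise)
  qed
  then have k: "layer m k ?w = layer m k v" if "k \<noteq> 1" for k
    using that by (simp add: layer_diff layer_scl)
  have "(SUP A\<in>capped j. level_norm m (layer m 0 ?w - (\<Sum>k\<in>A. layer m k ?w)) + (\<Sum>k\<in>A. level_norm m (layer m k ?w))) =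
    (SUP A\<in>capped j. level_norm m (layer m 0 v - (\<Sum>k\<in>A. layer m k v)) + (\<Sum>k\<in>A. level_norm m (layer m k v)))" for j
  proof (rule SUP_cong[OF refl])
    fix A assume "A \<in> capped j"
    then have "layer m i ?w = layer m i v" if "i \<in> A" for i
      using that k[of i] by (auto simp: capped_def)
    then show "level_norm m (layer m 0 ?w - (\<Sum>k\<in>A. layer m k ?w)) + (\<Sum>k\<in>A. level_norm m (layer m k ?w)) =
        level_norm m (layer m 0 v - (\<Sum>k\<in>A. layer m k v)) + (\<Sum>k\<in>A. level_norm m (layer m k v))"
      using k[of 0] by simp
  qed
  moreover have "?w (birth m) = 0" by (simp add: unit_vec_def pointwise)
  ultimately have "level_norm (Suc m) v = ennreal (norm (v (birth m))) + level_norm (Suc m) ?w" by simp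
  then have "ennreal (vnorm v) = ennreal (norm (v (birth m)) + vnorm ?w)"
    unfolding level_norm_level[OF v] level_norm_level[OF w] by simp
  then show ?thesis by (subst (asm) ennreal_inj) auto
qed

lemma vnorm_unit_vec: "vnorm (unit_vec m) = 1"
  using vnorm_Suc_split[OF unit_vec_level, of m] by (simp add: unit_vec_def)

text \<open>The inequality \<open>regular_part_split\<close> is stable under composition: the parts removed at the successive levels
add up, by the triangle inequality.\<close>

lemma coeff_from_split:
  assumes "v \<in> level n"
  shows "norm (coeff_from m n v) + vnorm (v - scl (coeff_from m n v) (unit_vec m)) / 3 \<le> vnorm v"
proof (cases "n \<le> Suc m")
  case True
  then have "v \<in> level (Suc m)" using assms level_mono by blast
  from vnorm_Suc_split[OF this] show ?thesis
    using coeff_from_base[OF True, of v] vnorm_nonneg[of "v - scl (v (birth m)) (unit_vec m)"] by simp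
next
  case False
  then have "Suc m \<le> n" by simp
  then show ?thesis using assms
  proof (induction n arbitrary: v rule: dec_induct)
    case base
    from vnorm_Suc_split[OF this] show ?case
      using coeff_from_base[of "Suc m" m v] vnorm_nonneg[of "v - scl (v (birth m)) (unit_vec m)"] by simp
  next
    case (step n)
    let ?r = "regular_part n v"
    have r: "?r \<in> level n" by (rule regular_part_level[OF step.prems])
    have regular_coeff: "coeff_from m (Suc n) v = coeff_from m n ?r" using step.hyps by simp
    let ?x = "scl (coeff_from m n ?r) (unit_vec m)"
    have x: "finite_norm ?x" by (intro finite_norm_scl level_finite_norm[OF unit_vec_level])
    have "vnorm (v - ?x) \<le> vnorm (v - ?r) + vnorm (?r - ?x)"
      by (intro vnorm_triangle level_finite_norm[OF step.prems] level_finite_norm[OF r] x)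
    then show ?case using step.IH[OF r] regular_part_split[OF step.prems] unfolding regular_coeff by simp
  qed
qed

text \<open>Carrying the defect \<open>c - a - b\<close> along is essential. With exact sums the constant would be multiplied by
a factor at each level, whereas here the defect is transported by \<open>\<rho>\<close> with a factor \<open>1 + O(2\<^sup>-\<^sup>n)\<close> and
increased by \<open>O(2\<^sup>-\<^sup>n)\<close>. The two coefficients on the right are explicit bounds for the
resulting product and sum.\<close>

lemma coeff_from_quasi_additive:
  assumes "Suc m \<le> n" "a \<in> level n" "b \<in> level n" "c \<in> level n"
  shows "norm (coeff_from m n c - coeff_from m n a - coeff_from m n b)
    \<le> (3 - 2 * (1/2)^n) * vnorm (c - a - b) + 2 * ((1/2)^m - (1/2)^n) * (vnorm a + vnorm b)"
  using assms
proof (induction n arbitrary: a b c rule: dec_induct)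
  case base
  let ?d = "c - a - b"
  have d: "?d \<in> level (Suc m)" using base by (intro level_diff)
  have p: "(1/2::real)^Suc m \<le> 1" "(1/2::real)^Suc m \<le> (1/2)^m"
    using power_le_one[of "1/2::real" m] by auto
  have "coeff_from m (Suc m) c - coeff_from m (Suc m) a - coeff_from m (Suc m) b = ?d (birth m)"
    by (simp add: pointwise)
  then have "norm (coeff_from m (Suc m) c - coeff_from m (Suc m) a - coeff_from m (Suc m) b) \<le> 1 * vnorm ?d"
    using vnorm_Suc_split[OF d] by simp
  also have "\<dots> \<le> (3 - 2 * (1/2)^Suc m) * vnorm ?d"
    using p(1) by (intro mult_right_mono) auto
  also have "\<dots> \<le> \<dots> + 2 * ((1/2)^m - (1/2)^Suc m) * (vnorm a + vnorm b)"
    using p(2) by simp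
  finally show ?case .
next
  case (step n)
  let ?ra = "regular_part n a" and ?rb = "regular_part n b" and ?rc = "regular_part n c"
  define t :: real where "t = (1/2)^n"
  define T :: real where "T = (1/2)^m"
  define D where "D = vnorm (c - a - b)"
  define S where "S = vnorm a + vnorm b"
  have D0: "0 \<le> D" and S0: "0 \<le> S" by (auto simp: D_def S_def)
  have t: "0 \<le> t" "t \<le> 1" by (auto simp: t_def intro: power_le_one)
  have tT: "t \<le> T" unfolding t_def T_def using step.hyps by (intro power_decreasing) auto
  have regular_coeff: "coeff_from m (Suc n) v = coeff_from m n (regular_part n v)" for v using step.hyps by simp
  have "norm (coeff_from m (Suc n) c - coeff_from m (Suc n) a - coeff_from m (Suc n) b)
      \<le> (3 - 2 * t) * vnorm (?rc - ?ra - ?rb) + 2 * (T - t) * (vnorm ?ra + vnorm ?rb)"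
    unfolding regular_coeff t_def T_def by (intro step.IH regular_part_level step.prems)
  also have "\<dots> \<le> (3 - 2 * t) * ((1 + t / 4) * D + t / 4 * S) + 2 * (T - t) * S"
  proof (intro add_mono mult_left_mono)
    show "vnorm (?rc - ?ra - ?rb) \<le> (1 + t / 4) * D + t / 4 * S"
      using regular_part_quasi_additive[OF step.prems] by (simp add: t_def D_def S_def)
    show "vnorm ?ra + vnorm ?rb \<le> S"
      unfolding S_def by (intro add_mono vnorm_regular_part_le step.prems)
  qed (use t tT in auto)
  also have "\<dots> = (3 - 5 / 4 * t - t * t / 2) * D + (2 * T - 5 / 4 * t - t * t / 2) * S"
    by (simp add: field_simps)
  also have "\<dots> \<le> (3 - t) * D + (2 * T - t) * S"
    by (intro add_mono mult_right_mono D0 S0) (use t mult_nonneg_nonneg[OF t(1) t(1)] in linarith)+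
  finally show ?case by (simp add: t_def T_def D_def S_def algebra_simps)
qed

definition finitary :: "vec set" where "finitary = (\<Union>n. level n)"

lemma finitaryI: "v \<in> level n \<Longrightarrow> v \<in> finitary" by (auto simp: finitary_def)

lemma finitary_common:
  assumes "a \<in> finitary" "b \<in> finitary" "c \<in> finitary"
  obtains n where "n \<ge> k" "a \<in> level n" "b \<in> level n" "c \<in> level n"
proof -
  obtain i j l where "a \<in> level i" "b \<in> level j" "c \<in> level l" using assms by (auto simp: finitary_def)
  then have "a \<in> level (i + j + l + k)" "b \<in> level (i + j + l + k)" "c \<in> level (i + j + l + k)"
    by (auto elim: level_mono[rotated])
  then show ?thesis using that[of "i + j + l + k"] by simp
qed

lemma finitary_zero [simp]: "0 \<in> finitary" by (rule finitaryI[of _ 0]) simp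
lemma finitary_add: "u \<in> finitary \<Longrightarrow> v \<in> finitary \<Longrightarrow> u + v \<in> finitary"
  by (erule (1) finitary_common[of u v v]) (auto intro: finitaryI level_add)
lemma finitary_diff: "u \<in> finitary \<Longrightarrow> v \<in> finitary \<Longrightarrow> u - v \<in> finitary"
  by (erule (1) finitary_common[of u v v]) (auto intro: finitaryI level_diff)
lemma finitary_scl: "c \<in> K \<Longrightarrow> v \<in> finitary \<Longrightarrow> scl c v \<in> finitary"
  by (auto simp: finitary_def intro: level_scl)
lemma finitary_finite_norm: "v \<in> finitary \<Longrightarrow> finite_norm v" by (auto simp: finitary_def level_finite_norm)

text \<open>The value does not depend on the level chosen for \<open>v\<close>, because the regular part fixes vectors of the lower
level.\<close>

definition regular_coeff :: "nat \<Rightarrow> vec \<Rightarrow> complex" where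
  "regular_coeff m v = coeff_from m (LEAST n. v \<in> level n) v"

lemma regular_coeff_eq: assumes "v \<in> level n" shows "regular_coeff m v = coeff_from m n v"
proof -
  let ?l = "LEAST n. v \<in> level n"
  have l: "v \<in> level ?l" "?l \<le> n" using assms by (auto intro: LeastI Least_le)
  have "coeff_from m (?l + k) v = coeff_from m ?l v" for k
  proof (induction k)
    case (Suc k)
    then show ?case using coeff_from_stable[OF level_mono[OF _ l(1)], of "?l + k" m] by simp
  qed simp
  from this[of "n - ?l"] show ?thesis using l(2) by (simp add: regular_coeff_def)
qed

lemma regular_coeff_in_K: "v \<in> finitary \<Longrightarrow> regular_coeff m v \<in> K"
  by (auto simp: finitary_def regular_coeff_eq coeff_from_in_K)

lemma regular_coeff_scl: assumes "c \<in> K" "v \<in> finitary" shows "regular_coeff m (scl c v) = c * regular_coeff m v"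
proof -
  obtain n where n: "v \<in> level n" using assms by (auto simp: finitary_def)
  show ?thesis unfolding regular_coeff_eq[OF n] regular_coeff_eq[OF level_scl[OF assms(1) n]] by (rule coeff_from_scl[OF n])
qed

lemma regular_coeff_split: "v \<in> finitary \<Longrightarrow> norm (regular_coeff m v) + vnorm (v - scl (regular_coeff m v) (unit_vec m)) / 3 \<le> vnorm v"
  unfolding finitary_def by (auto simp: regular_coeff_eq coeff_from_split)

lemma regular_coeff_quasi_additive:
  assumes "a \<in> finitary" "b \<in> finitary" "c \<in> finitary"
  shows "norm (regular_coeff m c - regular_coeff m a - regular_coeff m b) \<le> 3 * vnorm (c - a - b) + 2 * (1/2)^m * (vnorm a + vnorm b)"
proof -
  obtain n where n: "n \<ge> Suc m" "a \<in> level n" "b \<in> level n" "c \<in> level n"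
    using finitary_common[OF assms] by blast
  have "norm (regular_coeff m c - regular_coeff m a - regular_coeff m b) \<le>
      (3 - 2 * (1/2)^n) * vnorm (c - a - b) + 2 * ((1/2)^m - (1/2)^n) * (vnorm a + vnorm b)"
    using coeff_from_quasi_additive[OF n] n by (simp add: regular_coeff_eq)
  also have "\<dots> \<le> 3 * vnorm (c - a - b) + 2 * (1/2)^m * (vnorm a + vnorm b)"
    by (intro add_mono mult_right_mono) auto
  finally show ?thesis .
qed

lemma regular_coeff_unit_vec: "regular_coeff m (unit_vec m) = 1"
  using regular_coeff_eq[OF unit_vec_level, of m m] by (simp add: unit_vec_def)

section \<open>The Banach space\<close>

text \<open>The condition on \<open>supp\<close> is needed since coordinates outside of all \<open>indices n\<close> do not enter the norm.\<close>

definition tower :: "vec set" where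
  "tower = {v. (\<forall>s. v s \<in> K) \<and> supp v \<subseteq> (\<Union>n. indices n) \<and> finite_norm v \<and> (\<forall>e>0. \<exists>u\<in>finitary. vnorm (v - u) < e)}"

definition tower_space :: "vec nspace" where
  "tower_space = \<lparr>carrier = tower, zero = 0, add = (+), scale = scl, nrm = vnorm\<rparr>"

lemma tower_space_simps [simp]: "carrier tower_space = tower" "zero tower_space = 0" "add tower_space = (+)" "scale tower_space = scl" "nrm tower_space = vnorm"
  by (auto simp: tower_space_def)

lemma diff_tower_space [simp]: "diff tower_space u v = u - v" by (simp add: diff_def scl_minus1)

lemma finitary_subset_tower: "v \<in> finitary \<Longrightarrow> v \<in> tower"
  unfolding tower_def using finitary_finite_norm[of v]
  by (auto simp: finitary_def levelD(1) intro!: bexI[of _ v]) (auto dest: levelD(3))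

lemma towerD: "v \<in> tower \<Longrightarrow> v s \<in> K" "v \<in> tower \<Longrightarrow> supp v \<subseteq> (\<Union>n. indices n)" "v \<in> tower \<Longrightarrow> finite_norm v"
  "v \<in> tower \<Longrightarrow> e > 0 \<Longrightarrow> \<exists>u\<in>finitary. vnorm (v - u) < e"
  by (auto simp: tower_def)

lemma tower_add: assumes u: "u \<in> tower" and v: "v \<in> tower" shows "u + v \<in> tower"
proof -
  have "\<exists>w\<in>finitary. vnorm (u + v - w) < e" if "e > 0" for e
  proof -
    obtain u' v' where u': "u' \<in> finitary" "vnorm (u - u') < e / 2" and v': "v' \<in> finitary" "vnorm (v - v') < e / 2"
      using towerD(4)[OF u, of "e / 2"] towerD(4)[OF v, of "e / 2"] \<open>e > 0\<close> by auto
    have "vnorm (u + v - (u' + v')) \<le> vnorm (u - u') + vnorm (v - v')"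
      using vnorm_add[of "u - u'" "v - v'"] towerD(3) u v u' v'
      by (simp add: finite_norm_diff finitary_finite_norm algebra_simps)
    then show ?thesis using u' v' by (intro bexI[of _ "u' + v'"] finitary_add) auto
  qed
  moreover have "supp (u + v) \<subseteq> supp u \<union> supp v" by (auto simp: supp_def pointwise)
  ultimately show ?thesis using u v finite_norm_add[of u v] by (auto simp: tower_def pointwise K_add)
qed

lemma tower_scl: assumes c: "c \<in> K" and v: "v \<in> tower" shows "scl c v \<in> tower"
proof -
  have "\<exists>w\<in>finitary. vnorm (scl c v - w) < e" if "e > 0" for e
  proof -
    have "e / (norm c + 1) > 0" using that by (intro divide_pos_pos add_nonneg_pos) auto
    then obtain v' where v': "v' \<in> finitary" "vnorm (v - v') < e / (norm c + 1)"
      using towerD(4)[OF v] by blast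
    have "vnorm (scl c v - scl c v') = norm c * vnorm (v - v')"
      by (simp add: scl_diff[symmetric] vnorm_scl)
    also have "\<dots> \<le> norm c * (e / (norm c + 1))" using v' by (intro mult_left_mono) auto
    also have "\<dots> < e" using that add_pos_nonneg[OF zero_less_one norm_ge_zero[of c]] by (simp add: field_simps)
    finally show ?thesis using v' c by (intro bexI[of _ "scl c v'"] finitary_scl) auto
  qed
  moreover have "supp (scl c v) \<subseteq> supp v" by (auto simp: supp_def pointwise)
  ultimately show ?thesis using c v finite_norm_scl[of v c] by (auto simp: tower_def pointwise K_mult)
qed

lemma tower_diff: "u \<in> tower \<Longrightarrow> v \<in> tower \<Longrightarrow> u - v \<in> tower"
  using tower_add[of u "scl (-1) v"] tower_scl[of "-1" v] K_minus[of 1] by (simp add: scl_minus1)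

lemma tower_sum: "(\<And>i. i \<in> I \<Longrightarrow> u i \<in> tower) \<Longrightarrow> (\<Sum>i\<in>I. u i) \<in> tower"
  by (induction I rule: infinite_finite_induct) (auto simp: tower_add finitary_subset_tower)

lemma vnorm_definite:
  assumes v: "v \<in> tower" and z: "vnorm v = 0"
  shows "v = 0"
proof
  fix s
  show "v s = 0 s"
  proof (cases "\<exists>n. s \<in> indices n")
    case True
    then obtain C where "norm (v s) \<le> C * vnorm v" using coordinate_le_vnorm towerD(3)[OF v] by metis
    then show ?thesis using z by (simp add: pointwise)
  next
    case False
    then show ?thesis using towerD(2)[OF v] by (auto simp: supp_def pointwise)
  qed
qed

lemma normed_tower_space: "normed_space K tower_space"
proof
  show "K = \<real> \<or> K = UNIV" by (rule K)
  show "diff tower_space x x = zero tower_space" for x by simp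
  show "nrm tower_space (add tower_space x y) \<le> nrm tower_space x + nrm tower_space y" if "x \<in> carrier tower_space" "y \<in> carrier tower_space" for x y
    using vnorm_add[of x y] that towerD(3) by simp
qed (auto simp: tower_add tower_scl finitary_subset_tower scl_add scl_plus scl_scl vnorm_scl vnorm_definite algebra_simps)

text \<open>A subsequence has summable increments. Coordinates are bounded functionals, so the increments can be
summed coordinatewise, and countable subadditivity bounds the tails.\<close>

lemma complete_tower_space:
  assumes x: "\<And>n. x n \<in> tower"
    and cauchy: "\<And>e. e > 0 \<Longrightarrow> \<exists>M. \<forall>m\<ge>M. \<forall>n\<ge>M. vnorm (x m - x n) < e"
  shows "\<exists>l\<in>tower. (\<lambda>n. vnorm (x n - l)) \<longlonglongrightarrow> 0"
proof -
  have "\<forall>k. \<exists>M. \<forall>m\<ge>M. \<forall>n\<ge>M. vnorm (x m - x n) < (1/2)^k" using cauchy by simp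
  then obtain M where M: "\<And>k m n. m \<ge> M k \<Longrightarrow> n \<ge> M k \<Longrightarrow> vnorm (x m - x n) < (1/2)^k"
    by metis
  define r where "r k = (\<Sum>i\<le>k. M i)" for k
  have r1: "r k \<ge> M k" for k by (auto simp: r_def intro: member_le_sum)
  have r: "r k \<ge> M k" "r (Suc k) \<ge> M k" for k
    using r1[of k] by (auto simp: r_def)
  define u where "u k = x (r (Suc k)) - x (r k)" for k
  have vnorm_u: "vnorm (u k) \<le> (1/2)^k" for k unfolding u_def using M[OF r(2,1), of k] by simp
  have finite_norm_x: "finite_norm (x n)" for n using towerD(3) x by blast
  then have finite_norm_u: "finite_norm (u k)" for k unfolding u_def by (intro finite_norm_diff)
  have geo: "summable (\<lambda>i. (1/2::real)^i)" by (rule summable_geometric) simp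
  have summ: "summable (\<lambda>k. u k s)" for s
  proof (cases "\<exists>n. s \<in> indices n")
    case True
    then obtain C where C: "C \<ge> 0" "\<And>v. finite_norm v \<Longrightarrow> norm (v s) \<le> C * vnorm v"
      using coordinate_le_vnorm by metis
    have "norm (u k s) \<le> C * (1/2)^k" for k
      by (rule order_trans[OF C(2)[OF finite_norm_u] mult_left_mono[OF vnorm_u C(1)]])
    then show ?thesis by (intro summable_comparison_test'[OF summable_mult[OF geo, of C]])
  next
    case False
    then have "x n s = 0" for n using towerD(2)[OF x] by (auto simp: supp_def)
    then show ?thesis by (simp add: u_def pointwise)
  qed
  define l where "l s = x (r 0) s + (\<Sum>k. u k s)" for s
  have tail: "(\<lambda>i. u (i + k) s) sums (l - x (r k)) s" for k s
  proof -
    have "(\<Sum>i<k. u i s) = x (r k) s - x (r 0) s"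
      using sum_lessThan_telescope[of "\<lambda>i. x (r i) s" k] by (simp add: u_def pointwise)
    then have "(\<Sum>k. u k s) - (\<Sum>i<k. u i s) = (l - x (r k)) s"
      by (simp add: l_def pointwise)
    then show ?thesis
      using sums_split_initial_segment[OF summable_sums[OF summ[of s]], of k] by simp
  qed
  have geo': "(\<lambda>i. (1/2::real)^(i + k)) sums (2 * (1/2)^k)" for k
    using sums_mult2[OF geometric_sums[of "1/2::real"], of "(1/2)^k"] by (simp add: power_add)
  have sum_u: "summable (\<lambda>i. vnorm (u (i + k)))" for k
    by (rule summable_comparison_test'[OF sums_summable[OF geo'[of k]]]) (simp add: vnorm_u)
  have bl: "finite_norm (l - x (r k))" for k by (rule finite_norm_sums[OF tail finite_norm_u sum_u])
  have dist: "vnorm (l - x (r k)) \<le> 2 * (1/2)^k" for k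
  proof -
    have "vnorm (l - x (r k)) \<le> (\<Sum>i. vnorm (u (i + k)))" by (rule vnorm_sums_le[OF tail finite_norm_u sum_u])
    also have "\<dots> \<le> (\<Sum>i. (1/2)^(i + k))"
      by (intro suminf_le vnorm_u sum_u sums_summable[OF geo'])
    finally show ?thesis using geo'[of k] by (simp add: sums_iff)
  qed
  have finite_norm_l: "finite_norm l" using finite_norm_add[OF bl[of 0] finite_norm_x[of "r 0"]] by simp
  have capped: "\<exists>k. 2 * (1/2)^k < e" if "e > 0" for e :: real
    using real_arch_pow_inv[of "e / 2" "1/2"] that by (auto simp: field_simps)
  have "l \<in> tower"
    unfolding tower_def
  proof (intro CollectI conjI allI impI finite_norm_l)
    fix s
    have "(\<Sum>k. u k s) \<in> K"
    proof (rule K_sums[OF summable_sums[OF summ]])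
      fix k
      have "u k \<in> tower" unfolding u_def by (intro tower_diff x)
      then show "u k s \<in> K" by (rule towerD(1))
    qed
    then show "l s \<in> K" unfolding l_def by (rule K_add[OF towerD(1)[OF x[of "r 0"]]])
  next
    show "supp l \<subseteq> (\<Union>n. indices n)"
    proof
      fix s assume s: "s \<in> supp l"
      show "s \<in> (\<Union>n. indices n)"
      proof (rule ccontr)
        assume "s \<notin> (\<Union>n. indices n)"
        then have "x n s = 0" for n using towerD(2)[OF x] by (auto simp: supp_def)
        then show False using s by (simp add: supp_def l_def u_def pointwise)
      qed
    qed
  next
    fix e :: real assume "e > 0"
    then obtain k where k: "2 * (1/2)^k < e / 2" using capped[of "e / 2"] by auto
    obtain w where w: "w \<in> finitary" "vnorm (x (r k) - w) < e / 2"
      using towerD(4)[OF x, of "e / 2"] \<open>e > 0\<close> by auto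
    have "vnorm (l - w) \<le> vnorm (l - x (r k)) + vnorm (x (r k) - w)"
      by (intro vnorm_triangle finite_norm_l finite_norm_x finitary_finite_norm w)
    then show "\<exists>w\<in>finitary. vnorm (l - w) < e" using w k dist[of k] by (intro bexI[of _ w]) auto
  qed
  moreover have "(\<lambda>n. vnorm (x n - l)) \<longlonglongrightarrow> 0"
  proof (rule LIMSEQ_I)
    fix e :: real assume "e > 0"
    then obtain k where k: "2 * (1/2)^k < e / 2" using capped[of "e / 2"] by auto
    then have "(1/2)^k < e / 2" using zero_le_power[of "1/2::real" k] by linarith
    have "norm (vnorm (x n - l) - 0) < e" if n: "n \<ge> M k" for n
    proof -
      have "vnorm (x n - l) \<le> vnorm (x n - x (r k)) + vnorm (x (r k) - l)"
        by (intro vnorm_triangle finite_norm_l finite_norm_x)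
      also have "\<dots> < e"
        using M[OF n r(1)] dist[of k] k \<open>(1/2)^k < e / 2\<close> vnorm_diff_commute[of "x (r k)" l] by simp
      finally show ?thesis by simp
    qed
    then show "\<exists>no. \<forall>n\<ge>no. norm (vnorm (x n - l) - 0) < e" by blast
  qed
  ultimately show ?thesis by blast
qed

lemma unit_vec_finitary: "unit_vec m \<in> finitary" by (rule finitaryI[OF unit_vec_level])

lemma banach_tower_space: "banach_space K tower_space"
proof -
  have "unit_vec 0 \<noteq> 0" using vnorm_unit_vec[of 0] by auto
  then show ?thesis
    unfolding banach_space_def banach_space_axioms_def
    using normed_tower_space complete_tower_space finitary_subset_tower[OF unit_vec_finitary[of 0]] by auto
qed

section \<open>The Daugavet property\<close>

text \<open>The vector \<open>y \<otimes> g\<^sub>k\<close>: its total and its \<open>k\<close>-th layer are \<open>y\<close>.\<close>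

definition bump :: "nat \<Rightarrow> nat \<Rightarrow> vec \<Rightarrow> vec" where
  "bump n k y = (\<lambda>s. if s \<in> indices (Suc n) \<and> (s n = 0 \<or> s n = k) then y (s(n := 0)) else 0)"

context
  fixes n k :: nat and y :: vec
  assumes y: "y \<in> level n" and k: "2 \<le> k"
begin

lemma bump_level: "bump n k y \<in> level (Suc n)"
proof -
  have "supp (bump n k y) \<subseteq> supp y \<union> (\<lambda>s. s(n := k)) ` supp y"
  proof
    fix s assume "s \<in> supp (bump n k y)"
    then have s: "s n = 0 \<or> s n = k" "s(n := 0) \<in> supp y"
      by (auto simp: supp_def bump_def split: if_splits)
    then show "s \<in> supp y \<union> (\<lambda>s. s(n := k)) ` supp y"
    proof (cases "s n = 0")
      case True
      then have "s(n := 0) = s" by auto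
      then show ?thesis using s by simp
    next
      case False
      then have "s = (s(n := 0))(n := k)" using s(1) by auto
      then show ?thesis using s(2) by blast
    qed
  qed
  then have "finite (supp (bump n k y))" using levelD(2)[OF y] by (auto intro: finite_subset)
  then show ?thesis using levelD(1)[OF y] by (auto simp: level_def supp_def bump_def)
qed

lemma layer_bump: "layer n i (bump n k y) = (if i = 0 \<or> i = k then y else 0)"
proof
  fix s
  show "layer n i (bump n k y) s = (if i = 0 \<or> i = k then y else 0) s"
  proof (cases "s \<in> indices n")
    case True
    then have "s(n := 0) = s" using indices_zero[OF True, of n] by auto
    moreover have "s(n := i) \<in> indices (Suc n)" if "i = 0 \<or> i = k"
      using that k by (intro indices_update True) auto
    ultimately show ?thesis using True by (auto simp: layer_def bump_def pointwise)
  next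
    case False
    then show ?thesis using levelD(3)[OF y] by (auto simp: layer_def supp_def pointwise)
  qed
qed

lemma bump_birth: "bump n k y (birth n) = 0" using k by (simp add: bump_def birth_def)

lemma weight_const: "(\<lambda>j. weight n j * c) sums c" using sums_mult2[OF weight_sums, of n c] by simp

lemma vnorm_bump_le: "vnorm (bump n k y) \<le> vnorm y"
proof -
  have "vnorm (bump n k y) \<le> norm (bump n k y (birth n)) + (\<Sum>j. weight n j * vnorm y)"
  proof (rule vnorm_upper[OF bump_level])
    fix j A assume A: "A \<in> capped j"
    have A0: "i \<noteq> 0" if "i \<in> A" for i using A that by (auto simp: capped_def)
    show "split_val n (bump n k y) A \<le> vnorm y"
    proof (cases "k \<in> A")
      case True
      have "(\<Sum>i\<in>A. layer n i (bump n k y)) = (\<Sum>i\<in>{k}. y)"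
        by (rule sum.mono_neutral_cong_right) (use A0 True capped_finite[OF A] in \<open>auto simp: layer_bump\<close>)
      moreover have "(\<Sum>i\<in>A. vnorm (layer n i (bump n k y))) = (\<Sum>i\<in>{k}. vnorm y)"
        by (rule sum.mono_neutral_cong_right) (use A0 True capped_finite[OF A] in \<open>auto simp: layer_bump\<close>)
      ultimately show ?thesis by (simp add: layer_bump)
    next
      case False
      then have "layer n i (bump n k y) = 0" if "i \<in> A" for i using that A0 by (auto simp: layer_bump)
      then show ?thesis by (simp add: layer_bump)
    qed
  qed (use weight_const in \<open>auto simp: sums_iff\<close>)
  then show ?thesis using weight_const[of "vnorm y"] by (simp add: bump_birth sums_iff)
qed

lemma vnorm_diff_bump_ge:
  assumes x: "x \<in> level n"
  shows "vnorm x + vnorm y \<le> vnorm (x - bump n k y)"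
proof -
  have L: "x - bump n k y \<in> level (Suc n)"
    using x by (intro level_diff bump_level level_mono[of n "Suc n"]) auto
  have "{k} \<in> capped j" for j using k by (auto simp: capped_def)
  from vnorm_lower(2)[OF L this]
  have "(\<Sum>j. weight n j * split_val n (x - bump n k y) {k}) \<le> vnorm (x - bump n k y)"
    using norm_ge_zero[of "(x - bump n k y) (birth n)"] by linarith
  moreover have "split_val n (x - bump n k y) {k} = vnorm x + vnorm y"
    using layer_eq_0[OF levelD(3)[OF x], of k] layer_0_id[OF levelD(3)[OF x]] k
    by (simp add: layer_diff layer_bump)
  ultimately show ?thesis using weight_const[of "vnorm x + vnorm y"] by (simp add: sums_iff)
qed

end

text \<open>The difference has total \<open>0\<close> and \<open>M\<close> layers \<open>y / M\<close>. A term of the supremum at scale \<open>j\<close> is at most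
\<open>2 \<parallel>y\<parallel>\<close> times the proportion of layers that is seen, which is small for \<open>j < J\<close> and large \<open>M\<close>; the scales
\<open>j \<ge> J\<close> have small total weight.\<close>

lemma bump_average:
  assumes y: "y \<in> level n" and e: "e > 0"
  shows "\<exists>M>0. vnorm ((\<Sum>k\<in>{2..<M + 2}. scl (of_real (1 / real M)) (bump n k y)) - y) < e"
proof -
  define d where "d = e / (4 * (vnorm y + 1))"
  have y1: "vnorm y + 1 > 0" by (simp add: add_nonneg_pos)
  have d: "d > 0" using e y1 by (simp add: d_def)
  obtain J where J: "\<And>n'. n' \<ge> J \<Longrightarrow> norm (\<Sum>i. weight n (i + n')) < d"
    using suminf_exist_split[OF d sums_summable[OF weight_sums[of n]]] by blast
  obtain M :: nat where M: "real M > 4 ^ J / d" using reals_Archimedean2 by blast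
  have M0: "M > 0" using M d by (auto intro: gr0I simp: divide_less_0_iff)
  have Md: "4 ^ J / real M < d" using M d M0 by (simp add: field_simps)
  define R where "R = {2..<M + 2}"
  have R: "finite R" "card R = M" "\<And>k. k \<in> R \<Longrightarrow> 2 \<le> k" by (auto simp: R_def)
  define z where "z = (\<Sum>k\<in>R. scl (of_real (1 / real M)) (bump n k y)) - y"
  have z: "z \<in> level (Suc n)"
    unfolding z_def
    by (intro level_diff level_sum level_scl K_of_real bump_level y level_mono[of n "Suc n" y]) (use R in auto)
  have sz: "layer n i z = (if i \<in> R then scl (of_real (1 / real M)) y else 0)" if "i \<noteq> 1" for i
  proof (cases "i = 0")
    case True
    have "(\<Sum>k\<in>R. scl (of_real (1 / real M)) (layer n 0 (bump n k y))) = (\<Sum>k\<in>R. scl (of_real (1 / real M)) y)"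
      by (intro sum.cong) (auto simp: layer_bump[OF y] R)
    also have "\<dots> = y" using M0 by (intro ext) (simp add: pointwise R)
    finally show ?thesis using True layer_0_id[OF levelD(3)[OF y]]
      using R(3)[of 0] by (auto simp add: z_def layer_diff layer_sum layer_scl)
  next
    case False
    have "(\<Sum>k\<in>R. scl (of_real (1 / real M)) (layer n i (bump n k y)))
       = (\<Sum>k\<in>R. if k = i then scl (of_real (1 / real M)) y else 0)"
      using False by (intro sum.cong) (auto simp: layer_bump[OF y] R)
    then show ?thesis using layer_eq_0[OF levelD(3)[OF y] False]
      by (simp add: z_def layer_diff layer_sum layer_scl R(1))
  qed
  have zn: "z (birth n) = 0"
    using levelD(3)[OF y] birth_notin_indices[of n n]
    by (auto simp: z_def pointwise bump_birth[OF y] supp_def R intro!: sum.neutral)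
  define P where "P j = 2 * vnorm y * (if j < J then 4 ^ J / real M else 1)" for j
  have "vnorm z \<le> norm (z (birth n)) + (\<Sum>j. weight n j * P j)"
  proof (rule vnorm_upper[OF z])
    fix j A assume A: "A \<in> capped j"
    have A1: "i \<noteq> 1" "i \<noteq> 0" if "i \<in> A" for i using A that by (auto simp: capped_def)
    have s: "(\<Sum>i\<in>A. vnorm (layer n i z)) = real (card (A \<inter> R)) / real M * vnorm y"
    proof -
      have "(\<Sum>i\<in>A. vnorm (layer n i z)) = (\<Sum>i\<in>A \<inter> R. vnorm y / real M)"
        by (rule sum.mono_neutral_cong_right)
          (use A1 capped_finite[OF A] in \<open>auto simp: sz vnorm_scl norm_divide\<close>)
      then show ?thesis by simp
    qed
    have "finite_norm (layer n i z)" for i by (rule level_finite_norm[OF level_layer[OF z]])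
    then have "vnorm (layer n 0 z - (\<Sum>i\<in>A. layer n i z)) \<le> (\<Sum>i\<in>A. vnorm (layer n i z))"
      using vnorm_sum[of A "\<lambda>i. layer n i z"] sz[of 0] R(3)[of 0] by auto
    then have "split_val n z A \<le> 2 * (\<Sum>i\<in>A. vnorm (layer n i z))" by simp
    also have "\<dots> = 2 * vnorm y * (real (card (A \<inter> R)) / real M)" unfolding s by simp
    also have "\<dots> \<le> P j"
      unfolding P_def
    proof (rule mult_left_mono)
      have "card (A \<inter> R) \<le> card A" using capped_finite[OF A] by (intro card_mono) auto
      moreover have "card A \<le> 4 ^ j" using A by (simp add: capped_def)
      moreover have "(4::nat) ^ j \<le> 4 ^ J" if "j < J" using that by (intro power_increasing) auto
      moreover have "card (A \<inter> R) \<le> M" using card_mono[OF R(1), of "A \<inter> R"] R(2) by auto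
      ultimately have "j < J \<Longrightarrow> card (A \<inter> R) \<le> 4 ^ J" "card (A \<inter> R) \<le> M"
        by (meson order_trans, simp)
      then have "j < J \<Longrightarrow> real (card (A \<inter> R)) \<le> 4 ^ J" "real (card (A \<inter> R)) \<le> real M"
        by (metis of_nat_le_iff of_nat_numeral of_nat_power, simp)
      then show "real (card (A \<inter> R)) / real M \<le> (if j < J then 4 ^ J / real M else 1)"
        using M0 by (simp add: divide_right_mono)
    qed simp
    finally show "split_val n z A \<le> P j" .
  next
    show "summable (\<lambda>j. weight n j * P j)"
      unfolding P_def mult.left_commute[of "weight n _"]
      using sums_summable[OF weight_sums[of n]]
      by (intro summable_mult) (subst summable_iff_shift[symmetric, of _ J], simp add: summable_iff_shift)
  qed
  also have "(\<Sum>j. weight n j * P j) \<le> 2 * vnorm y * (2 * d)"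
  proof -
    have w: "summable (weight n)" by (rule sums_summable[OF weight_sums])
    have s: "summable (\<lambda>j. weight n j * P j)"
      unfolding P_def mult.left_commute[of "weight n _"]
      using sums_summable[OF weight_sums[of n]]
      by (intro summable_mult) (subst summable_iff_shift[symmetric, of _ J], simp add: summable_iff_shift)
    have "(\<Sum>j<J. weight n j * P j) = (\<Sum>j<J. 2 * vnorm y * (4 ^ J / real M) * weight n j)"
      by (intro sum.cong) (simp_all add: P_def)
    also have "\<dots> = 2 * vnorm y * (4 ^ J / real M * (\<Sum>j<J. weight n j))"
      by (simp only: sum_distrib_left mult.assoc)
    also have "\<dots> \<le> 2 * vnorm y * (d * 1)"
    proof (intro mult_left_mono mult_mono)
      show "(\<Sum>j<J. weight n j) \<le> 1"
        using sum_le_suminf[OF w, of "{..<J}"] weight_sums[of n] by (simp add: sums_iff)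
    qed (use Md d in \<open>auto intro: sum_nonneg\<close>)
    finally have 1: "(\<Sum>j<J. weight n j * P j) \<le> 2 * vnorm y * d" by simp
    have "(\<Sum>i. weight n (i + J) * P (i + J)) = 2 * vnorm y * (\<Sum>i. weight n (i + J))"
      using w by (simp add: P_def mult.commute[of _ "2 * vnorm y"] suminf_mult summable_iff_shift)
    also have "\<dots> \<le> 2 * vnorm y * d"
      using J[of J] by (intro mult_left_mono) auto
    finally show ?thesis using 1 suminf_split_initial_segment[OF s, of J] by (simp add: algebra_simps)
  qed
  also have "\<dots> = 4 * vnorm y * d" by simp
  also have "\<dots> < 4 * (vnorm y + 1) * d" using d by (intro mult_strict_right_mono) auto
  also have "\<dots> = e" using y1 by (simp add: d_def)
  finally have "vnorm z < e" using zn by simp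
  then show ?thesis using M0 unfolding z_def R_def by blast
qed

context
  fixes f :: "vec \<Rightarrow> complex"
  assumes f: "f \<in> dual K tower_space"
begin

lemma functional_add: "u \<in> tower \<Longrightarrow> v \<in> tower \<Longrightarrow> f (u + v) = f u + f v"
  and functional_scl: "c \<in> K \<Longrightarrow> v \<in> tower \<Longrightarrow> f (scl c v) = c * f v"
  using f by (auto simp: dual_def)

lemma functional_minus: "v \<in> tower \<Longrightarrow> f (- v) = - f v"
  using functional_scl[of "-1" v] K_minus[of 1] by (simp add: scl_minus1)

lemma functional_diff: "u \<in> tower \<Longrightarrow> v \<in> tower \<Longrightarrow> f (u - v) = f u - f v"
  using functional_add[of u "- v"] functional_minus[of v] tower_diff[of 0 v] finitary_subset_tower[of 0] by simp

lemma functional_sum: "(\<And>i. i \<in> I \<Longrightarrow> u i \<in> tower) \<Longrightarrow> f (\<Sum>i\<in>I. u i) = (\<Sum>i\<in>I. f (u i))"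
proof (induction I rule: infinite_finite_induct)
  case (insert i I)
  then show ?case by (simp add: functional_add tower_sum)
qed (use functional_scl[of 0 0] finitary_subset_tower[of 0] in auto)

lemma functional_bounded: obtains C where "C \<ge> 0" "\<And>v. v \<in> tower \<Longrightarrow> norm (f v) \<le> C * vnorm v"
proof -
  have "\<exists>C. \<forall>v\<in>tower. norm (f v) \<le> C * vnorm v" using f by (simp add: dual_def)
  then obtain C where C: "\<And>v. v \<in> tower \<Longrightarrow> norm (f v) \<le> C * vnorm v" by blast
  have "norm (f v) \<le> \<bar>C\<bar> * vnorm v" if "v \<in> tower" for v
    by (rule order_trans[OF C[OF that]]) (simp add: mult_right_mono)
  then show ?thesis using that[of "\<bar>C\<bar>"] by simp
qed

text \<open>If the threshold of the slice is negative, the slice contains \<open>u\<close> or \<open>- u\<close> for any unit vector \<open>u\<close>. Otherwise a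
point of the slice is approximated by a finitary vector, and dividing by the norm increases the
functional, up to the error of approximation.\<close>

lemma unit_vector_in_slice:
  assumes b: "\<beta> > 0"
  shows "\<exists>u\<in>finitary. vnorm u = 1 \<and> Re (f u) > (SUP y\<in>unit_ball tower_space. Re (f y)) - \<beta>"
proof -
  obtain C where C: "C \<ge> 0" "\<And>v. v \<in> tower \<Longrightarrow> norm (f v) \<le> C * vnorm v" using functional_bounded by blast
  have Re_f: "\<bar>Re (f v)\<bar> \<le> C * vnorm v" if "v \<in> tower" for v
    using C(2)[OF that] abs_Re_le_cmod[of "f v"] by linarith
  define g where "g = (SUP y\<in>unit_ball tower_space. Re (f y)) - \<beta>"
  show ?thesis
  proof (cases "g < 0")
    case True
    let ?u = "unit_vec 0"
    have u: "?u \<in> finitary" "?u \<in> tower" "- ?u \<in> finitary"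
      using unit_vec_finitary[of 0] finitary_subset_tower finitary_diff[of 0 ?u] by auto
    show ?thesis
    proof (cases "Re (f ?u) \<ge> 0")
      case True
      then show ?thesis using u \<open>g < 0\<close> by (intro bexI[of _ ?u]) (auto simp: vnorm_unit_vec g_def)
    next
      case False
      then show ?thesis using u \<open>g < 0\<close> functional_minus[OF u(2)]
        by (intro bexI[of _ "- ?u"]) (auto simp: vnorm_unit_vec g_def)
    qed
  next
    case False
    then have g0: "g \<ge> 0" by simp
    have "unit_ball tower_space \<noteq> {}" using finitary_subset_tower[OF finitary_zero] by (auto simp: unit_ball_def intro!: exI[of _ 0])
    moreover have "bdd_above ((\<lambda>y. Re (f y)) ` unit_ball tower_space)"
    proof (rule bdd_aboveI2)
      fix v assume "v \<in> unit_ball tower_space"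
      then have "v \<in> tower" "vnorm v \<le> 1" by (auto simp: unit_ball_def)
      then show "Re (f v) \<le> C" using Re_f[of v] mult_left_mono[of "vnorm v" 1 C] C(1) by auto
    qed
    ultimately obtain v where "v \<in> unit_ball tower_space" and v2: "Re (f v) > g"
      using less_cSUP_iff[of "unit_ball tower_space" "\<lambda>y. Re (f y)" g] b by (auto simp: g_def)
    then have v: "v \<in> tower" "vnorm v \<le> 1" by (auto simp: unit_ball_def)
    \<comment> \<open>so small that approximating within \<open>t\<close> and dividing by a norm of at most \<open>1 + t\<close> keep the value above \<open>g\<close>\<close>
    define t where "t = (Re (f v) - g) / (C + g + 1)"
    have t: "t > 0" "t * (C + g) < Re (f v) - g"
      using v2 g0 C(1) by (auto simp: t_def field_simps)
    obtain w where w: "w \<in> finitary" "vnorm (v - w) < t" using towerD(4)[OF v(1) t(1)] by blast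
    have wC: "w \<in> tower" by (rule finitary_subset_tower[OF w(1)])
    have nw: "vnorm w \<le> 1 + t"
      using vnorm_add[of v "w - v"] towerD(3)[OF v(1)] towerD(3)[OF wC] v(2) w(2) vnorm_diff_commute[of v w]
      by (simp add: finite_norm_diff)
    have "\<bar>Re (f (v - w))\<bar> \<le> C * vnorm (v - w)" by (intro Re_f tower_diff v wC)
    also have "\<dots> \<le> C * t" using w(2) C(1) by (intro mult_left_mono) auto
    finally have "Re (f w) \<ge> Re (f v) - C * t" by (simp add: functional_diff[OF v(1) wC])
    moreover have "Re (f v) - C * t > g * (1 + t)" using t(2) by (simp add: algebra_simps)
    moreover have "g * (1 + t) \<ge> g * vnorm w" using nw g0 by (rule mult_left_mono)
    ultimately have fw: "Re (f w) > g * vnorm w" by linarith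
    then have "Re (f w) > 0" using mult_nonneg_nonneg[OF g0 vnorm_nonneg[of w]] by linarith
    then have pos: "vnorm w > 0" using Re_f[OF wC] vnorm_nonneg[of w] by (cases "vnorm w = 0") (auto simp: less_le)
    let ?u = "scl (of_real (1 / vnorm w)) w"
    have "Re (f ?u) = Re (f w) / vnorm w"
      by (subst functional_scl[OF K_of_real wC]) (simp add: Re_divide_of_real flip: of_real_inverse)
    also have "\<dots> > g" using fw pos by (simp add: field_simps)
    finally have "Re (f ?u) > g" .
    moreover have "vnorm ?u = 1" unfolding vnorm_scl using pos by (simp add: norm_divide)
    ultimately show ?thesis using finitary_scl[OF K_of_real w(1)] unfolding g_def by blast
  qed
qed

text \<open>The functional is almost the same at \<open>u\<close> and at an average of vectors \<open>u \<otimes> g\<^sub>k\<close>, so it is large at one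
of them.\<close>

lemma far_point_in_slice:
  assumes u: "u \<in> level n" "vnorm u = 1" and g: "Re (f u) > g" and x: "x \<in> level n"
  shows "\<exists>z\<in>finitary. vnorm z \<le> 1 \<and> Re (f z) > g \<and> vnorm (x - z) \<ge> vnorm x + 1"
proof -
  obtain C where C: "C \<ge> 0" "\<And>v. v \<in> tower \<Longrightarrow> norm (f v) \<le> C * vnorm v" using functional_bounded by blast
  define e where "e = (Re (f u) - g) / (C + 1)"
  have e: "e > 0" "C * e < Re (f u) - g"
    using g C(1) by (auto simp: e_def field_simps)
  obtain M where M: "M > 0"
    "vnorm ((\<Sum>k\<in>{2..<M + 2}. scl (of_real (1 / real M)) (bump n k u)) - u) < e"
    using bump_average[OF u(1) e(1)] by blast
  define R where "R = {2..<M + 2}"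
  have R: "finite R" "card R = M" "\<And>k. k \<in> R \<Longrightarrow> 2 \<le> k" by (auto simp: R_def)
  have ch: "bump n k u \<in> finitary" if "k \<in> R" for k
    by (rule finitaryI[OF bump_level[OF u(1) R(3)[OF that]]])
  have uC: "u \<in> tower" by (rule finitary_subset_tower[OF finitaryI[OF u(1)]])
  let ?a = "\<Sum>k\<in>R. scl (of_real (1 / real M)) (bump n k u)"
  have aC: "?a \<in> tower" by (intro tower_sum tower_scl K_of_real finitary_subset_tower ch)
  have "norm (f (?a - u)) \<le> C * vnorm (?a - u)" by (intro C tower_diff aC uC)
  also have "\<dots> \<le> C * e" using M(2) C(1) by (intro mult_left_mono) (auto simp: R_def)
  finally have "\<bar>Re (f (?a - u))\<bar> \<le> C * e"
    using abs_Re_le_cmod[of "f (?a - u)"] by linarith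
  then have "Re (f ?a) > g" unfolding functional_diff[OF aC uC] using e(2) by (simp only: minus_complex.sel)
  moreover have "f ?a = (\<Sum>k\<in>R. of_real (1 / real M) * f (bump n k u))"
  proof -
    have c: "scl (of_real (1 / real M)) (bump n k u) \<in> tower" if "k \<in> R" for k
      by (rule tower_scl[OF K_of_real finitary_subset_tower[OF ch[OF that]]])
    show ?thesis
      using functional_sum[of R "\<lambda>k. scl (of_real (1 / real M)) (bump n k u)", OF c]
      by (auto simp: functional_scl[OF K_of_real finitary_subset_tower[OF ch]] simp del: of_real_divide intro!: sum.cong)
  qed
  ultimately have avg: "(\<Sum>k\<in>R. Re (f (bump n k u)) / real M) > g"
    by simp
  have "\<exists>k\<in>R. Re (f (bump n k u)) > g"
  proof (rule ccontr)
    assume "\<not> ?thesis"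
    then have "(\<Sum>k\<in>R. Re (f (bump n k u)) / real M) \<le> (\<Sum>k\<in>R. g / real M)"
      by (intro sum_mono divide_right_mono) auto
    then show False using avg M(1) by (simp add: R)
  qed
  then obtain k where k: "k \<in> R" "Re (f (bump n k u)) > g" by blast
  then have "2 \<le> k" by (intro R)
  then show ?thesis
    using vnorm_bump_le[OF u(1)] vnorm_diff_bump_ge[OF u(1) _ x] u(2) k ch[OF k(1)]
    by (intro bexI[of _ "bump n k u"]) auto
qed

end

lemma daugavet_tower_space: "daugavet_property K tower_space"
  unfolding daugavet_property_def
proof (intro ballI allI impI)
  fix S x and \<epsilon> :: real
  assume "S \<in> slices K tower_space" and x: "x \<in> unit_sphere tower_space" and e: "\<epsilon> > 0"
  then obtain f \<beta> where f: "f \<in> dual K tower_space" and b: "\<beta> > 0" and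
    S: "S = {x \<in> unit_ball tower_space. Re (f x) > (SUP y\<in>unit_ball tower_space. Re (f y)) - \<beta>}"
    by (auto simp: slices_def)
  let ?g = "(SUP y\<in>unit_ball tower_space. Re (f y)) - \<beta>"
  have x: "x \<in> tower" "vnorm x = 1" using x by (auto simp: unit_sphere_def)
  obtain u where u: "u \<in> finitary" "vnorm u = 1" "Re (f u) > ?g" using unit_vector_in_slice[OF f b] by blast
  obtain w where w: "w \<in> finitary" "vnorm (x - w) < \<epsilon> / 2" using towerD(4)[OF x(1), of "\<epsilon> / 2"] e by auto
  obtain n where n: "u \<in> level n" "w \<in> level n" using finitary_common[OF u(1) w(1) w(1)] by blast
  obtain z where z: "z \<in> finitary" "vnorm z \<le> 1" "Re (f z) > ?g" "vnorm (w - z) \<ge> vnorm w + 1"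
    using far_point_in_slice[OF f n(1) u(2,3) n(2)] by blast
  have bd: "finite_norm x" "finite_norm w" "finite_norm z" using towerD(3)[OF x(1)] finitary_finite_norm w z by auto
  have "vnorm w \<ge> 1 - \<epsilon> / 2"
    using vnorm_add[of "x - w" w] bd x(2) w(2) by (simp add: finite_norm_diff)
  moreover have "vnorm (w - z) \<le> vnorm (x - w) + vnorm (x - z)"
    using vnorm_triangle[of w x z] bd vnorm_diff_commute[of w x] by simp
  ultimately have "vnorm (x - z) > 2 - \<epsilon>" using z(4) w(2) by linarith
  then show "\<exists>y\<in>S. nrm tower_space (diff tower_space x y) > 2 - \<epsilon>"
    using z finitary_subset_tower[OF z(1)] by (intro bexI[of _ z]) (auto simp: S unit_ball_def)
qed

end

section \<open>Transport to the prescribed type of points\<close>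

definition transport :: "('a \<Rightarrow> 'b) \<Rightarrow> 'a nspace \<Rightarrow> 'b nspace" where
  "transport h X = \<lparr>
     carrier = h ` carrier X,
     zero = h (zero X),
     add = (\<lambda>p q. h (add X (inv h p) (inv h q))),
     scale = (\<lambda>a p. h (scale X a (inv h p))),
     nrm = (\<lambda>p. nrm X (inv h p))\<rparr>"

context
  fixes h :: "'a \<Rightarrow> 'b" and X :: "'a nspace"
  assumes h: "inj h"
begin

lemma transport_simps:
  "carrier (transport h X) = h ` carrier X"
  "zero (transport h X) = h (zero X)"
  "add (transport h X) (h u) (h v) = h (add X u v)"
  "scale (transport h X) a (h u) = h (scale X a u)"
  "nrm (transport h X) (h u) = nrm X u"
  using h by (auto simp: transport_def)

lemma diff_transport: "diff (transport h X) (h u) (h v) = h (diff X u v)"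
  by (simp add: diff_def transport_simps)

lemma normed_space_transport:
  assumes "normed_space K X"
  shows "normed_space K (transport h X)"
proof -
  interpret normed_space K X by fact
  show ?thesis
  proof
    show "K = \<real> \<or> K = UNIV" by (rule scalars)
  qed (auto simp: transport_simps diff_transport inj_eq[OF h] zero_closed add_closed scale_closed
      add_assoc add_zero diff_self scale_add add_scale scale_scale scale_one nrm_nonneg nrm_eq_0
      nrm_add nrm_scale intro: add_commute)
qed

lemma banach_space_transport:
  assumes "banach_space K X"
  shows "banach_space K (transport h X)"
proof -
  interpret banach_space K X by fact
  interpret T: normed_space K "transport h X" by (rule normed_space_transport) (rule normed_space_axioms)
  show ?thesis
  proof
    show "\<exists>p\<in>carrier (transport h X). p \<noteq> zero (transport h X)"
      using nonzero by (auto simp: transport_simps inj_eq[OF h])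
  next
    fix p :: "nat \<Rightarrow> 'b"
    assume p: "\<And>n. p n \<in> carrier (transport h X)"
      and c: "\<And>e. e > 0 \<Longrightarrow> \<exists>N. \<forall>m\<ge>N. \<forall>n\<ge>N. nrm (transport h X) (diff (transport h X) (p m) (p n)) < e"
    define u where "u n = inv h (p n)" for n
    have pu: "p n = h (u n)" and u: "u n \<in> carrier X" for n
      using p[of n] h by (auto simp: u_def transport_simps)
    have "\<exists>l\<in>carrier X. (\<lambda>n. nrm X (diff X (u n) l)) \<longlonglongrightarrow> 0"
      using c by (intro complete u) (simp add: pu diff_transport transport_simps)
    then show "\<exists>l\<in>carrier (transport h X). (\<lambda>n. nrm (transport h X) (diff (transport h X) (p n) l)) \<longlonglongrightarrow> 0"
      by (auto simp: pu diff_transport transport_simps)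
  qed
qed

lemma daugavet_property_transport:
  assumes "daugavet_property K X"
  shows "daugavet_property K (transport h X)"
  unfolding daugavet_property_def
proof (intro ballI allI impI)
  fix S p and \<epsilon> :: real
  assume "S \<in> slices K (transport h X)" and p: "p \<in> unit_sphere (transport h X)" and e: "\<epsilon> > 0"
  have ball: "unit_ball (transport h X) = h ` unit_ball X"
    by (auto simp: unit_ball_def transport_simps)
  obtain f \<beta> where f: "f \<in> dual K (transport h X)" and b: "\<beta> > 0" and
    S: "S = {p \<in> h ` unit_ball X. Re (f p) > (SUP q\<in>h ` unit_ball X. Re (f q)) - \<beta>}"
    using \<open>S \<in> slices K (transport h X)\<close> by (auto simp: slices_def ball)
  obtain u where u: "p = h u" "u \<in> unit_sphere X"
    using p by (auto simp: unit_sphere_def transport_simps)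
  have "(\<lambda>v. f (h v)) \<in> dual K X"
    using f by (auto simp: dual_def transport_simps)
  then have "{v \<in> unit_ball X. Re (f (h v)) > (SUP w\<in>unit_ball X. Re (f (h w))) - \<beta>} \<in> slices K X"
    unfolding slices_def
    by (intro CollectI exI[of _ "\<lambda>v. f (h v)"] exI[of _ \<beta>] conjI refl b)
  from assms[unfolded daugavet_property_def, rule_format, OF this u(2) e]
  obtain v where "v \<in> unit_ball X" "Re (f (h v)) > (SUP w\<in>unit_ball X. Re (f (h w))) - \<beta>"
    "nrm X (diff X u v) > 2 - \<epsilon>"
    by blast
  then show "\<exists>q\<in>S. nrm (transport h X) (diff (transport h X) p q) > 2 - \<epsilon>"
    by (intro bexI[of _ "h v"]) (auto simp: S u(1) diff_transport transport_simps image_image)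
qed

end

text \<open>Integer points of the space of real sequences suffice to recover \<open>v\<close>; rounding makes the encoding total.\<close>

definition encode :: "vec \<Rightarrow> point" where
  "encode v = {\<lambda>r. v (\<lambda>i. nat \<lfloor>r i\<rfloor>)}"

lemma inj_encode: "inj encode"
proof (rule injI, rule ext)
  fix u v :: vec and s :: index
  assume "encode u = encode v"
  then have "(\<lambda>r::nat \<Rightarrow> real. u (\<lambda>i. nat \<lfloor>r i\<rfloor>)) = (\<lambda>r. v (\<lambda>i. nat \<lfloor>r i\<rfloor>))"
    by (simp add: encode_def)
  from fun_cong[OF this, of "\<lambda>i. real (s i)"] show "u s = v s" by simp
qed

lemma (in scalar_field) asymptotic_coefficients_tower_space:
  "asymptotic_coefficients K (transport encode tower_space) (encode ` finitary) (\<lambda>m p. regular_coeff m (inv encode p))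
     (\<lambda>m. encode (unit_vec m)) (\<lambda>m. 2 * (1/2)^m)"
proof -
  note t = transport_simps[OF inj_encode] diff_transport[OF inj_encode] inv_f_f[OF inj_encode]
  interpret T: normed_space K "transport encode tower_space"
    by (rule normed_space_transport[OF inj_encode normed_tower_space])
  show ?thesis
  proof
    fix p and \<epsilon> :: real assume "p \<in> carrier (transport encode tower_space)" "\<epsilon> > 0"
    then show "\<exists>a\<in>encode ` finitary. nrm (transport encode tower_space) (diff (transport encode tower_space) p a) < \<epsilon>"
      by (auto simp: t dest: towerD(4))
  next
    fix a b c m assume "a \<in> encode ` finitary" "b \<in> encode ` finitary" "c \<in> encode ` finitary"
    then show "norm (regular_coeff m (inv encode c) - regular_coeff m (inv encode a) - regular_coeff m (inv encode b))
      \<le> 3 * nrm (transport encode tower_space) (diff (transport encode tower_space) c (add (transport encode tower_space) a b))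
        + 2 * (1/2)^m * (nrm (transport encode tower_space) a + nrm (transport encode tower_space) b)"
      using regular_coeff_quasi_additive by (auto simp: t diff_diff_add)
  next
    show "(\<lambda>m. 2 * (1/2::real)^m) \<longlonglongrightarrow> 0"
      by (intro tendsto_mult_right_zero LIMSEQ_power_zero) simp
  qed (auto simp: t finitary_subset_tower finitary_scl regular_coeff_in_K regular_coeff_scl regular_coeff_split unit_vec_finitary vnorm_unit_vec regular_coeff_unit_vec)
qed

theorem theorem4p6:
  fixes K :: "complex set" and \<eta> :: real
  assumes "K = \<real> \<or> K = UNIV" and "\<eta> > 0"
  shows "\<exists>X :: point nspace. banach_space K X \<and> daugavet_property K X \<and>
    (\<forall>\<U>. free_ultrafilter \<U> \<longrightarrow>
      (\<exists>S \<in> slices K (ultrapower \<U> X). diam (ultrapower \<U> X) S \<le> \<eta>))"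
proof -
  interpret scalar_field K by standard (rule assms(1))
  let ?X = "transport encode tower_space"
  interpret R: asymptotic_coefficients K ?X "encode ` finitary" "\<lambda>m p. regular_coeff m (inv encode p)" "\<lambda>m. encode (unit_vec m)"
      "\<lambda>m. 2 * (1/2)^m"
    by (rule asymptotic_coefficients_tower_space)
  show ?thesis
  proof (intro exI[of _ ?X] conjI allI impI)
    show "banach_space K ?X" by (rule banach_space_transport[OF inj_encode banach_tower_space])
    show "daugavet_property K ?X" by (rule daugavet_property_transport[OF inj_encode daugavet_tower_space])
    show "\<exists>S\<in>slices K (ultrapower \<U> ?X). diam (ultrapower \<U> ?X) S \<le> \<eta>"
      if "free_ultrafilter \<U>" for \<U>
      by (rule R.small_slice[OF that assms(2)])
  qed
qed

end
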